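(* Let $\eta$ be a nilpotent endomorphism of Jordan type $\lambda$ of an $n$-dimensional vector space $V$ over an infinite field. Let $K\in\mathcal T_{\lambda/\mu}$ be a skew chain, and let $P\in\mathcal T_\nu$ be a Young tableau such that $K\triangleright\operatorname{ch}P$. Then there is a dense open subset $\mathcal F'_{\eta,K}$ of $\mathcal F_{\eta,K}$ such that $r_{\eta_{/\lfloor f\rfloor}}(\overline f)=P$ for all $f\in\mathcal F'_{\eta,K}$.
   Context: Varieties carry the Zariski topology. For $\eta$-stable $V'$, $\eta|_{V'}$ and $\eta_{/V'}$ are the endomorphisms of $V'$ and $V/V'$ induced by $\eta$. $J(\xi)$ is the Jordan type of a nilpotent $\xi$ (the partition formed by the sizes of its Jordan blocks). A partition $\lambda$ is a weakly decreasing sequence $\lambda_0\ge\lambda_1\ge\cdots$ of natural numbers with finite sum $|\lambda|$, with Young diagram $Y(\lambda)=\{(i,j)\in\mathbb N^2:j<\lambda_i\}$; partitions are ordered by inclusion of diagrams. A Young tableau of shape $\lambda$ is an injective map $T:Y(\lambda)\to\mathbb N$ increasing along rows and columns; $\operatorname{sh}T=\lambda$; $\operatorname{ch}T$ is the saturated decreasing chain of partitions from $\lambda$ to $(0)$ obtained by recording the shapes as squares are removed in order of decreasing entries. $\mathcal T_\lambda$ is the set of tableaux of shape $\lambda$ with entries $0,\dots,|\lambda|-1$. A skew chain of shape $\lambda/\mu$ is a saturated decreasing chain of partitions from $\lambda$ to $\mu$; $\mathcal T_{\lambda/\mu}$ is the set of these. Jeu de taquin relation $\triangleright$: for a non-empty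 tableau $T$, $T^{\downarrow}$ is obtained by removing the smallest entry (in square $(0,0)$), then repeatedly moving into the empty square the smaller of the entries to its right and below it, until the empty square is a corner of the diagram, and then deleting that square (other entries keep their values); $T^{\downarrow*i}$ is the result of doing this $i$ times. For a tableau $U$, $U_{<m}$ is its subtableau of entries less than $m$, and $U_{\ge m}$ is the initial part of $\operatorname{ch}U$ from $\operatorname{sh}U$ down to $\operatorname{sh}U_{<m}$. The relation $K\triangleright K'$ on skew chains means that for some $T\in\mathcal T_\lambda$ (some $\lambda$) and some $i\le m$ one has $K=T_{\ge m}$ and $K'=(T^{\downarrow*i})_{\ge m}$. (Equivalently, $K'$ is obtained from $K$ by inward jeu de taquin slides.) In particular, for $K\in\mathcal T_{\lambda/\mu}$ with $m=|\mu|$, $K\triangleright\operatorname{ch}P$ means that some $T\in\mathcal T_\lambda$ has $T_{\ge m}=K$ and $\operatorname{ch}(T^{\downarrow*m})=\operatorname{ch}P$. For a complete flag $g=(0=g_0\subset g_1\subset\dots\subset g_d=W)$, $\dim g_i=i$, stable under a nilpotent endomorphism $\xi$ of $W$, $r_\xi(g)\in\mathcal T_{J(\xi)}$ is the tableau with $\operatorname{ch}r_\xi(g)=(J(\xi),J(\xi|_{g_{d-1}}),\dots,J(\xi|_{g_0}))$. For $m=|\mu|$, $\mathcal F^{(m)}_\eta$ is the variety of chains $f=(f_m\subset f_{m+1}\subset\cdots\subset f_n=V)$ of $\eta$-stable subspaces with $\dim f_i=i$. For $f\in\mathcal F^{(m)}_\eta$ put $\lfloor f\rfloor=f_m$; $\overline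 f=(f_m/\lfloor f\rfloor\subset\cdots\subset f_n/\lfloor f\rfloor)$, a complete $\eta_{/\lfloor f\rfloor}$-stable flag in $V/\lfloor f\rfloor$; and $r_\eta(f)=(J(\eta),J(\eta|_{f_{n-1}}),\dots,J(\eta|_{\lfloor f\rfloor}))$, a skew chain. $\mathcal F_{\eta,K}=\{f\in\mathcal F^{(m)}_\eta:r_\eta(f)=K\}$. *)

theory Defs
  imports "HOL-Analysis.Abstract_Topology" "HOL-Analysis.Function_Topology"
    "HOL-Algebra.Module" "HOL-Algebra.AbelCoset"
begin

subsection \<open>Partitions and skew chains\<close>

type_synonym partition = "nat \<Rightarrow> nat"

definition is_partition :: "partition \<Rightarrow> bool" where
  "is_partition lam \<longleftrightarrow> antimono lam \<and> finite {i. lam i \<noteq> 0}"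

definition psize :: "partition \<Rightarrow> nat" where
  "psize lam = (\<Sum>i | lam i \<noteq> 0. lam i)"

definition young_diagram :: "partition \<Rightarrow> (nat \<times> nat) set" where
  "young_diagram lam = {(i, j). j < lam i}"

definition pcovers :: "partition \<Rightarrow> partition \<Rightarrow> bool" where
  "pcovers alpha beta \<longleftrightarrow> young_diagram beta \<subset> young_diagram alpha \<and>
     \<not> (\<exists>gamma. is_partition gamma \<and> young_diagram beta \<subset> young_diagram gamma \<and>
            young_diagram gamma \<subset> young_diagram alpha)"

definition skew_chains :: "partition \<Rightarrow> partition \<Rightarrow> partition list set" where
  "skew_chains lam mu =
     {K. K \<noteq> [] \<and> hd K = lam \<and> last K = mu \<and> (\<forall>kappa\<in>set K. is_partition kappa) \<and>
         successively pcovers K}"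


subsection \<open>Young tableaux\<close>

text \<open>A tableau is a partial map whose domain is its diagram; the first component of a square
  is the row, the second the column.\<close>

type_synonym tableau = "nat \<times> nat \<Rightarrow> nat option"

definition is_tableau :: "partition \<Rightarrow> tableau \<Rightarrow> bool" where
  "is_tableau lam T \<longleftrightarrow> is_partition lam \<and> dom T = young_diagram lam \<and> inj_on T (dom T) \<and>
     (\<forall>i j a b. T (i, j) = Some a \<longrightarrow> T (i, Suc j) = Some b \<longrightarrow> a < b) \<and>
     (\<forall>i j a b. T (i, j) = Some a \<longrightarrow> T (Suc i, j) = Some b \<longrightarrow> a < b)"

definition tableaux :: "partition \<Rightarrow> tableau set" where
  "tableaux lam = {T. is_tableau lam T \<and> ran T = {..<psize lam}}"

definition tab_shape :: "tableau \<Rightarrow> partition" where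
  "tab_shape T = (\<lambda>i. card {j. (i, j) \<in> dom T})"

definition tab_less :: "tableau \<Rightarrow> nat \<Rightarrow> tableau" where
  "tab_less T m = T |` {s. \<exists>a. T s = Some a \<and> a < m}"

definition tab_chain :: "tableau \<Rightarrow> partition list" where
  "tab_chain T = tab_shape T #
     map (\<lambda>a. tab_shape (tab_less T a)) (rev (sorted_list_of_set (ran T)))"

definition tab_ge :: "tableau \<Rightarrow> nat \<Rightarrow> partition list" where
  "tab_ge T m = takeWhile (\<lambda>kappa. kappa \<noteq> tab_shape (tab_less T m)) (tab_chain T) @
     [tab_shape (tab_less T m)]"


subsection \<open>Jeu de taquin\<close>

text \<open>The empty square \<open>s\<close> is one where \<open>T s = None\<close>; it is a corner of the diagram
  \<open>dom T \<union> {s}\<close> when neither neighbour carries an entry, and deleting it then leaves \<open>T\<close> as is.\<close>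

partial_function (tailrec) slide :: "nat \<times> nat \<Rightarrow> tableau \<Rightarrow> tableau" where
  "slide s T =
     (let r = (fst s, Suc (snd s)); b = (Suc (fst s), snd s) in
      case T r of
        None \<Rightarrow> (case T b of
                  None \<Rightarrow> T
                | Some y \<Rightarrow> slide b (T(s := Some y, b := None)))
      | Some x \<Rightarrow> (case T b of
                  None \<Rightarrow> slide r (T(s := Some x, r := None))
                | Some y \<Rightarrow> if x < y then slide r (T(s := Some x, r := None))
                            else slide b (T(s := Some y, b := None))))"

text \<open>Only used for non-empty tableaux; the empty tableau is mapped to itself.\<close>

definition tab_down :: "tableau \<Rightarrow> tableau" where
  "tab_down T = slide (0, 0) (T((0, 0) := None))"

definition jdt :: "partition list \<Rightarrow> partition list \<Rightarrow> bool" where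
  "jdt K K' \<longleftrightarrow> (\<exists>lam T m i. T \<in> tableaux lam \<and> i \<le> m \<and>
     K = tab_ge T m \<and> K' = tab_ge ((tab_down ^^ i) T) m)"


subsection \<open>Jordan types, restrictions and quotients\<close>

text \<open>Vector spaces on a carrier are module records; the inherited fields \<open>mult\<close> and \<open>one\<close>
  have no meaning for them. The restriction to a subspace \<open>W\<close> is \<open>M\<lparr>carrier := W\<rparr>\<close>.\<close>

definition total_space :: "('a \<Rightarrow> 'b \<Rightarrow> 'b) \<Rightarrow> ('a, 'b::ab_group_add) module" where
  "total_space smul = \<lparr>carrier = UNIV, mult = (\<lambda>_ _. undefined), one = undefined,
     zero = 0, add = (+), smult = smul\<rparr>"

definition quotient_space :: "('a, 'v) module \<Rightarrow> 'v set \<Rightarrow> ('a, 'v set) module" where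
  "quotient_space M U = \<lparr>carrier = a_rcosets\<^bsub>M\<^esub> U, mult = (\<lambda>_ _. undefined), one = undefined,
     zero = U, add = (<+>\<^bsub>M\<^esub>), smult = (\<lambda>c C. \<Union>x\<in>C. U +>\<^bsub>M\<^esub> (c \<odot>\<^bsub>M\<^esub> x))\<rparr>"

definition quotient_map_of :: "('a, 'v) module \<Rightarrow> 'v set \<Rightarrow> ('v \<Rightarrow> 'v) \<Rightarrow> 'v set \<Rightarrow> 'v set" where
  "quotient_map_of M U xi = (\<lambda>C. \<Union>x\<in>C. U +>\<^bsub>M\<^esub> xi x)"

text \<open>The vectors \<open>e (i, 0), \<dots>, e (i, lam i - 1)\<close> span the \<open>i\<close>-th Jordan block.\<close>

definition jordan_basis ::
  "('a, 'v) module \<Rightarrow> ('v \<Rightarrow> 'v) \<Rightarrow> partition \<Rightarrow> (nat \<times> nat \<Rightarrow> 'v) \<Rightarrow> bool" where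
  "jordan_basis M xi lam e \<longleftrightarrow>
     e ` young_diagram lam \<subseteq> carrier M \<and>
     (\<forall>x\<in>carrier M. \<exists>!c. c \<in> extensional (young_diagram lam) \<and>
        x = (\<Oplus>\<^bsub>M\<^esub>s\<in>young_diagram lam. c s \<odot>\<^bsub>M\<^esub> e s)) \<and>
     (\<forall>(i, j)\<in>young_diagram lam.
        xi (e (i, j)) = (if j = 0 then \<zero>\<^bsub>M\<^esub> else e (i, j - 1)))"

definition jordan_type :: "('a, 'v) module \<Rightarrow> ('v \<Rightarrow> 'v) \<Rightarrow> partition" where
  "jordan_type M xi = (THE lam. is_partition lam \<and> (\<exists>e. jordan_basis M xi lam e))"

text \<open>\<open>flag_tableau M xi d g\<close> is the tableau of a complete flag \<open>g 0, \<dots>, g d\<close> of the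
  \<open>d\<close>-dimensional space \<open>M\<close>.\<close>

definition flag_tableau ::
  "('a, 'v) module \<Rightarrow> ('v \<Rightarrow> 'v) \<Rightarrow> nat \<Rightarrow> (nat \<Rightarrow> 'v set) \<Rightarrow> tableau" where
  "flag_tableau M xi d g = (THE T. T \<in> tableaux (jordan_type M xi) \<and>
     tab_chain T = map (\<lambda>i. jordan_type (M\<lparr>carrier := g i\<rparr>) xi) (rev [0..<Suc d]))"


subsection \<open>Varieties of partial flags\<close>

context
  fixes smul :: "'a::field \<Rightarrow> 'b::ab_group_add \<Rightarrow> 'b"
begin

definition partial_flags :: "nat \<Rightarrow> (nat \<Rightarrow> 'b set) set" where
  "partial_flags m = (let n = vector_space.dim smul UNIV in
     {f \<in> extensional {m..n}.
        (\<forall>i\<in>{m..n}. module.subspace smul (f i) \<and> vector_space.dim smul (f i) = i) \<and>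
        (\<forall>i\<in>{m..n}. \<forall>j\<in>{m..n}. i \<le> j \<longrightarrow> f i \<subseteq> f j)})"

definition frames :: "(nat \<Rightarrow> 'b) set" where
  "frames = (let n = vector_space.dim smul UNIV in
     {v \<in> extensional {..<n}. inj_on v {..<n} \<and> \<not> module.dependent smul (v ` {..<n})})"

definition frame_flag :: "nat \<Rightarrow> (nat \<Rightarrow> 'b) \<Rightarrow> nat \<Rightarrow> 'b set" where
  "frame_flag m v = (\<lambda>i\<in>{m..vector_space.dim smul UNIV}. module.span smul (v ` {..<i}))"

text \<open>Polynomial functions on the affine space of \<open>n\<close>-tuples of vectors: the algebra generated
  by the linear functionals of the components.\<close>

inductive_set poly_funs :: "((nat \<Rightarrow> 'b) \<Rightarrow> 'a) set" where
  const: "(\<lambda>_. c) \<in> poly_funs"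
| coord: "i < vector_space.dim smul UNIV \<Longrightarrow> Vector_Spaces.linear smul (*) phi \<Longrightarrow>
    (\<lambda>v. phi (v i)) \<in> poly_funs"
| add: "p \<in> poly_funs \<Longrightarrow> q \<in> poly_funs \<Longrightarrow> (\<lambda>v. p v + q v) \<in> poly_funs"
| mult: "p \<in> poly_funs \<Longrightarrow> q \<in> poly_funs \<Longrightarrow> (\<lambda>v. p v * q v) \<in> poly_funs"

definition frame_topology :: "(nat \<Rightarrow> 'b) topology" where
  "frame_topology = topology_generated_by {{v \<in> frames. p v \<noteq> 0} | p. p \<in> poly_funs}"

text \<open>The frames form a torsor under the general linear group, and the variety of partial flags is its
  quotient by a parabolic subgroup; its Zariski topology is the quotient topology. (The map from
  frames to flags has regular sections over the open cells, which are defined over the base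
  field, so on rational points this is also the topology induced by the Pluecker embedding.)\<close>

definition flag_topology :: "nat \<Rightarrow> (nat \<Rightarrow> 'b set) topology" where
  "flag_topology m = topology (\<lambda>S. S \<subseteq> partial_flags m \<and>
     openin frame_topology {v \<in> frames. frame_flag m v \<in> S})"

lemma openin_flag_topology:
  "openin (flag_topology m) S \<longleftrightarrow>
     S \<subseteq> partial_flags m \<and> openin frame_topology {v \<in> frames. frame_flag m v \<in> S}"
proof -
  have "istopology (\<lambda>S. S \<subseteq> partial_flags m \<and>
     openin frame_topology {v \<in> frames. frame_flag m v \<in> S})"
    unfolding istopology_def
  proof (intro conjI allI impI; (elim conjE)?)
    fix S T
    assume "openin frame_topology {v \<in> frames. frame_flag m v \<in> S}"
      "openin frame_topology {v \<in> frames. frame_flag m v \<in> T}"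
    then have "openin frame_topology
       ({v \<in> frames. frame_flag m v \<in> S} \<inter> {v \<in> frames. frame_flag m v \<in> T})"
      by (rule openin_Int)
    moreover have "{v \<in> frames. frame_flag m v \<in> S} \<inter> {v \<in> frames. frame_flag m v \<in> T} =
       {v \<in> frames. frame_flag m v \<in> S \<inter> T}" by auto
    ultimately show "openin frame_topology {v \<in> frames. frame_flag m v \<in> S \<inter> T}" by simp
  next
    fix \<K>
    assume *: "\<forall>S\<in>\<K>. S \<subseteq> partial_flags m \<and>
      openin frame_topology {v \<in> frames. frame_flag m v \<in> S}"
    have "{v \<in> frames. frame_flag m v \<in> \<Union>\<K>} = (\<Union>S\<in>\<K>. {v \<in> frames. frame_flag m v \<in> S})"
      by auto
    then show "openin frame_topology {v \<in> frames. frame_flag m v \<in> \<Union>\<K>}"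
      using * by (auto intro!: openin_Union)
  qed auto
  then show ?thesis
    unfolding flag_topology_def by (simp add: topology_inverse')
qed

definition stable_flags :: "('b \<Rightarrow> 'b) \<Rightarrow> nat \<Rightarrow> (nat \<Rightarrow> 'b set) set" where
  "stable_flags eta m =
     {f \<in> partial_flags m. \<forall>i\<in>{m..vector_space.dim smul UNIV}. eta ` f i \<subseteq> f i}"

definition flag_skew_chain :: "('b \<Rightarrow> 'b) \<Rightarrow> nat \<Rightarrow> (nat \<Rightarrow> 'b set) \<Rightarrow> partition list" where
  "flag_skew_chain eta m f =
     map (\<lambda>i. jordan_type ((total_space smul)\<lparr>carrier := f i\<rparr>) eta)
       (rev [m..<Suc (vector_space.dim smul UNIV)])"

definition flags_of_chain :: "('b \<Rightarrow> 'b) \<Rightarrow> nat \<Rightarrow> partition list \<Rightarrow> (nat \<Rightarrow> 'b set) set" where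
  "flags_of_chain eta m K = {f \<in> stable_flags eta m. flag_skew_chain eta m f = K}"

definition quotient_flag :: "nat \<Rightarrow> (nat \<Rightarrow> 'b set) \<Rightarrow> nat \<Rightarrow> 'b set set" where
  "quotient_flag m f i = (\<lambda>x. f m +>\<^bsub>total_space smul\<^esub> x) ` f (m + i)"

definition quotient_flag_tableau :: "('b \<Rightarrow> 'b) \<Rightarrow> nat \<Rightarrow> (nat \<Rightarrow> 'b set) \<Rightarrow> tableau" where
  "quotient_flag_tableau eta m f =
     flag_tableau (quotient_space (total_space smul) (f m))
       (quotient_map_of (total_space smul) (f m) eta)
       (vector_space.dim smul UNIV - m) (quotient_flag m f)"

end

end

theory Submission
  imports Defs "HOL-Computational_Algebra.Polynomial"
begin

text \<open>
  Any two flags of the same type are joined by a polynomial curve of flags of that type: two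
  hyperplanes of the same type differ by a unipotent map \<open>1 + D\<close> commuting with \<open>\<eta>\<close>, and \<open>1 + t D\<close>
  interpolates. As ranks are lower semicontinuous and the field is infinite, a rank condition that
  holds for one flag holds on a dense open set, and it suffices to find the maximal ranks of the powers
  of \<open>\<eta>\<close> on \<open>f\<^sub>j / f\<^sub>i\<close>.

  Dividing a complete flag by its line \<open>f\<^sub>1\<close>, one square is removed from each shape. The column of that
  square weakly increases with \<open>j\<close>, and this alone bounds it below by the column of the empty square of
  the jeu de taquin slide. Conversely, if the line is fixed, a suitable choice of hyperplanes from the top
  down attains the bound. Applying both facts in turn to \<open>f\<^sub>1, f\<^sub>2, \<dots>\<close> shows that the generic types of the
  \<open>f\<^sub>j / f\<^sub>i\<close> form the growth diagram of the iterated slides.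
\<close>

section \<open>Linear algebra and generic ranks\<close>

text \<open>Genericity acts in two opposite directions. If the type over U is fixed, larger ranks
  modulo a line L mean a smaller column of L; if L and the type over L are fixed, larger ranks
  modulo U mean a larger one. Among flags of prescribed type over U, generic ones therefore push the
  columns down to those of the slide; among flags above one line, of the slid type over it, generic
  ones push them up to the same values. This is why \<open>growth\<close> proves existence and the
  rank bound in one induction: existence over U needs the bound over L, and the bound over U needs
  existence over U.

  Complete flags enter because lines are divided out one at a time. A partial flag is therefore
  completed inside its lowest member, with types read off from a tableau that realises the relation
  between K and P.

  The hard point is existence above a fixed line. A hyperplane of the right type over L has one of
  two possible line columns, and in one case the wrong one is avoided only by forcing the hyperplane
  through a chosen vector.\<close>

locale fin_dim_space = finite_dimensional_vector_space scale Basis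
  for scale :: "'a::field \<Rightarrow> 'b::ab_group_add \<Rightarrow> 'b" (infixr \<open>*s\<close> 75) and Basis
begin

abbreviation endo :: "('b \<Rightarrow> 'b) \<Rightarrow> bool" where
  "endo g \<equiv> Vector_Spaces.linear scale scale g"

abbreviation functional :: "('b \<Rightarrow> 'a) \<Rightarrow> bool" where
  "functional \<phi> \<equiv> Vector_Spaces.linear scale (*) \<phi>"

text \<open>This is g(W) + S.\<close>

definition msum :: "('b \<Rightarrow> 'b) \<Rightarrow> 'b set \<Rightarrow> 'b set \<Rightarrow> 'b set" where
  "msum g W S = {y. \<exists>x\<in>W. y - g x \<in> S}"

text \<open>Indexing keeps track of repetitions: two equal vectors count as dependent, also while
  the family moves with a parameter.\<close>

definition indep_family :: "'s set \<Rightarrow> ('s \<Rightarrow> 'b) \<Rightarrow> bool" where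
  "indep_family S u \<longleftrightarrow> (\<forall>c. (\<Sum>s\<in>S. c s *s u s) = 0 \<longrightarrow> (\<forall>s\<in>S. c s = 0))"

lemma indep_familyD:
  "indep_family S u \<Longrightarrow> (\<Sum>s\<in>S. c s *s u s) = 0 \<Longrightarrow> s \<in> S \<Longrightarrow> c s = 0"
  unfolding indep_family_def by blast

lemma subspace_msum:
  assumes g: "endo g" and W: "subspace W" and S: "subspace S"
  shows "subspace (msum g W S)"
proof (rule subspaceI)
  interpret g: Vector_Spaces.linear scale scale g by fact
  show "0 \<in> msum g W S"
    unfolding msum_def using subspace_0[OF W] subspace_0[OF S] by (auto intro!: bexI[of _ 0])
next
  interpret g: Vector_Spaces.linear scale scale g by fact
  fix x y assume "x \<in> msum g W S" "y \<in> msum g W S"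
  then obtain a b where ab: "a \<in> W" "b \<in> W" "x - g a \<in> S" "y - g b \<in> S"
    unfolding msum_def by auto
  have "(x + y) - g (a + b) = (x - g a) + (y - g b)" by (simp add: g.add)
  then have "(x + y) - g (a + b) \<in> S" using subspace_add[OF S ab(3,4)] by metis
  then show "x + y \<in> msum g W S"
    unfolding msum_def using subspace_add[OF W ab(1,2)] by blast
next
  interpret g: Vector_Spaces.linear scale scale g by fact
  fix c x assume "x \<in> msum g W S"
  then obtain a where a: "a \<in> W" "x - g a \<in> S" unfolding msum_def by auto
  have "c *s x - g (c *s a) = c *s (x - g a)" by (simp add: g.scale scale_right_diff_distrib)
  then have "c *s x - g (c *s a) \<in> S" using subspace_scale[OF S a(2), of c] by metis
  then show "c *s x \<in> msum g W S"
    unfolding msum_def using subspace_scale[OF W a(1), of c] by blast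
qed

lemma indep_family_iff:
  assumes "finite S"
  shows "indep_family S u \<longleftrightarrow> inj_on u S \<and> independent (u ` S)"
proof
  assume ind: "indep_family S u"
  have inj: "inj_on u S"
  proof (rule inj_onI, rule ccontr)
    fix x y assume xy: "x \<in> S" "y \<in> S" "u x = u y" "x \<noteq> y"
    let ?c = "\<lambda>s. if s = x then 1 else if s = y then - 1 else (0::'a)"
    have "(\<Sum>s\<in>S. ?c s *s u s) = (\<Sum>s\<in>{x, y}. ?c s *s u s)"
      using xy assms by (intro sum.mono_neutral_right) auto
    also have "\<dots> = 0" using xy by simp
    finally have "?c x = 0" by (rule indep_familyD[OF ind _ xy(1)])
    then show False by simp
  qed
  moreover have "independent (u ` S)"
  proof (rule independent_if_scalars_zero)
    fix c x assume 0: "(\<Sum>x\<in>u ` S. c x *s x) = 0" and "x \<in> u ` S"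
    then obtain s where s: "s \<in> S" "x = u s" by auto
    have "(\<Sum>s\<in>S. c (u s) *s u s) = 0" using 0 inj by (simp add: sum.reindex)
    then show "c x = 0" using indep_familyD[OF ind, where c = "\<lambda>s. c (u s)"] s by auto
  qed (use assms in auto)
  ultimately show "inj_on u S \<and> independent (u ` S)" by simp
next
  assume *: "inj_on u S \<and> independent (u ` S)"
  show "indep_family S u" unfolding indep_family_def
  proof (intro allI impI ballI)
    fix c s assume 0: "(\<Sum>s\<in>S. c s *s u s) = 0" and s: "s \<in> S"
    let ?c = "\<lambda>x. c (the_inv_into S u x)"
    have "(\<Sum>x\<in>u ` S. ?c x *s x) = (\<Sum>s\<in>S. c s *s u s)"
      using * by (simp add: sum.reindex the_inv_into_f_f)
    then have "?c (u s) = 0"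
      using * 0 s assms independentD[of "u ` S" "u ` S" ?c "u s"] by auto
    then show "c s = 0" using * s by (simp add: the_inv_into_f_f)
  qed
qed

lemma vector_space_field: "vector_space ((*) :: 'a \<Rightarrow> 'a \<Rightarrow> 'a)"
  by unfold_locales (simp_all add: algebra_simps)

lemma separating_functional:
  assumes S: "subspace S" and y: "y \<notin> S"
  shows "\<exists>\<phi>. functional \<phi> \<and> (\<forall>x\<in>S. \<phi> x = 0) \<and> \<phi> y = 1"
proof -
  interpret F: vector_space "(*) :: 'a \<Rightarrow> 'a \<Rightarrow> 'a" by (rule vector_space_field)
  interpret P: vector_space_pair scale "(*) :: 'a \<Rightarrow> 'a \<Rightarrow> 'a" ..
  obtain B where B: "B \<subseteq> S" "independent B" "S \<subseteq> span B" using basis_exists[of S] by metis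
  have sB: "span B = S" using B S span_subspace by blast
  then have "independent (insert y B)" using y B(2) by (intro independent_insertI) auto
  then obtain \<phi> where phi: "functional \<phi>"
    "\<forall>x\<in>insert y B. \<phi> x = (if x = y then 1 else 0)"
    using P.linear_independent_extend[of "insert y B" "\<lambda>x. if x = y then 1 else 0"] by blast
  interpret L: Vector_Spaces.linear scale "(*)" \<phi> by fact
  have "y \<notin> B" using B(1) y by auto
  then have "\<phi> x = 0" if "x \<in> B" for x using phi(2) that by (metis insertCI)
  then have "\<phi> x = 0" if "x \<in> S" for x using L.eq_0_on_span[of B x] sB that by blast
  then show ?thesis using phi by auto
qed

text \<open>Elimination with one pivot at a time, so that no determinants are needed; \<open>A\<close> is
  instantiated with the polynomial functions on frames and with those of one variable.\<close>

lemma indep_family_generic: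
  fixes A :: "('x \<Rightarrow> 'a) set"
  assumes const: "\<And>c. (\<lambda>_. c) \<in> A" and add: "\<And>p q. p \<in> A \<Longrightarrow> q \<in> A \<Longrightarrow> (\<lambda>x. p x + q x) \<in> A"
    and mult: "\<And>p q. p \<in> A \<Longrightarrow> q \<in> A \<Longrightarrow> (\<lambda>x. p x * q x) \<in> A"
    and "finite S"
    and "\<And>s \<phi>. s \<in> S \<Longrightarrow> functional \<phi> \<Longrightarrow> (\<lambda>x. \<phi> (w s x)) \<in> A"
    and "indep_family S (\<lambda>s. w s x0)"
  shows "\<exists>p\<in>A. p x0 \<noteq> 0 \<and> (\<forall>x. p x \<noteq> 0 \<longrightarrow> indep_family S (\<lambda>s. w s x))"
  using assms(4-)
proof (induction S arbitrary: w rule: finite_induct)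
  case empty
  then show ?case using const[of 1] by (intro bexI[of _ "\<lambda>_. 1"]) (auto simp: indep_family_def)
next
  case (insert r S w)
  have "w r x0 \<noteq> 0"
  proof
    assume 0: "w r x0 = 0"
    have "(\<Sum>s\<in>insert r S. (if s = r then 1 else 0) *s w s x0) = 0"
      using insert.hyps 0 by (auto intro!: sum.neutral)
    from indep_familyD[OF insert.prems(2) this, of r] show False by simp
  qed
  then obtain \<phi> where phi: "functional \<phi>" "\<phi> (w r x0) = 1"
    using separating_functional[of "{0}" "w r x0"] by auto
  interpret L: Vector_Spaces.linear scale "(*)" \<phi> by fact
  \<comment> \<open>Fraction-free elimination: every vector is multiplied by the pivot instead of
    dividing by it, so that all coordinates stay in \<open>A\<close>.\<close>
  define w' where "w' s x = \<phi> (w r x) *s w s x - \<phi> (w s x) *s w r x" for s x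
  have *: "(\<Sum>s\<in>S. c s *s w' s x) =
      \<phi> (w r x) *s (\<Sum>s\<in>S. c s *s w s x) - \<phi> (\<Sum>s\<in>S. c s *s w s x) *s w r x" for c x
    by (simp add: w'_def scale_right_diff_distrib sum_subtractf scale_sum_right L.sum L.scale
        scale_sum_left mult.commute)
  have A': "(\<lambda>x. \<psi> (w' s x)) \<in> A" if s: "s \<in> S" and psi: "functional \<psi>" for s \<psi>
  proof -
    interpret M: Vector_Spaces.linear scale "(*)" \<psi> by fact
    have "(\<lambda>x. \<psi> (w' s x)) = (\<lambda>x. \<phi> (w r x) * \<psi> (w s x) + (- 1) * (\<phi> (w s x) * \<psi> (w r x)))"
      by (simp add: w'_def M.diff M.scale)
    also have "\<dots> \<in> A"
      by (intro add mult const insert.prems(1) psi phi(1)) (use s in auto)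
    finally show ?thesis .
  qed
  have I': "indep_family S (\<lambda>s. w' s x0)"
    unfolding indep_family_def
  proof (intro allI impI ballI)
    fix c s assume 0: "(\<Sum>s\<in>S. c s *s w' s x0) = 0" and s: "s \<in> S"
    let ?c = "\<lambda>s. if s = r then - \<phi> (\<Sum>s\<in>S. c s *s w s x0) else c s"
    have "(\<Sum>s\<in>S. ?c s *s w s x0) = (\<Sum>s\<in>S. c s *s w s x0)"
      using insert.hyps by (intro sum.cong) auto
    then have "(\<Sum>s\<in>insert r S. ?c s *s w s x0) = 0"
      using insert.hyps 0 unfolding * phi(2) by simp
    from indep_familyD[OF insert.prems(2) this, of s]
    show "c s = 0" using s insert.hyps by (auto split: if_splits)
  qed
  from insert.IH[of w', OF A' I'] obtain p where p: "p \<in> A" "p x0 \<noteq> 0"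
    "\<And>x. p x \<noteq> 0 \<Longrightarrow> indep_family S (\<lambda>s. w' s x)" by auto
  show ?case
  proof (intro bexI[of _ "\<lambda>x. p x * \<phi> (w r x)"] conjI allI impI)
    show "(\<lambda>x. p x * \<phi> (w r x)) \<in> A"
      by (intro mult p(1) insert.prems(1) phi(1)) auto
    show "p x0 * \<phi> (w r x0) \<noteq> 0" using p(2) phi(2) by simp
    fix x assume x: "p x * \<phi> (w r x) \<noteq> 0"
    then have I: "indep_family S (\<lambda>s. w' s x)" and nz: "\<phi> (w r x) \<noteq> 0" using p(3) by auto
    show "indep_family (insert r S) (\<lambda>s. w s x)" unfolding indep_family_def
    proof (intro allI impI)
      fix c assume 0: "(\<Sum>s\<in>insert r S. c s *s w s x) = 0"
      define y where "y = (\<Sum>s\<in>S. c s *s w s x)"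
      have y: "c r *s w r x = - y" using 0 insert.hyps y_def by (simp add: eq_neg_iff_add_eq_0)
      then have "\<phi> (c r *s w r x) = \<phi> (- y)" by simp
      then have "c r * \<phi> (w r x) = - \<phi> y" by (simp add: L.neg L.scale)
      then have "\<phi> y *s w r x = - \<phi> (w r x) *s (c r *s w r x)" by (simp add: mult.commute)
      then have "(\<Sum>s\<in>S. c s *s w' s x) = 0" unfolding * y_def[symmetric] y by simp
      then have z: "\<forall>s\<in>S. c s = 0" using indep_familyD[OF I, where c = c] by blast
      then have "y = 0" unfolding y_def by simp
      then have "c r *s w r x = 0" using y by simp
      moreover have "w r x \<noteq> 0" using nz L.zero by metis
      ultimately show "\<forall>s\<in>insert r S. c s = 0" using z by simp
    qed
  qed
qed

text \<open>Lower semicontinuity of rank: a subfamily that is a basis of the span at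
  \<open>x0\<close> stays independent wherever \<open>p\<close> does not vanish.\<close>

lemma dim_span_generic:
  fixes A :: "('x \<Rightarrow> 'a) set"
  assumes const: "\<And>c. (\<lambda>_. c) \<in> A" and add: "\<And>p q. p \<in> A \<Longrightarrow> q \<in> A \<Longrightarrow> (\<lambda>x. p x + q x) \<in> A"
    and mult: "\<And>p q. p \<in> A \<Longrightarrow> q \<in> A \<Longrightarrow> (\<lambda>x. p x * q x) \<in> A"
    and S: "finite S"
    and w: "\<And>s \<phi>. s \<in> S \<Longrightarrow> functional \<phi> \<Longrightarrow> (\<lambda>x. \<phi> (w s x)) \<in> A"
  shows "\<exists>p\<in>A. p x0 \<noteq> 0 \<and>
    (\<forall>x. p x \<noteq> 0 \<longrightarrow> dim (span ((\<lambda>s. w s x0) ` S)) \<le> dim (span ((\<lambda>s. w s x) ` S)))"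
proof -
  obtain B where B: "B \<subseteq> (\<lambda>s. w s x0) ` S" "independent B" "(\<lambda>s. w s x0) ` S \<subseteq> span B"
    "card B = dim ((\<lambda>s. w s x0) ` S)"
    using basis_exists[of "(\<lambda>s. w s x0) ` S"] by metis
  obtain S' where S': "S' \<subseteq> S" "inj_on (\<lambda>s. w s x0) S'" "B = (\<lambda>s. w s x0) ` S'"
    using B(1) subset_image_inj[of B "\<lambda>s. w s x0" S] by auto
  have fin: "finite S'" using S S'(1) finite_subset by blast
  have "indep_family S' (\<lambda>s. w s x0)" using indep_family_iff[OF fin] S' B(2) by simp
  then obtain p where p: "p \<in> A" "p x0 \<noteq> 0" "\<And>x. p x \<noteq> 0 \<Longrightarrow> indep_family S' (\<lambda>s. w s x)"
    using indep_family_generic[of A S' w x0, OF const add mult fin w] S'(1) by blast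
  show ?thesis
  proof (intro bexI[OF _ p(1)] conjI p(2) allI impI)
    fix x assume "p x \<noteq> 0"
    then have "inj_on (\<lambda>s. w s x) S'" "independent ((\<lambda>s. w s x) ` S')"
      using p(3) indep_family_iff[OF fin] by auto
    then have "card S' \<le> dim ((\<lambda>s. w s x) ` S)"
      by (metis S'(1) card_image image_mono independent_card_le_dim)
    moreover have "card B = card S'" using S' card_image by blast
    ultimately show "dim (span ((\<lambda>s. w s x0) ` S)) \<le> dim (span ((\<lambda>s. w s x) ` S))"
      using B(4) by simp
  qed
qed

section \<open>Hyperplanes and rank-nullity\<close>

lemma span_of_subspace: "subspace H \<Longrightarrow> span H = H"
  by simp

lemma dim_hyperplane:
  assumes "subspace H" "x \<notin> H" "W = span (insert x H)"
  shows "dim W = Suc (dim H)"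
  using assms dim_insert[of x H] by (simp add: span_of_subspace)

lemma hyperplane_span:
  assumes H: "subspace H" and W: "subspace W" and HW: "H \<subseteq> W" and d: "dim W = Suc (dim H)"
    and x: "x \<in> W" "x \<notin> H"
  shows "W = span (insert x H)"
proof -
  have "span (insert x H) \<subseteq> W" using HW x W by (intro span_minimal) auto
  moreover have "dim (span (insert x H)) = Suc (dim H)" using dim_hyperplane[OF H x(2) refl] .
  ultimately show ?thesis using subspace_dim_equal[of "span (insert x H)" W] W d by auto
qed

lemma hyperplane_decompose:
  assumes "subspace H" "subspace W" "H \<subseteq> W" "dim W = Suc (dim H)" "x \<in> W" "x \<notin> H" "y \<in> W"
  shows "\<exists>a. y - a *s x \<in> H"
  using hyperplane_span[OF assms(1-6)] assms(1,7) span_breakdown_eq[of y x H]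
  by (simp add: span_of_subspace)

lemma hyperplane_exists:
  assumes S: "subspace S" and W: "subspace W" and SW: "S \<subseteq> W" and x: "x \<in> W" "x \<notin> S"
  shows "\<exists>H. subspace H \<and> S \<subseteq> H \<and> H \<subseteq> W \<and> x \<notin> H \<and> dim W = Suc (dim H)"
proof -
  obtain \<phi> where phi: "functional \<phi>" "\<forall>x\<in>S. \<phi> x = 0" "\<phi> x = 1"
    using separating_functional[OF S x(2)] by auto
  interpret L: Vector_Spaces.linear scale "(*)" \<phi> by fact
  let ?H = "W \<inter> {y. \<phi> y = 0}"
  have H: "subspace ?H" using W L.subspace_kernel by (rule subspace_inter)
  have "y \<in> span (insert x ?H)" if "y \<in> W" for y
  proof -
    have "y - \<phi> y *s x \<in> ?H"
      using that x(1) W phi(3) by (auto simp: L.diff L.scale intro!: subspace_diff subspace_scale)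
    then show ?thesis unfolding span_breakdown_eq using span_base[of "y - \<phi> y *s x" ?H] by metis
  qed
  moreover have "span (insert x ?H) \<subseteq> W" using x W by (intro span_minimal) auto
  ultimately have "W = span (insert x ?H)" by auto
  then have "dim W = Suc (dim ?H)" using phi(3) by (intro dim_hyperplane[OF H, of x]) auto
  then show ?thesis using H phi SW by (intro exI[of _ ?H]) auto
qed

text \<open>Rank-nullity for the map from W to V / S induced by g, without the quotient. The
  induction climbs from the kernel to W through hyperplanes; each step adds one dimension to both
  sides.\<close>

lemma dim_msum:
  assumes g: "endo g" and W: "subspace W" and S: "subspace S"
  shows "dim (msum g W S) + dim {x \<in> W. g x \<in> S} = dim W + dim S"
proof -
  interpret g: Vector_Spaces.linear scale scale g by fact
  let ?Z = "{x \<in> W. g x \<in> S}"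
  have eqZ: "?Z = W \<inter> {x. g x \<in> S}" by auto
  have Z: "subspace ?Z"
    unfolding eqZ by (intro subspace_inter W g.subspace_linear_preimage S)
  have "dim (msum g X S) + dim ?Z = dim X + dim S" if "subspace X" "?Z \<subseteq> X" "X \<subseteq> W" for X
    using that
  proof (induction "dim X" arbitrary: X)
    case 0
    then have "X \<subseteq> {0}" by (metis dim_eq_0)
    then have X: "X = {0}" using subspace_0[OF \<open>subspace X\<close>] by auto
    then have "msum g X S = S" by (simp add: msum_def)
    moreover have "?Z = {0}" using 0(3) X subspace_0[OF Z] by auto
    ultimately show ?case using X by simp
  next
    case (Suc d)
    show ?case
    proof (cases "X = ?Z")
      case True
      then have "y \<in> msum g X S \<longleftrightarrow> y \<in> S" for y
      proof -
        have "y \<in> S" if "y - g x \<in> S" "g x \<in> S" for x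
          using subspace_add[OF S that] by simp
        moreover have "y - g 0 \<in> S" if "y \<in> S" using that by simp
        ultimately show ?thesis unfolding msum_def True using subspace_0[OF Z] by blast
      qed
      then have "msum g X S = S" by auto
      then show ?thesis using True by simp
    next
      case False
      then obtain x where x: "x \<in> X" "x \<notin> ?Z" using Suc.prems by auto
      from hyperplane_exists[OF Z Suc.prems(1,2) x] obtain H where
        H: "subspace H" "?Z \<subseteq> H" "H \<subseteq> X" "x \<notin> H" "dim X = Suc (dim H)" by metis
      have IH: "dim (msum g H S) + dim ?Z = dim H + dim S"
        using Suc.hyps(1)[of H] H Suc.hyps(2) Suc.prems by auto
      have n: "g x \<notin> msum g H S"
      proof
        assume "g x \<in> msum g H S"
        then obtain h where "h \<in> H" "g x - g h \<in> S" unfolding msum_def by auto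
        then have "x - h \<in> ?Z" using x H Suc.prems(3)
          by (auto simp: g.diff intro!: subspace_diff W)
        then have "x - h \<in> H" using H by auto
        then show False using H(4) subspace_add[OF H(1) _ \<open>h \<in> H\<close>] by (metis diff_add_cancel)
      qed
      have sub: "subspace (msum g H S)" "subspace (msum g X S)"
        using subspace_msum g S H Suc.prems by auto
      have "msum g X S = span (insert (g x) (msum g H S))"
      proof
        show "msum g X S \<subseteq> span (insert (g x) (msum g H S))"
        proof
          fix y assume "y \<in> msum g X S"
          then obtain z where z: "z \<in> X" "y - g z \<in> S" unfolding msum_def by auto
          obtain a where a: "z - a *s x \<in> H"
            using hyperplane_decompose[OF H(1) Suc.prems(1) H(3,5) x(1) H(4) z(1)] by auto
          have "(y - a *s g x) - g (z - a *s x) \<in> S" using z by (simp add: g.diff g.scale)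
          then have "y - a *s g x \<in> msum g H S" unfolding msum_def using a by blast
          then show "y \<in> span (insert (g x) (msum g H S))"
            unfolding span_breakdown_eq using span_base by blast
        qed
        have "g x \<in> msum g X S" unfolding msum_def using x(1) subspace_0[OF S]
          by (auto intro!: bexI[of _ x])
        moreover have "msum g H S \<subseteq> msum g X S" unfolding msum_def using H by auto
        ultimately show "span (insert (g x) (msum g H S)) \<subseteq> msum g X S"
          using sub by (intro span_minimal) auto
      qed
      then have "dim (msum g X S) = Suc (dim (msum g H S))" using dim_hyperplane[OF sub(1) n]
        by simp
      then show ?thesis using IH H(5) by simp
    qed
  qed
  then show ?thesis using W by auto
qed

end

section \<open>Types of subquotients\<close>

locale nilpotent_endo = fin_dim_space scale Basis
  for scale :: "'a::field \<Rightarrow> 'b::ab_group_add \<Rightarrow> 'b" (infixr \<open>*s\<close> 75) and Basis +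
  fixes eta :: "'b \<Rightarrow> 'b" and N :: nat
  assumes linear_eta: "endo eta"
    and eta_N: "(eta ^^ N) v = 0"
begin

lemma linear_pow: "endo (eta ^^ k)"
proof (induction k)
  case 0
  show ?case unfolding Vector_Spaces.linear_iff using vector_space_axioms by simp
next
  case (Suc k)
  from Vector_Spaces.linear_compose[OF this linear_eta] show ?case by (simp add: comp_def)
qed

lemma pow_add: "(eta ^^ k) (x + y) = (eta ^^ k) x + (eta ^^ k) y"
  and pow_diff: "(eta ^^ k) (x - y) = (eta ^^ k) x - (eta ^^ k) y"
  and pow_scale: "(eta ^^ k) (c *s x) = c *s (eta ^^ k) x"
  and pow_zero: "(eta ^^ k) 0 = 0"
proof -
  interpret L: Vector_Spaces.linear scale scale "eta ^^ k" by (rule linear_pow)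
  show "(eta ^^ k) (x + y) = (eta ^^ k) x + (eta ^^ k) y"
    "(eta ^^ k) (x - y) = (eta ^^ k) x - (eta ^^ k) y"
    "(eta ^^ k) (c *s x) = c *s (eta ^^ k) x" "(eta ^^ k) 0 = 0"
    by (auto simp: L.add L.diff L.scale)
qed

lemmas eta_add = pow_add[of 1, simplified]
  and eta_diff = pow_diff[of 1, simplified]
  and eta_scale = pow_scale[of 1, simplified]
  and eta_zero = pow_zero[of 1, simplified]

lemma pow_eta: "(eta ^^ k) (eta x) = (eta ^^ Suc k) x"
  by (simp add: funpow_swap1)

section \<open>Images, ranks and columns of a subquotient\<close>

definition stable :: "'b set \<Rightarrow> bool" where
  "stable W \<longleftrightarrow> subspace W \<and> eta ` W \<subseteq> W"

text \<open>For U \<subseteq> W with W stable this is the preimage in W of the image of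
  \<open>eta ^^ k\<close> on W / U. Hence \<open>rank\<close> exceeds the rank on W / U by dim
  U.\<close>

definition im :: "nat \<Rightarrow> 'b set \<Rightarrow> 'b set \<Rightarrow> 'b set" where
  "im k W U = msum (eta ^^ k) W U"

definition rank :: "nat \<Rightarrow> 'b set \<Rightarrow> 'b set \<Rightarrow> nat" where
  "rank k W U = dim (im k W U)"

text \<open>Column \<open>k\<close> of the Young diagram of the Jordan type of \<open>eta\<close> on \<open>W / U\<close>. Working with columns
  and with pairs \<open>U \<subseteq> W\<close> inside the ambient space avoids quotient spaces altogether.\<close>

definition cols :: "'b set \<Rightarrow> 'b set \<Rightarrow> nat \<Rightarrow> nat" where
  "cols W U k = rank k W U - rank (Suc k) W U"

text \<open>Its codimension in \<open>W\<close> is \<open>cols W U k\<close>; passing from \<open>W\<close> to a stable hyperplane \<open>H\<close> removes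
  a square from the column \<open>k\<close> for which \<open>H\<close> contains \<open>Zs W U k\<close> but not \<open>Zs W U (Suc k)\<close>.\<close>

definition Zs :: "'b set \<Rightarrow> 'b set \<Rightarrow> nat \<Rightarrow> 'b set" where
  "Zs W U k = {x \<in> W. (eta ^^ k) x \<in> im (Suc k) W U}"

lemma stable_subspace: "stable W \<Longrightarrow> subspace W"
  and stable_eta: "stable W \<Longrightarrow> x \<in> W \<Longrightarrow> eta x \<in> W"
  unfolding stable_def by auto

lemma stable_pow: "stable W \<Longrightarrow> x \<in> W \<Longrightarrow> (eta ^^ k) x \<in> W"
  by (induction k) (auto intro: stable_eta)

lemma im_iff: "y \<in> im k W U \<longleftrightarrow> (\<exists>x\<in>W. y - (eta ^^ k) x \<in> U)"
  unfolding im_def msum_def by auto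

lemma subspace_im: "subspace W \<Longrightarrow> subspace U \<Longrightarrow> subspace (im k W U)"
  unfolding im_def by (rule subspace_msum[OF linear_pow])

lemma im_superset: "subspace W \<Longrightarrow> U \<subseteq> im k W U"
  unfolding subset_iff im_iff using subspace_0[of W] by (auto intro!: bexI[of _ 0] simp: pow_zero)

lemma pow_in_im: "subspace U \<Longrightarrow> x \<in> W \<Longrightarrow> (eta ^^ k) x \<in> im k W U"
  unfolding im_iff using subspace_0[of U] by (auto intro!: bexI[of _ x])

lemma im_mono: "W \<subseteq> W' \<Longrightarrow> im k W U \<subseteq> im k W' U"
  unfolding subset_iff im_iff by blast

lemma im_subset:
  assumes "stable W" "U \<subseteq> W"
  shows "im k W U \<subseteq> W"
proof
  fix y assume "y \<in> im k W U"
  then obtain x where x: "x \<in> W" "y - (eta ^^ k) x \<in> U" unfolding im_iff by auto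
  then have "(y - (eta ^^ k) x) + (eta ^^ k) x \<in> W"
    using assms by (intro subspace_add stable_subspace stable_pow) auto
  then show "y \<in> W" by simp
qed

lemma im_Suc_subset: assumes "stable W" shows "im (Suc k) W U \<subseteq> im k W U"
  unfolding subset_iff im_iff using stable_eta[OF assms] pow_eta by metis

lemma im_antimono: "stable W \<Longrightarrow> k \<le> l \<Longrightarrow> im l W U \<subseteq> im k W U"
  by (rule lift_Suc_antimono_le[of "\<lambda>k. im k W U"]) (auto dest: im_Suc_subset)

lemma im_0: "subspace W \<Longrightarrow> U \<subseteq> W \<Longrightarrow> subspace U \<Longrightarrow> im 0 W U = W"
proof -
  assume W: "subspace W" and UW: "U \<subseteq> W" and U: "subspace U"
  have "y \<in> im 0 W U \<longleftrightarrow> y \<in> W" for y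
  proof
    assume "y \<in> im 0 W U"
    then obtain x where x: "x \<in> W" "y - x \<in> U" unfolding im_iff by auto
    then have "(y - x) + x \<in> W" using UW by (intro subspace_add W) auto
    then show "y \<in> W" by simp
  next
    assume "y \<in> W" then show "y \<in> im 0 W U" unfolding im_iff using subspace_0[OF U]
      by (auto intro!: bexI[of _ y])
  qed
  then show ?thesis by auto
qed

lemma im_N: "subspace W \<Longrightarrow> im N W U = U"
  using subspace_0[of W] by (auto simp: im_iff set_eq_iff eta_N)

lemma im_ge_N: assumes "subspace W" "N \<le> k" shows "im k W U = U"
proof -
  have "(eta ^^ k) v = 0" for v
  proof -
    have "eta ^^ k = eta ^^ N \<circ> eta ^^ (k - N)" using assms(2) by (simp flip: funpow_add)
    then show ?thesis by (simp add: eta_N)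
  qed
  then show ?thesis using subspace_0[OF assms(1)] by (auto simp: im_iff set_eq_iff)
qed

lemma rank_antimono: "stable W \<Longrightarrow> subspace U \<Longrightarrow> k \<le> l \<Longrightarrow> rank l W U \<le> rank k W U"
  unfolding rank_def using im_antimono dim_subset by metis

text \<open>Telescoping from \<open>im N W U = U\<close>. Once dim U is fixed, prescribing the
  columns is the same as prescribing all ranks, which is how types meet semicontinuity.\<close>

lemma rank_eq_sum:
  assumes "stable W" "subspace U"
  shows "rank k W U = dim U + (\<Sum>l=k..<N. cols W U l)"
proof (cases "k \<le> N")
  case True
  then show ?thesis
  proof (induction k rule: inc_induct)
    case base
    then show ?case using assms by (simp add: rank_def im_N stable_subspace)
  next
    case (step k)
    have "rank (Suc k) W U \<le> rank k W U" using rank_antimono[OF assms] by simp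
    then show ?case using step by (simp add: cols_def sum.atLeast_Suc_lessThan)
  qed
next
  case False
  then show ?thesis using assms by (simp add: rank_def im_ge_N stable_subspace)
qed

lemma cols_ge_N: "stable W \<Longrightarrow> N \<le> k \<Longrightarrow> cols W U k = 0"
  by (simp add: cols_def rank_def im_ge_N stable_subspace)

lemma Zs_subset: "Zs W U k \<subseteq> W" unfolding Zs_def by auto

lemma subspace_Zs: assumes "stable W" "subspace U" shows "subspace (Zs W U k)"
proof -
  interpret L: Vector_Spaces.linear scale scale "eta ^^ k" by (rule linear_pow)
  have "Zs W U k = W \<inter> {x. (eta ^^ k) x \<in> im (Suc k) W U}" unfolding Zs_def by auto
  moreover have "subspace {x. (eta ^^ k) x \<in> im (Suc k) W U}"
    using assms by (intro L.subspace_linear_preimage subspace_im) (auto dest: stable_subspace)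
  ultimately show ?thesis using assms by (simp add: subspace_inter stable_subspace)
qed

text \<open>Rank-nullity for \<open>eta ^^ k\<close> as a map from W onto \<open>im k W U\<close>
  modulo \<open>im (Suc k) W U\<close>, whose kernel is \<open>Zs W U k\<close>.\<close>

lemma dim_Zs: assumes W: "stable W" and U: "subspace U" shows "cols W U k + dim (Zs W U k) = dim W"
proof -
  have "msum (eta ^^ k) W (im (Suc k) W U) = im k W U"
  proof (intro equalityI subsetI)
    fix y assume "y \<in> msum (eta ^^ k) W (im (Suc k) W U)"
    then obtain x where x: "x \<in> W" "y - (eta ^^ k) x \<in> im (Suc k) W U" unfolding msum_def by auto
    then have "y - (eta ^^ k) x \<in> im k W U" using im_Suc_subset[OF W] by blast
    moreover have "(eta ^^ k) x \<in> im k W U" using pow_in_im[OF U x(1)] .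
    ultimately have "(y - (eta ^^ k) x) + (eta ^^ k) x \<in> im k W U"
      using subspace_im[OF stable_subspace[OF W] U] by (intro subspace_add)
    then show "y \<in> im k W U" by simp
  next
    fix y assume "y \<in> im k W U"
    then show "y \<in> msum (eta ^^ k) W (im (Suc k) W U)"
      unfolding msum_def im_iff[of _ k] using im_superset[OF stable_subspace[OF W]] by blast
  qed
  then have "rank k W U + dim (Zs W U k) = dim W + rank (Suc k) W U"
    using dim_msum[OF linear_pow stable_subspace[OF W] subspace_im[OF stable_subspace[OF W] U], of k
      "Suc k"]
    unfolding rank_def Zs_def by simp
  moreover have "rank (Suc k) W U \<le> rank k W U" using rank_antimono[OF W U] by simp
  ultimately show ?thesis unfolding cols_def by simp
qed

lemma Zs_Suc: assumes "stable W" "stable U" shows "Zs W U k \<subseteq> Zs W U (Suc k)"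
proof
  fix x assume "x \<in> Zs W U k"
  then obtain w where w: "x \<in> W" "w \<in> W" "(eta ^^ k) x - (eta ^^ Suc k) w \<in> U"
    unfolding Zs_def im_iff by auto
  from stable_eta[OF assms(2) w(3)] have "(eta ^^ Suc k) x - (eta ^^ Suc (Suc k)) w \<in> U"
    by (simp add: eta_diff)
  then show "x \<in> Zs W U (Suc k)" using w unfolding Zs_def im_iff by auto
qed

lemma Zs_mono: "stable W \<Longrightarrow> stable U \<Longrightarrow> k \<le> l \<Longrightarrow> Zs W U k \<subseteq> Zs W U l"
  by (rule lift_Suc_mono_le[of "\<lambda>k. Zs W U k"]) (auto dest: Zs_Suc)

lemma cols_antimono: assumes "stable W" "stable U" shows "antimono (cols W U)"
proof (rule antimonoI)
  fix k l :: nat assume "k \<le> l"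
  then have "dim (Zs W U k) \<le> dim (Zs W U l)" using Zs_mono[OF assms] dim_subset by metis
  then show "cols W U l \<le> cols W U k"
    using dim_Zs[OF assms(1) stable_subspace[OF assms(2)], of k]
      dim_Zs[OF assms(1) stable_subspace[OF assms(2)], of l] by linarith
qed

text \<open>On the line W / U the map acts by a scalar a, and a^N = 0 forces a = 0.\<close>

lemma eta_codim_one:
  assumes U: "stable U" and W: "stable W" and UW: "U \<subseteq> W" and d: "dim W = Suc (dim U)"
    and y: "y \<in> W"
  shows "eta y \<in> U"
proof -
  have sU: "subspace U" and sW: "subspace W" using U W stable_subspace by auto
  have "W \<noteq> U" using d by auto
  then obtain x where x: "x \<in> W" "x \<notin> U" using UW by auto
  obtain a where a: "eta x - a *s x \<in> U"
    using hyperplane_decompose[OF sU sW UW d x stable_eta[OF W x(1)]] by auto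
  have "a = 0"
  proof (rule ccontr)
    assume "a \<noteq> 0"
    have "(eta ^^ k) x - a ^ k *s x \<in> U" for k
    proof (induction k)
      case 0 then show ?case using subspace_0[OF sU] by simp
    next
      case (Suc k)
      have "(eta ^^ Suc k) x - a ^ Suc k *s x
        = eta ((eta ^^ k) x - a ^ k *s x) + a ^ k *s (eta x - a *s x)"
        by (simp add: eta_diff eta_scale scale_right_diff_distrib mult.commute)
      then show ?case
        using stable_eta[OF U Suc] subspace_scale[OF sU a] subspace_add[OF sU] by metis
    qed
    from this[of N] have "- (a ^ N *s x) \<in> U" by (simp add: eta_N)
    then have "inverse (a ^ N) *s (a ^ N *s x) \<in> U"
      using subspace_neg[OF sU] subspace_scale[OF sU] by (metis minus_minus)
    then show False using x(2) \<open>a \<noteq> 0\<close> by simp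
  qed
  then have ex: "eta x \<in> U" using a by simp
  obtain b where b: "y - b *s x \<in> U" using hyperplane_decompose[OF sU sW UW d x y] by auto
  have "eta y = eta (y - b *s x) + b *s eta x" by (simp add: eta_diff eta_scale)
  then show ?thesis using stable_eta[OF U b] subspace_scale[OF sU ex] subspace_add[OF sU] by metis
qed

section \<open>Stable hyperplanes and lines of a subquotient\<close>

definition hyper :: "'b set \<Rightarrow> 'b set \<Rightarrow> bool" where
  "hyper H W \<longleftrightarrow> stable H \<and> stable W \<and> H \<subseteq> W \<and> dim W = Suc (dim H)"

lemma hyperD:
  assumes "hyper H W"
  shows "stable H" "stable W" "subspace H" "subspace W" "H \<subseteq> W" "dim W = Suc (dim H)"
    "y \<in> W \<Longrightarrow> eta y \<in> H"
  using assms eta_codim_one[of H W] unfolding hyper_def stable_def by auto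

text \<open>Take x in W outside H. The rank stays the same iff \<open>(eta ^^ k) x\<close> already
  lies in \<open>im k H U\<close>, and this happens iff \<open>Zs W U k\<close> has a vector z
  outside H: then \<open>(eta ^^ k) z\<close> agrees modulo U with
  \<open>(eta ^^ k) (eta w)\<close>, and \<open>eta w\<close> lies in H by
  \<open>eta_codim_one\<close>.\<close>

lemma rank_hyper:
  assumes h: "hyper H W" and U: "stable U" "U \<subseteq> H"
  shows "rank k W U = rank k H U + (if Zs W U k \<subseteq> H then 1 else 0)"
proof -
  note hd = hyperD[OF h]
  have sU: "subspace U" using U stable_subspace by auto
  obtain x where x: "x \<in> W" "x \<notin> H" using hd by (metis n_not_Suc_n subsetI subset_antisym)
  have s: "subspace (im k H U)" "subspace (im k W U)" using subspace_im hd sU by auto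
  have im: "im k W U = span (insert ((eta ^^ k) x) (im k H U))"
  proof
    show "im k W U \<subseteq> span (insert ((eta ^^ k) x) (im k H U))"
    proof
      fix y assume "y \<in> im k W U"
      then obtain w where w: "w \<in> W" "y - (eta ^^ k) w \<in> U" unfolding im_iff by auto
      obtain a where a: "w - a *s x \<in> H"
        using hyperplane_decompose[OF hd(3,4,5,6) x w(1)] by auto
      have "(y - a *s (eta ^^ k) x) - (eta ^^ k) (w - a *s x) \<in> U" using w
        by (simp add: pow_diff pow_scale)
      then have "y - a *s (eta ^^ k) x \<in> im k H U" unfolding im_iff using a by blast
      then show "y \<in> span (insert ((eta ^^ k) x) (im k H U))"
        unfolding span_breakdown_eq using span_base by blast
    qed
    show "span (insert ((eta ^^ k) x) (im k H U)) \<subseteq> im k W U"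
      using s im_mono[OF hd(5)] pow_in_im[OF sU x(1)] by (intro span_minimal) auto
  qed
  have iff: "(eta ^^ k) x \<in> im k H U \<longleftrightarrow> \<not> Zs W U k \<subseteq> H"
  proof
    assume "(eta ^^ k) x \<in> im k H U"
    then obtain h where h: "h \<in> H" "(eta ^^ k) x - (eta ^^ k) h \<in> U" unfolding im_iff by auto
    then have "(eta ^^ k) (x - h) \<in> im (Suc k) W U"
      using im_superset[OF hd(4)] by (auto simp: pow_diff)
    then have "x - h \<in> Zs W U k"
      unfolding Zs_def using x h hd by (auto intro: subspace_diff)
    moreover have "x - h \<notin> H" using subspace_add[OF hd(3) _ h(1), of "x - h"] x by auto
    ultimately show "\<not> Zs W U k \<subseteq> H" by auto
  next
    assume "\<not> Zs W U k \<subseteq> H"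
    then obtain z where z: "z \<in> Zs W U k" "z \<notin> H" by auto
    then obtain w where w: "z \<in> W" "w \<in> W" "(eta ^^ k) z - (eta ^^ Suc k) w \<in> U"
      unfolding Zs_def im_iff by auto
    obtain a where a: "x - a *s z \<in> H"
      using hyperplane_decompose[OF hd(3,4,5,6) w(1) z(2) x(1)] by auto
    have "(eta ^^ k) z - (eta ^^ k) (eta w) \<in> U" using w(3) pow_eta by simp
    then have "(eta ^^ k) z \<in> im k H U" unfolding im_iff using hd(7)[OF w(2)] by blast
    moreover have "(eta ^^ k) (x - a *s z) \<in> im k H U" using pow_in_im[OF sU a] .
    ultimately have "(eta ^^ k) (x - a *s z) + a *s (eta ^^ k) z \<in> im k H U"
      using s by (intro subspace_add subspace_scale)
    then show "(eta ^^ k) x \<in> im k H U" by (simp add: pow_diff pow_scale)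
  qed
  show ?thesis
  proof (cases "Zs W U k \<subseteq> H")
    case True
    then show ?thesis using iff im dim_hyperplane[OF s(1) _ im] unfolding rank_def by simp
  next
    case False
    then have "im k W U = im k H U" using iff im s by (simp add: insert_absorb span_of_subspace)
    then show ?thesis using False unfolding rank_def by simp
  qed
qed

lemma threshold_exists:
  assumes "P (0::nat)" "\<not> P M" "\<And>k. P (Suc k) \<Longrightarrow> P k"
  shows "\<exists>c. \<forall>k. P k \<longleftrightarrow> k \<le> c"
proof -
  have anti: "P k" if "P l" "k \<le> l" for k l using that(2,1)
    by (induction rule: inc_induct) (auto dest: assms(3))
  have b: "\<forall>k. P k \<longrightarrow> k \<le> M" using anti assms(2) by (metis nat_le_linear)
  define c where "c = (GREATEST k. P k)"
  have "P c" unfolding c_def using GreatestI_nat[of P 0 M] assms(1) b by auto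
  moreover have "k \<le> c" if "P k" for k unfolding c_def using Greatest_le_nat[of P k M] that b
    by auto
  ultimately show ?thesis using anti by blast
qed

lemma hyper_column:
  assumes h: "hyper H W" and U: "stable U" "U \<subseteq> H"
  shows "\<exists>c. (\<forall>k. Zs W U k \<subseteq> H \<longleftrightarrow> k \<le> c) \<and> cols W U = (cols H U)(c := Suc (cols H U c))"
proof -
  note hd = hyperD[OF h]
  have sU: "subspace U" using U stable_subspace by auto
  have "\<exists>c. \<forall>k. Zs W U k \<subseteq> H \<longleftrightarrow> k \<le> c"
  proof (rule threshold_exists)
    show "Zs W U 0 \<subseteq> H"
    proof
      fix x assume "x \<in> Zs W U 0"
      then obtain w where w: "w \<in> W" "x - eta w \<in> U" unfolding Zs_def im_iff by auto
      then have "(x - eta w) + eta w \<in> H" using hd U by (intro subspace_add) auto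
      then show "x \<in> H" by simp
    qed
    have "Zs W U N = W" unfolding Zs_def using subspace_0[OF subspace_im[OF hd(4) sU]]
      by (auto simp: eta_N)
    then show "\<not> Zs W U N \<subseteq> H" using hd by (metis n_not_Suc_n subset_antisym)
    show "Zs W U k \<subseteq> H" if "Zs W U (Suc k) \<subseteq> H" for k using that Zs_Suc[OF hd(2) U(1)] by blast
  qed
  then obtain c where c: "\<And>k. Zs W U k \<subseteq> H \<longleftrightarrow> k \<le> c" by blast
  have r: "rank k W U = rank k H U + (if k \<le> c then 1 else 0)" for k using rank_hyper[OF h U] c
    by simp
  have "rank (Suc k) H U \<le> rank k H U" for k using rank_antimono[OF hd(1) sU] by simp
  then have "cols W U = (cols H U)(c := Suc (cols H U c))"
    by (auto simp: cols_def r fun_eq_iff not_less_eq_eq Suc_diff_le)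
  then show ?thesis using c by blast
qed

text \<open>Dually, dividing out the line \<open>L / U\<close> removes a square from column \<open>line_col U L W\<close>.\<close>

definition line_col :: "'b set \<Rightarrow> 'b set \<Rightarrow> 'b set \<Rightarrow> nat" where
  "line_col U L W = (LEAST p. \<not> L \<subseteq> im (Suc p) W U)"

lemma line_col_iff:
  assumes h: "hyper U L" and W: "stable W" "L \<subseteq> W"
  shows "L \<subseteq> im k W U \<longleftrightarrow> k \<le> line_col U L W"
proof -
  note hd = hyperD[OF h]
  have sW: "subspace W" using W stable_subspace by auto
  have "\<exists>c. \<forall>k. L \<subseteq> im k W U \<longleftrightarrow> k \<le> c"
  proof (rule threshold_exists)
    show "L \<subseteq> im 0 W U" using im_0[OF sW _ hd(3)] hd W by auto
    show "\<not> L \<subseteq> im N W U" using im_N[OF sW] hd by (metis n_not_Suc_n subset_antisym)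
    show "L \<subseteq> im k W U" if "L \<subseteq> im (Suc k) W U" for k using that im_Suc_subset[OF W(1)] by blast
  qed
  then obtain c where c: "\<And>k. L \<subseteq> im k W U \<longleftrightarrow> k \<le> c" by blast
  then have "line_col U L W = c" unfolding line_col_def by (intro Least_equality) auto
  then show ?thesis using c by simp
qed

text \<open>Replacing U by L adds L to the image, which gains one dimension unless L was already
  contained in it.\<close>

lemma rank_line:
  assumes h: "hyper U L" and W: "stable W" "L \<subseteq> W"
  shows "rank k W L = rank k W U + (if k \<le> line_col U L W then 0 else 1)"
proof -
  note hd = hyperD[OF h]
  have sW: "subspace W" using W stable_subspace by auto
  obtain x where x: "x \<in> L" "x \<notin> U" using hd by (metis n_not_Suc_n subsetI subset_antisym)
  have L: "L = span (insert x U)" using hyperplane_span[OF hd(3,4,5,6) x] .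
  have s: "subspace (im k W L)" "subspace (im k W U)" using subspace_im hd sW by auto
  have im: "im k W L = span (insert x (im k W U))"
  proof
    show "im k W L \<subseteq> span (insert x (im k W U))"
    proof
      fix y assume "y \<in> im k W L"
      then obtain w where w: "w \<in> W" "y - (eta ^^ k) w \<in> L" unfolding im_iff by auto
      obtain a where a: "y - (eta ^^ k) w - a *s x \<in> U"
        using hyperplane_decompose[OF hd(3,4,5,6) x w(2)] by auto
      then have "(y - a *s x) - (eta ^^ k) w \<in> U" by (simp add: algebra_simps)
      then have "y - a *s x \<in> im k W U" unfolding im_iff using w by blast
      then show "y \<in> span (insert x (im k W U))"
        unfolding span_breakdown_eq using span_base by blast
    qed
    have "im k W U \<subseteq> im k W L" unfolding subset_iff im_iff using hd by blast
    then show "span (insert x (im k W U)) \<subseteq> im k W L"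
      using s im_superset[OF sW, of L] x by (intro span_minimal) auto
  qed
  have iff: "L \<subseteq> im k W U \<longleftrightarrow> x \<in> im k W U"
  proof
    assume "x \<in> im k W U"
    then have "span (insert x U) \<subseteq> im k W U" using s im_superset[OF sW, of U]
      by (intro span_minimal) auto
    then show "L \<subseteq> im k W U" using L by simp
  qed (use x in auto)
  show ?thesis
  proof (cases "L \<subseteq> im k W U")
    case True
    then have "im k W L = im k W U" using iff im s by (simp add: insert_absorb span_of_subspace)
    then show ?thesis using line_col_iff[OF h W] True unfolding rank_def by simp
  next
    case False
    then have "dim (im k W L) = Suc (dim (im k W U))" using iff dim_hyperplane[OF s(2) _ im] by simp
    then show ?thesis using line_col_iff[OF h W] False unfolding rank_def by simp
  qed
qed

lemma cols_line:
  assumes h: "hyper U L" and W: "stable W" "L \<subseteq> W"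
  shows "cols W U = (cols W L)(line_col U L W := Suc (cols W L (line_col U L W)))"
proof -
  note hd = hyperD[OF h]
  define c where "c = line_col U L W"
  have r: "rank k W L = rank k W U + (if k \<le> c then 0 else 1)" for k
    using rank_line[OF h W] c_def by simp
  have a: "rank (Suc k) W U \<le> rank k W U" "rank (Suc k) W L \<le> rank k W L" for k
    using rank_antimono W hd by auto
  have "cols W U k = ((cols W L)(c := Suc (cols W L c))) k" for k
    using a[of k] r[of k] r[of "Suc k"] by (cases "k < c"; cases "k = c") (auto simp: cols_def)
  then show ?thesis unfolding c_def by blast
qed

lemma line_col_mono:
  assumes h: "hyper U L" and W: "stable W" "L \<subseteq> W" and W': "stable W'" "W \<subseteq> W'"
  shows "line_col U L W \<le> line_col U L W'"
proof -
  have "L \<subseteq> im (line_col U L W) W U" using line_col_iff[OF h W] by simp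
  then have "L \<subseteq> im (line_col U L W) W' U" using im_mono[OF W'(2)] by blast
  then show ?thesis using line_col_iff[OF h W'(1)] W W' by auto
qed

text \<open>The drop after column p means a Jordan block of length p + 1 on W / U. A vector x in
  \<open>Zs W U (Suc p)\<close> but not in \<open>Zs W U p\<close>, corrected by some
  \<open>eta w\<close>, generates such a block, and the line is its socle, spanned by
  \<open>(eta ^^ p) (x - eta w)\<close>.\<close>

lemma line_exists:
  assumes U: "stable U" and W: "stable W" and UW: "U \<subseteq> W"
    and p: "cols W U (Suc p) < cols W U p"
  shows "\<exists>L. hyper U L \<and> L \<subseteq> W \<and> line_col U L W = p"
proof -
  have sU: "subspace U" and sW: "subspace W" using U W stable_subspace by auto
  have "\<not> Zs W U (Suc p) \<subseteq> Zs W U p"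
    using p dim_Zs[OF W sU, of p] dim_Zs[OF W sU, of "Suc p"] dim_subset[of "Zs W U (Suc p)"
      "Zs W U p"]
    by auto
  then obtain x where x: "x \<in> Zs W U (Suc p)" "x \<notin> Zs W U p" by auto
  then obtain w where w: "x \<in> W" "w \<in> W" "(eta ^^ Suc p) x - (eta ^^ Suc (Suc p)) w \<in> U"
    unfolding Zs_def im_iff by auto
  define l where "l = (eta ^^ p) (x - eta w)"
  have el: "eta l \<in> U" using w(3) by (simp add: l_def pow_diff eta_diff pow_eta)
  have lW: "l \<in> W" unfolding l_def using w W by (intro stable_pow subspace_diff sW stable_eta) auto
  have ln: "l \<notin> im (Suc p) W U"
  proof
    assume l: "l \<in> im (Suc p) W U"
    have "(eta ^^ p) (eta w) \<in> im (Suc p) W U" using pow_in_im[OF sU w(2), of "Suc p"] pow_eta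
      by simp
    with l have "l + (eta ^^ p) (eta w) \<in> im (Suc p) W U"
      using subspace_add[OF subspace_im[OF sW sU]] by blast
    then have "(eta ^^ p) x \<in> im (Suc p) W U" unfolding l_def by (simp add: pow_diff)
    then show False using x(2) w(1) unfolding Zs_def by auto
  qed
  have lU: "l \<notin> U" using ln im_superset[OF sW, of U "Suc p"] by auto
  define L where "L = span (insert l U)"
  have UL: "U \<subseteq> L" unfolding L_def using span_superset by blast
  have "eta y \<in> L" if yL: "y \<in> L" for y
  proof -
    obtain a where a: "y - a *s l \<in> U" using yL
      unfolding L_def span_breakdown_eq span_of_subspace[OF sU] by auto
    have "eta (y - a *s l) + a *s eta l \<in> U"
      using subspace_add[OF sU stable_eta[OF U a] subspace_scale[OF sU el, of a]] .
    then show ?thesis using UL by (auto simp: eta_diff eta_scale)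
  qed
  then have "stable L" unfolding stable_def L_def by auto
  then have h: "hyper U L" unfolding hyper_def using U UL dim_hyperplane[OF sU lU L_def] by auto
  have LW: "L \<subseteq> W" unfolding L_def using lW UW by (intro span_minimal sW) auto
  have "l \<in> im p W U" unfolding l_def using w W
    by (intro pow_in_im sU subspace_diff sW stable_eta) auto
  then have "L \<subseteq> im p W U" unfolding L_def using im_superset[OF sW]
    by (intro span_minimal subspace_im sU sW) auto
  then have "p \<le> line_col U L W" using line_col_iff[OF h W LW] by blast
  moreover have "\<not> L \<subseteq> im (Suc p) W U" using ln unfolding L_def using span_base by blast
  then have "\<not> Suc p \<le> line_col U L W" using line_col_iff[OF h W LW] by blast
  ultimately show ?thesis using h LW by (intro exI[of _ L]) auto
qed

end

section \<open>Curves of flags\<close>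

context nilpotent_endo
begin

text \<open>As g fixes U and commutes with \<open>eta\<close> modulo U, it induces a homomorphism of
  subquotients over U. Commutation up to U is what the maps of \<open>transvection\<close>
  provide.\<close>

lemma im_transport:
  assumes g: "endo g"
    and gU: "\<And>x. x \<in> U \<Longrightarrow> g x = x"
    and comm: "\<And>x. x \<in> W \<Longrightarrow> g (eta x) - eta (g x) \<in> U"
    and U: "stable U" and X: "stable X" "U \<subseteq> X" "X \<subseteq> W"
  shows "im k (g ` X) U = g ` im k X U"
proof -
  interpret g: Vector_Spaces.linear scale scale g by fact
  have sU: "subspace U" using U stable_subspace by auto
  have c: "g ((eta ^^ k) x) - (eta ^^ k) (g x) \<in> U" if x: "x \<in> X" for x
  proof (induction k)
    case 0 then show ?case using subspace_0[OF sU] by simp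
  next
    case (Suc k)
    have "(eta ^^ k) x \<in> W" using stable_pow[OF X(1) x] X by auto
    from comm[OF this] stable_eta[OF U Suc]
    have "(g (eta ((eta ^^ k) x)) - eta (g ((eta ^^ k) x))) + eta (g ((eta ^^ k) x) - (eta ^^ k) (g
      x)) \<in> U"
      by (rule subspace_add[OF sU])
    then show ?case by (simp add: eta_diff)
  qed
  show ?thesis
  proof (intro equalityI subsetI)
    fix y assume "y \<in> im k (g ` X) U"
    then obtain x where x: "x \<in> X" "y - (eta ^^ k) (g x) \<in> U" unfolding im_iff by auto
    define u where "u = y - g ((eta ^^ k) x)"
    have "u = (y - (eta ^^ k) (g x)) - (g ((eta ^^ k) x) - (eta ^^ k) (g x))" unfolding u_def
      by simp
    then have u: "u \<in> U" using x(2) c[OF x(1)] subspace_diff[OF sU] by metis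
    then have "y = g ((eta ^^ k) x + u)" using gU u_def by (simp add: g.add)
    moreover have "(eta ^^ k) x + u \<in> im k X U" unfolding im_iff using x(1) u
      by (intro bexI[of _ x]) auto
    ultimately show "y \<in> g ` im k X U" by blast
  next
    fix y assume "y \<in> g ` im k X U"
    then obtain z x where z: "y = g z" "x \<in> X" "z - (eta ^^ k) x \<in> U"
      unfolding image_iff Bex_def im_iff by blast
    have "y - (eta ^^ k) (g x) = g (z - (eta ^^ k) x) + (g ((eta ^^ k) x) - (eta ^^ k) (g x))"
      using z by (simp add: g.diff)
    moreover have "g (z - (eta ^^ k) x) \<in> U" using gU[OF z(3)] z(3) by simp
    ultimately have "y - (eta ^^ k) (g x) \<in> U" using c[OF z(2)] subspace_add[OF sU] by metis
    then show "y \<in> im k (g ` X) U" unfolding im_iff using z(2) by blast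
  qed
qed

lemma dim_inj_image:
  assumes g: "endo g" and i: "inj g"
  shows "dim (g ` X) = dim X"
proof -
  interpret P: finite_dimensional_vector_space_pair_1 scale Basis scale ..
  show ?thesis using P.dim_image_eq[OF g] i by (meson inj_on_subset subset_UNIV)
qed

lemma transport:
  assumes g: "endo g" and i: "inj g"
    and gU: "\<And>x. x \<in> U \<Longrightarrow> g x = x"
    and comm: "\<And>x. x \<in> W \<Longrightarrow> g (eta x) - eta (g x) \<in> U"
    and U: "stable U" and X: "stable X" "U \<subseteq> X" "X \<subseteq> W"
  shows "stable (g ` X)" "U \<subseteq> g ` X" "dim (g ` X) = dim X" "cols (g ` X) U = cols X U"
proof -
  interpret g: Vector_Spaces.linear scale scale g by fact
  show UX: "U \<subseteq> g ` X"
  proof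
    fix u assume "u \<in> U" then show "u \<in> g ` X" using gU[of u] X by (metis imageI subsetD)
  qed
  have s: "subspace (g ` X)" using X stable_subspace g.subspace_image by blast
  have "eta (g x) \<in> g ` X" if "x \<in> X" for x
  proof -
    have "g (eta x) \<in> g ` X" using stable_eta[OF X(1) that] by auto
    moreover have "g (eta x) - eta (g x) \<in> g ` X" using comm[of x] that X UX by auto
    ultimately have "g (eta x) - (g (eta x) - eta (g x)) \<in> g ` X" by (rule subspace_diff[OF s])
    then show ?thesis by simp
  qed
  then show "stable (g ` X)" unfolding stable_def using s by auto
  show "dim (g ` X) = dim X" by (rule dim_inj_image[OF g i])
  have "im k (g ` X) U = g ` im k X U" for k by (rule im_transport[OF g gU comm U X])
  then show "cols (g ` X) U = cols X U"
    by (simp add: fun_eq_iff cols_def rank_def dim_inj_image[OF g i])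
qed

lemma sum_singleton_support:
  fixes f :: "nat \<Rightarrow> 'z::comm_monoid_add"
  shows "(\<And>k. k \<le> c \<Longrightarrow> k \<noteq> 0 \<Longrightarrow> f k = 0) \<Longrightarrow> (\<Sum>k\<le>c. f k) = f 0"
  by (subst sum.remove[of _ 0]) (auto intro!: sum.neutral)

text \<open>A kernel vector satisfies x = -t D x, which can be iterated until the power of D
  vanishes. No t is exceptional, so the curves below consist of flags for every parameter.\<close>

lemma nilpotent_shift_inj:
  assumes D: "endo D" and n: "\<And>x. (D ^^ M) x = 0"
  shows "inj (\<lambda>x. x + t *s D x)"
proof -
  interpret D: Vector_Spaces.linear scale scale D by fact
  have "endo (\<lambda>x. x + t *s D x)"
    unfolding Vector_Spaces.linear_iff using vector_space_axioms
    by (simp add: D.add D.scale scale_right_distrib scale_left_commute)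
  then interpret G: Vector_Spaces.linear scale scale "\<lambda>x. x + t *s D x" .
  have "x = 0" if x: "x + t *s D x = 0" for x
  proof -
    have e: "x = (- t) *s D x" using x by (simp add: eq_neg_iff_add_eq_0)
    have "x = (- t) ^ k *s (D ^^ k) x" for k
    proof (induction k)
      case (Suc k)
      have sc: "(D ^^ k) (c *s y) = c *s (D ^^ k) y" for c y
        by (induction k) (simp_all add: D.scale)
      have "(D ^^ k) x = (D ^^ k) ((- t) *s D x)" using e by simp
      also have "\<dots> = (- t) *s (D ^^ Suc k) x" unfolding sc by (simp only: funpow_Suc_right comp_def)
      finally have "(- t) ^ Suc k *s (D ^^ Suc k) x = (- t) ^ k *s (D ^^ k) x"
        by (simp only: power_Suc2 scale_scale)
      then show ?case using Suc by simp
    qed simp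
    from this[of M] show ?thesis by (simp add: n)
  qed
  then show ?thesis unfolding G.inj_iff_eq_0 by blast
qed

text \<open>The image of D lies in the span of v, ..., \<open>(eta ^^ c) v\<close>, and D carries
  \<open>(eta ^^ i) v\<close> into the span of strictly higher powers, because \<theta> kills
  \<open>(eta ^^ j) v\<close> for j \<ge> c. One application followed by c + 1 more gives 0.\<close>

lemma cyclic_map_nilpotent:
  fixes v :: 'b
  assumes D: "\<And>x. D x = (\<Sum>k\<le>c. \<theta> ((eta ^^ (c - k)) x) *s (eta ^^ k) v)"
    and \<theta>: "functional \<theta>"
    and z: "\<And>j. c \<le> j \<Longrightarrow> \<theta> ((eta ^^ j) v) = 0"
  shows "(D ^^ Suc (Suc c)) x = 0"
proof -
  interpret T: Vector_Spaces.linear scale "(*)" \<theta> by fact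
  let ?N = "\<lambda>k. span ((\<lambda>j. (eta ^^ j) v) ` {k..c})"
  have lin: "endo D"
    unfolding Vector_Spaces.linear_iff D using vector_space_axioms
    by (simp add: pow_add pow_scale T.add T.scale scale_left_distrib sum.distrib scale_sum_right)
  then interpret DD: Vector_Spaces.linear scale scale D .
  have base: "D ((eta ^^ i) v) \<in> ?N (Suc i)" for i
    unfolding D
  proof (rule span_sum)
    fix k assume k: "k \<in> {..c}"
    have e: "(eta ^^ (c - k)) ((eta ^^ i) v) = (eta ^^ (c - k + i)) v" by (simp add: funpow_add)
    show "\<theta> ((eta ^^ (c - k)) ((eta ^^ i) v)) *s (eta ^^ k) v \<in> ?N (Suc i)"
    proof (cases "k \<le> i")
      case True
      then show ?thesis unfolding e using z[of "c - k + i"] k by (simp add: span_zero)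
    next
      case False
      then show ?thesis using k by (intro span_scale span_base) auto
    qed
  qed
  have step: "D y \<in> ?N (Suc k)" if "y \<in> ?N k" for y k
    using that
  proof (induction rule: span_induct)
    case base
    show ?case
    proof (rule subspaceI)
      show "0 \<in> {y. D y \<in> ?N (Suc k)}" by (simp add: span_zero)
    qed (auto simp: DD.add DD.scale intro: span_add span_scale)
  next
    case (step y)
    then obtain j where j: "k \<le> j" "y = (eta ^^ j) v" by auto
    have "?N (Suc j) \<subseteq> ?N (Suc k)" using j by (intro span_mono) auto
    then show ?case using base[of j] j by auto
  qed
  have "(D ^^ Suc i) x \<in> ?N i" for i
  proof (induction i)
    case 0
    have "D x \<in> ?N 0" unfolding D by (intro span_sum span_scale span_base) auto
    then show ?case by simp
  next
    case (Suc i)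
    then show ?case using step by simp
  qed
  from this[of "Suc c"] show ?thesis by simp
qed

text \<open>\<open>D\<close> is the module homomorphism \<open>W / U \<rightarrow> F[X] / (X^(c+1))\<close> determined by the functional
  \<open>\<theta>\<close>, followed by the inclusion of the cyclic submodule generated by a vector \<open>v\<close> outside both
  hyperplanes.\<close>

lemma transvection:
  assumes h: "hyper H W" "hyper H' W" and U: "stable U" "U \<subseteq> H" "U \<subseteq> H'"
    and eq: "cols H U = cols H' U"
  shows "\<exists>D. endo D \<and> (\<forall>t. inj (\<lambda>x. x + t *s D x)) \<and> D ` W \<subseteq> W \<and>
    (\<forall>x\<in>U. D x = 0) \<and> (\<forall>x\<in>W. D (eta x) - eta (D x) \<in> U) \<and> (\<lambda>x. x + D x) ` H = H'"
proof (cases "H = H'")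
  case True
  have "endo (\<lambda>_. 0)"
    unfolding Vector_Spaces.linear_iff using vector_space_axioms by simp
  then show ?thesis using True subspace_0[OF stable_subspace[OF U(1)]] subspace_0[OF hyperD(4)[OF
    h(1)]]
    by (intro exI[of _ "\<lambda>_. 0"]) (auto simp: eta_zero)
next
  case False
  note hd = hyperD[OF h(1)] and hd' = hyperD[OF h(2)]
  have sU: "subspace U" using U stable_subspace by auto
  obtain c where c: "\<And>k. Zs W U k \<subseteq> H \<longleftrightarrow> k \<le> c" "cols W U = (cols H U)(c := Suc (cols H U c))"
    using hyper_column[OF h(1) U(1,2)] by auto
  obtain c' where c': "\<And>k. Zs W U k \<subseteq> H' \<longleftrightarrow> k \<le> c'" "cols W U = (cols H U)(c' := Suc (cols H U c'))"
    using hyper_column[OF h(2) U(1,3)] eq by auto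
  have "c = c'" using c(2) c'(2) by (metis fun_upd_apply n_not_Suc_n)
  \<comment> \<open>A vector space is not the union of two proper subspaces; the witness is a +
    b.\<close>
  have "\<exists>v\<in>Zs W U (Suc c). v \<notin> H \<and> v \<notin> H'"
  proof (rule ccontr)
    assume n: "\<not> ?thesis"
    obtain a where a: "a \<in> Zs W U (Suc c)" "a \<notin> H" using c(1)[of "Suc c"] by auto
    obtain b where b: "b \<in> Zs W U (Suc c)" "b \<notin> H'" using c'(1)[of "Suc c"] \<open>c = c'\<close> by auto
    have ab: "a \<in> H'" "b \<in> H" using n a b by auto
    have "a + b \<in> Zs W U (Suc c)" using a b subspace_add[OF subspace_Zs[OF hd(2) sU]] by blast
    moreover have "a + b \<notin> H" using subspace_diff[OF hd(3) _ ab(2), of "a + b"] a by auto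
    moreover have "a + b \<notin> H'" using subspace_diff[OF hd'(3) _ ab(1), of "a + b"] b by auto
    ultimately show False using n by auto
  qed
  then obtain v0 where v0: "v0 \<in> Zs W U (Suc c)" "v0 \<notin> H" "v0 \<notin> H'" by auto
  then obtain w where w: "v0 \<in> W" "w \<in> W" "(eta ^^ Suc c) v0 - (eta ^^ Suc (Suc c)) w \<in> U"
    unfolding Zs_def im_iff by auto
  \<comment> \<open>The correction by \<open>eta w\<close> makes \<open>(eta ^^ Suc c) v\<close>
    fall into U. As \<open>eta\<close> maps W into both hyperplanes, v stays outside them.\<close>
  define v where "v = v0 - eta w"
  have vW: "v \<in> W" unfolding v_def using w hd by (auto intro: subspace_diff stable_eta)
  have vU: "(eta ^^ Suc c) v \<in> U" using w(3) unfolding v_def by (simp only: pow_diff pow_eta)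
  have vH: "v \<notin> H"
  proof
    assume "v \<in> H"
    from subspace_add[OF hd(3) this hd(7)[OF w(2)]] show False using v0(2) unfolding v_def by simp
  qed
  have vH': "v \<notin> H'"
  proof
    assume "v \<in> H'"
    from subspace_add[OF hd'(3) this hd'(7)[OF w(2)]] show False using v0(3) unfolding v_def by simp
  qed
  have ker: "y \<in> K \<longleftrightarrow> f y = 0" if "functional f" "\<forall>x\<in>K. f x = 0" "f v = 1"
    and K: "hyper K W" "v \<notin> K" "y \<in> W" for f K y
  proof -
    interpret f: Vector_Spaces.linear scale "(*)" f by fact
    obtain a where a: "y - a *s v \<in> K"
      using hyperplane_decompose[OF hyperD(3-6)[OF K(1)] vW K(2,3)] by auto
    then have "f y = a" using that(2,3) by (auto simp: f.diff f.scale)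
    then show ?thesis using a that(2) by auto
  qed
  obtain \<phi> where phi: "functional \<phi>" "\<forall>x\<in>H. \<phi> x = 0" "\<phi> v = 1"
    using separating_functional[OF hd(3) vH] by auto
  obtain \<phi>' where phi': "functional \<phi>'" "\<forall>x\<in>H'. \<phi>' x = 0" "\<phi>' v = 1"
    using separating_functional[OF hd'(3) vH'] by auto
  interpret p: Vector_Spaces.linear scale "(*)" \<phi> by fact
  interpret p': Vector_Spaces.linear scale "(*)" \<phi>' by fact
  have kH: "y \<in> H \<longleftrightarrow> \<phi> y = 0" and kH': "y \<in> H' \<longleftrightarrow> \<phi>' y = 0" if "y \<in> W" for y
    using ker[OF phi h(1) vH that] ker[OF phi' h(2) vH' that] by auto
  \<comment> \<open>For x in H the condition \<phi>'(x + D x) = 0 reads \<phi>'(D x) = \<psi> x, so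
    D is built to satisfy this on all of W.\<close>
  define \<psi> where "\<psi> x = \<phi> x - \<phi>' x" for x
  have psi_lin: "\<psi> (x + y) = \<psi> x + \<psi> y" "\<psi> (x - y) = \<psi> x - \<psi> y" "\<psi> (a *s x) = a * \<psi> x" for x y a
    by (simp_all add: \<psi>_def p.add p'.add p.diff p'.diff p.scale p'.scale algebra_simps)
  obtain x1 where x1: "x1 \<in> W" "\<psi> x1 \<noteq> 0"
    using False kH kH' hd(5) hd'(5) unfolding \<psi>_def
      by (metis eq_iff_diff_eq_0 subsetD subset_antisym subsetI)
  define x0 where "x0 = inverse (\<psi> x1) *s x1"
  have x0: "x0 \<in> W" "\<psi> x0 = 1" using x1 subspace_scale[OF hd(4)] by (auto simp: x0_def psi_lin)
  define K where "K = {x \<in> W. \<psi> x = 0}"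
  have K: "subspace K" unfolding K_def
    by (rule subspaceI) (auto simp: psi_lin subspace_0[OF hd(4)] subspace_add[OF hd(4)]
      subspace_scale[OF hd(4)] \<psi>_def[of 0])
  \<comment> \<open>Wanted is a functional \<theta> that vanishes on \<open>im (Suc c) W U\<close>
    and has \<theta>(\<open>(eta ^^ c) x\<close>) = \<psi> x on W. It exists because \<psi> vanishes
    on \<open>Zs W U c\<close>, which lies in both hyperplanes. Vanishing on S together with the
    value 1 at \<open>(eta ^^ c) x0\<close> encodes both requirements.\<close>
  define S where "S = msum (eta ^^ c) K (im (Suc c) W U)"
  have sI: "subspace (im (Suc c) W U)" using subspace_im[OF hd(4) sU] .
  have S: "subspace S" unfolding S_def by (rule subspace_msum[OF linear_pow K sI])
  have ZK: "Zs W U c \<subseteq> K"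
  proof
    fix x assume x: "x \<in> Zs W U c"
    then have "x \<in> H" "x \<in> H'" "x \<in> W" using c(1)[of c] c'(1)[of c] \<open>c = c'\<close> Zs_subset[of W U c]
      by auto
    then show "x \<in> K" using phi(2) phi'(2) unfolding K_def \<psi>_def by auto
  qed
  have "(eta ^^ c) x0 \<notin> S"
  proof
    assume "(eta ^^ c) x0 \<in> S"
    then obtain y where y: "y \<in> K" "(eta ^^ c) x0 - (eta ^^ c) y \<in> im (Suc c) W U"
      unfolding S_def msum_def by auto
    then have "x0 - y \<in> Zs W U c" unfolding Zs_def K_def using x0(1) hd(4)
      by (auto simp: pow_diff intro: subspace_diff)
    then have "\<psi> (x0 - y) = 0" using ZK unfolding K_def by auto
    then show False using y(1) x0(2) unfolding K_def by (simp add: psi_lin)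
  qed
  then obtain \<theta> where th: "functional \<theta>" "\<forall>x\<in>S. \<theta> x = 0" "\<theta> ((eta ^^ c) x0) = 1"
    using separating_functional[OF S] by blast
  interpret T: Vector_Spaces.linear scale "(*)" \<theta> by fact
  have IS: "im (Suc c) W U \<subseteq> S"
    unfolding S_def msum_def using subspace_0[OF K] by (auto intro!: bexI[of _ 0] simp: pow_zero)
  have th1: "\<theta> x = 0" if "x \<in> im (Suc c) W U" for x using th(2) IS that by auto
  have thU: "\<theta> x = 0" if "x \<in> U" for x using th1 im_superset[OF hd(4)] that by blast
  have thpow: "\<theta> ((eta ^^ j) x) = 0" if "Suc c \<le> j" "x \<in> W" for j x
  proof -
    have "(eta ^^ j) x \<in> im j W U" by (rule pow_in_im[OF sU that(2)])
    then show ?thesis using im_antimono[OF hd(2) that(1)] th1 by blast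
  qed
  have thc: "\<theta> ((eta ^^ c) x) = \<psi> x" if "x \<in> W" for x
  proof -
    have "x - \<psi> x *s x0 \<in> K" unfolding K_def using that x0 hd(4)
      by (auto simp: psi_lin intro: subspace_diff subspace_scale)
    then have "(eta ^^ c) (x - \<psi> x *s x0) \<in> S"
      unfolding S_def msum_def using subspace_0[OF sI] by (auto intro!: bexI[of _ "x - \<psi> x *s x0"])
    then have "\<theta> ((eta ^^ c) (x - \<psi> x *s x0)) = 0" using th(2) by blast
    then show ?thesis by (simp add: pow_diff pow_scale T.diff T.scale th(3))
  qed
  define D where "D x = (\<Sum>k\<le>c. \<theta> ((eta ^^ (c - k)) x) *s (eta ^^ k) v)" for x
  have linD: "endo D"
    unfolding Vector_Spaces.linear_iff D_def using vector_space_axioms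
    by (simp add: pow_add pow_scale T.add T.scale scale_left_distrib sum.distrib scale_sum_right)
  interpret D: Vector_Spaces.linear scale scale D by (rule linD)
  have thv: "\<theta> ((eta ^^ j) v) = 0" if "c \<le> j" for j
    using thc[OF vW] phi(3) phi'(3) thpow[OF _ vW, of j] that unfolding \<psi>_def
    by (cases "j = c") auto
  have nil: "(D ^^ Suc (Suc c)) x = 0" for x
    by (rule cyclic_map_nilpotent[OF D_def th(1) thv])
  have inj: "inj (\<lambda>x. x + t *s D x)" for t by (rule nilpotent_shift_inj[OF linD nil])
  have DW: "D x \<in> W" for x unfolding D_def
    using vW hd by (intro subspace_sum subspace_scale stable_pow) auto
  have DU: "D x = 0" if "x \<in> U" for x
    unfolding D_def using thU[OF stable_pow[OF U(1) that]] by simp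
  have comm: "D (eta x) - eta (D x) \<in> U" if x: "x \<in> W" for x
  proof -
    let ?f = "\<lambda>k. \<theta> ((eta ^^ (Suc c - k)) x) *s (eta ^^ k) v"
    have "(\<Sum>k\<le>c. \<theta> ((eta ^^ (c - k)) (eta x)) *s (eta ^^ k) v) = (\<Sum>k\<le>c. ?f k)"
      by (intro sum.cong) (auto simp: pow_eta Suc_diff_le simp del: funpow.simps)
    then have 1: "D (eta x) = (\<Sum>k\<le>c. ?f k)" unfolding D_def .
    have "eta (D x) = (\<Sum>k\<le>c. ?f (Suc k))"
    proof -
      interpret E: Vector_Spaces.linear scale scale eta by (rule linear_eta)
      show ?thesis unfolding D_def E.sum by (simp add: eta_scale)
    qed
    \<comment> \<open>The two sums are shifts of each other. The extra term at 0 vanishes since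
      \<theta> kills \<open>(eta ^^ Suc c) x\<close>; the extra term at c + 1 is a multiple of
      \<open>(eta ^^ Suc c) v\<close> and lies in U.\<close>
    then have "?f 0 + eta (D x) = (\<Sum>k\<le>Suc c. ?f k)" by (simp only: sum.atMost_Suc_shift)
    also have "\<dots> = D (eta x) + ?f (Suc c)" unfolding 1 by simp
    finally have "D (eta x) - eta (D x) = - ?f (Suc c)"
      using thpow[OF _ x, of "Suc c"] by (simp add: algebra_simps del: funpow.simps)
    then show ?thesis using subspace_neg[OF sU subspace_scale[OF sU vU]] by metis
  qed
  have p'D: "\<phi>' (D x) = \<psi> x" if x: "x \<in> W" for x
  proof -
    have z: "\<phi>' ((eta ^^ k) v) = 0" if k: "k \<noteq> 0" for k
    proof -
      obtain j where "k = Suc j" using k not0_implies_Suc by blast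
      then have "(eta ^^ k) v = eta ((eta ^^ j) v)" by simp
      then have "(eta ^^ k) v \<in> H'" using hd'(7)[OF stable_pow[OF hd(2) vW]] by metis
      then show ?thesis using phi'(2) by blast
    qed
    have "\<phi>' (D x) = (\<Sum>k\<le>c. \<theta> ((eta ^^ (c - k)) x) * \<phi>' ((eta ^^ k) v))"
      unfolding D_def by (simp add: p'.sum p'.scale)
    also have "\<dots> = \<theta> ((eta ^^ c) x)"
      using sum_singleton_support[of c "\<lambda>k. \<theta> ((eta ^^ (c - k)) x) * \<phi>' ((eta ^^ k) v)"] z phi'(3)
        by simp
    finally show ?thesis using thc[OF x] by simp
  qed
  have sub: "(\<lambda>x. x + D x) ` H \<subseteq> H'"
  proof
    fix y assume "y \<in> (\<lambda>x. x + D x) ` H"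
    then obtain x where x: "x \<in> H" "y = x + D x" by auto
    then have xW: "x \<in> W" using hd by auto
    have "\<phi>' y = \<phi>' x + \<psi> x" using x p'D[OF xW] by (simp add: p'.add)
    also have "\<dots> = 0" using x phi(2) unfolding \<psi>_def by auto
    finally show "y \<in> H'" using kH'[of y] x xW DW subspace_add[OF hd(4)] by auto
  qed
  have "endo (\<lambda>x. x + D x)"
    unfolding Vector_Spaces.linear_iff using vector_space_axioms
    by (simp add: D.add D.scale scale_right_distrib)
  then interpret G: Vector_Spaces.linear scale scale "\<lambda>x. x + D x" .
  have "dim ((\<lambda>x. x + D x) ` H) = dim H"
    using dim_inj_image[OF G.linear_axioms] inj[of 1] by simp
  then have "(\<lambda>x. x + D x) ` H = H'"
    using subspace_dim_equal[OF G.subspace_image[OF hd(3)] hd'(3) sub] hd(6) hd'(6) by simp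
  then show ?thesis using linD inj DW DU comm by (intro exI[of _ D]) auto
qed

section \<open>Polynomial curves and flags of prescribed type\<close>

definition pcurve :: "('a \<Rightarrow> 'b) \<Rightarrow> bool" where
  "pcurve w \<longleftrightarrow> (\<forall>\<phi>. functional \<phi> \<longrightarrow> (\<exists>q. \<forall>t. \<phi> (w t) = poly q t))"

lemma pcurve_const: "pcurve (\<lambda>_. b)"
  unfolding pcurve_def
proof (intro allI impI)
  fix \<phi> :: "'b \<Rightarrow> 'a"
  show "\<exists>q. \<forall>t. \<phi> b = poly q t" by (rule exI[of _ "[:\<phi> b:]"]) simp
qed

lemma pcurve_linear:
  assumes w: "pcurve w" and D: "endo D"
  shows "pcurve (\<lambda>t. D (w t))"
  unfolding pcurve_def
proof (intro allI impI)
  fix \<phi> assume "functional \<phi>"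
  from Vector_Spaces.linear_compose[OF D this] w
  show "\<exists>q. \<forall>t. \<phi> (D (w t)) = poly q t" unfolding pcurve_def comp_def by blast
qed

lemma pcurve_shear:
  assumes w: "pcurve w" and D: "endo D"
  shows "pcurve (\<lambda>t. w t + t *s D (w t))"
  unfolding pcurve_def
proof (intro allI impI)
  fix \<phi> assume phi: "functional \<phi>"
  interpret L: Vector_Spaces.linear scale "(*)" \<phi> by fact
  obtain q where q: "\<forall>t. \<phi> (w t) = poly q t" using w phi unfolding pcurve_def by blast
  obtain r where r: "\<forall>t. \<phi> (D (w t)) = poly r t" using pcurve_linear[OF w D] phi
    unfolding pcurve_def by blast
  show "\<exists>q. \<forall>t. \<phi> (w t + t *s D (w t)) = poly q t"
    by (rule exI[of _ "q + [:0, 1:] * r"]) (simp add: L.add L.scale q r)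
qed

text \<open>The index j is the dimension in the ambient space, so it includes dim U. Values outside
  m, ..., dim W are free; sets of flags in the topology are therefore cut down by
  \<open>extensional\<close>.\<close>

definition Fl :: "'b set \<Rightarrow> nat \<Rightarrow> 'b set \<Rightarrow> (nat \<Rightarrow> nat \<Rightarrow> nat) \<Rightarrow> (nat \<Rightarrow> 'b set) set" where
  "Fl U m W \<kappa> = {f. (\<forall>j\<in>{m..dim W}. stable (f j) \<and> dim (f j) = j \<and> U \<subseteq> f j \<and> cols (f j) U = \<kappa> j) \<and>
     (\<forall>j\<in>{m..<dim W}. f j \<subseteq> f (Suc j)) \<and> f (dim W) = W}"

text \<open>The parameter type is left open: it is a scalar for curves and a frame for the Zariski
  topology.\<close>

definition curve_flag :: "(nat \<Rightarrow> 'x \<Rightarrow> 'b) \<Rightarrow> 'x \<Rightarrow> nat \<Rightarrow> 'b set" where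
  "curve_flag v t j = span ((\<lambda>a. v a t) ` {..<j})"

lemma enumerate_basis:
  assumes "subspace W"
  shows "\<exists>b. span (b ` {..<dim W}) = W"
proof -
  obtain B where B: "B \<subseteq> W" "independent B" "W \<subseteq> span B" "card B = dim W" using basis_exists
    by blast
  have "finite B" using B(2) finiteI_independent by blast
  then obtain b where "bij_betw b {..<card B} B"
    using ex_bij_betw_nat_finite by (metis atLeast0LessThan)
  then have "b ` {..<dim W} = B" using B(4) by (simp add: bij_betw_def)
  moreover have "span B = W" using B assms span_subspace by blast
  ultimately show ?thesis by metis
qed

lemma Fl_hyper:
  assumes "f \<in> Fl U m W \<kappa>" "m \<le> j" "j < dim W"
  shows "hyper (f j) (f (Suc j))"
  using assms unfolding Fl_def hyper_def by auto

lemma Fl_mono: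
  assumes f: "f \<in> Fl U m W \<kappa>" and "m \<le> i" "i \<le> j" "j \<le> dim W"
  shows "f i \<subseteq> f j"
  using assms(3,2,4)
proof (induction rule: dec_induct)
  case (step n)
  then have "f n \<subseteq> f (Suc n)" using f unfolding Fl_def by auto
  then show ?case using step by auto
qed simp

text \<open>This replaces the irreducibility of the variety of flags of a given type.\<close>

lemma Fl_curve:
  assumes U: "stable U" and m: "m \<le> dim W"
    and f: "f \<in> Fl U m W \<kappa>" and f': "f' \<in> Fl U m W \<kappa>"
  shows "\<exists>v. (\<forall>a. pcurve (v a)) \<and> (\<forall>t. curve_flag v t \<in> Fl U m W \<kappa>) \<and>
    (\<forall>j\<in>{m..dim W}. curve_flag v 0 j = f j \<and> curve_flag v 1 j = f' j)"
  using m f f'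
proof (induction "dim W - m" arbitrary: W f f')
  case 0
  then have "m = dim W" by simp
  then have *: "stable W" "f m = W" "f' m = W" "U \<subseteq> W" "cols W U = \<kappa> m" using 0 unfolding Fl_def
    by auto
  obtain b where "span (b ` {..<dim W}) = W" using enumerate_basis[OF stable_subspace[OF *(1)]]
    by auto
  with * show ?case using \<open>m = dim W\<close>
    by (intro exI[of _ "\<lambda>a t. b a"]) (auto simp: pcurve_const curve_flag_def Fl_def)
next
  case (Suc d)
  define w where "w = m + d"
  have dW: "dim W = Suc w" and mw: "m \<le> w" using Suc.hyps(2) w_def by auto
  note f = Suc.prems(2) and f' = Suc.prems(3)
  have fW: "f (Suc w) = W" "f' (Suc w) = W" using f f' dW unfolding Fl_def by auto
  define H H' where "H = f w" and "H' = f' w"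
  have h: "hyper H W" "hyper H' W"
    using Fl_hyper[OF f mw] Fl_hyper[OF f' mw] dW fW unfolding H_def H'_def by auto
  have UH: "U \<subseteq> H" "U \<subseteq> H'" and cH: "cols H U = \<kappa> w" "cols H' U = \<kappa> w" and dH: "dim H = w"
    using f f' mw dW unfolding Fl_def H_def H'_def by auto
  note hd = hyperD[OF h(1)]
  obtain D where D: "endo D" "\<And>t. inj (\<lambda>x. x + t *s D x)" "D ` W \<subseteq> W"
    "\<And>x. x \<in> U \<Longrightarrow> D x = 0" "\<And>x. x \<in> W \<Longrightarrow> D (eta x) - eta (D x) \<in> U" "(\<lambda>x. x + D x) ` H = H'"
    using transvection[OF h U UH] cH by auto
  interpret D: Vector_Spaces.linear scale scale D by (rule D(1))
  define g where "g t x = x + t *s D x" for t x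
  have lg: "endo (g t)" for t
    unfolding Vector_Spaces.linear_iff g_def using vector_space_axioms
    by (simp add: D.add D.scale scale_right_distrib scale_left_commute)
  have ig: "inj (g t)" for t unfolding g_def by (rule D(2))
  have gU: "g t x = x" if "x \<in> U" for t x using D(4)[OF that] by (simp add: g_def)
  have sU: "subspace U" using U stable_subspace by auto
  have comm: "g t (eta x) - eta (g t x) \<in> U" if "x \<in> W" for t x
  proof -
    have "g t (eta x) - eta (g t x) = t *s (D (eta x) - eta (D x))"
      by (simp add: g_def eta_add eta_scale scale_right_diff_distrib)
    then show ?thesis using subspace_scale[OF sU D(5)[OF that]] by metis
  qed
  have gW: "g t ` W = W" for t
  proof -
    interpret G: Vector_Spaces.linear scale scale "g t" by (rule lg)
    have "g t ` W \<subseteq> W" unfolding g_def using D(3) hd(4)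
      by (auto intro!: subspace_add subspace_scale)
    then show ?thesis
      using subspace_dim_equal[OF G.subspace_image[OF hd(4)] hd(4)] dim_inj_image[OF lg ig] by auto
  qed
  have g1: "g 1 ` H = H'" using D(6) unfolding g_def by simp
  define hh where "hh = inv_into UNIV (g 1)"
  have hg: "hh (g 1 x) = x" for x unfolding hh_def using ig by simp
  have "surj (g 1)" using linear_inj_imp_surj[OF lg ig] .
  then have gh: "g 1 (hh x) = x" for x unfolding hh_def by (simp add: surj_f_inv_f)
  have lh: "endo hh" unfolding hh_def using inj_linear_imp_inv_linear[OF lg ig] .
  have ih: "inj hh" using gh by (metis injI)
  have hU: "hh x = x" if "x \<in> U" for x using hg[of x] gU[OF that, of 1] by simp
  have hcomm: "hh (eta x) - eta (hh x) \<in> U" if "x \<in> W" for x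
  proof -
    interpret hh: Vector_Spaces.linear scale scale hh by (rule lh)
    have "hh x \<in> W" using that gW[of 1] hg by (metis imageE)
    from comm[OF this, of 1] have u: "g 1 (eta (hh x)) - eta x \<in> U" using gh by simp
    from hU[OF u] have "eta (hh x) - hh (eta x) = g 1 (eta (hh x)) - eta x"
      by (simp add: hh.diff hg)
    with u have "eta (hh x) - hh (eta x) \<in> U" by simp
    from subspace_neg[OF sU this] show ?thesis by simp
  qed
  \<comment> \<open>Pulling \<open>f'\<close> back by the inverse of \<open>g 1\<close> puts it
    below H. A curve inside H from \<open>f\<close> to \<open>f2\<close>, moved by
    \<open>g t\<close>, then runs from \<open>f\<close> to \<open>f'\<close>, since
    \<open>g 0\<close> is the identity.\<close>
  define f2 where "f2 j = hh ` f' j" for j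
  have "hh ` g 1 ` H = H" using hg by (simp add: image_image)
  then have f2H: "f2 w = H" using g1 unfolding f2_def H'_def by simp
  have fH: "f \<in> Fl U m H \<kappa>" using f dW dH H_def unfolding Fl_def by auto
  have "f2 \<in> Fl U m H \<kappa>"
    unfolding Fl_def dH
  proof (intro CollectI conjI ballI)
    fix j assume j: "j \<in> {m..w}"
    have X: "stable (f' j)" "U \<subseteq> f' j" "f' j \<subseteq> W" "dim (f' j) = j" "cols (f' j) U = \<kappa> j"
      using j f' Fl_mono[OF f', of j "Suc w"] dW fW unfolding Fl_def by auto
    from transport[OF lh ih hU hcomm U X(1-3)] X
    show "stable (f2 j)" "dim (f2 j) = j" "U \<subseteq> f2 j" "cols (f2 j) U = \<kappa> j" unfolding f2_def by auto
  next
    fix j assume "j \<in> {m..<w}"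
    then have "f' j \<subseteq> f' (Suc j)" using f' dW unfolding Fl_def by auto
    then show "f2 j \<subseteq> f2 (Suc j)" unfolding f2_def by auto
  qed (rule f2H)
  moreover have "d = dim H - m" "m \<le> dim H" using dH w_def by auto
  ultimately obtain v where v0: "\<forall>a. pcurve (v a)" "\<forall>t. curve_flag v t \<in> Fl U m H \<kappa>"
    "\<forall>j\<in>{m..dim H}. curve_flag v 0 j = f j \<and> curve_flag v 1 j = f2 j"
      using Suc.hyps(1)[of H f f2] fH by blast
  have v: "\<And>a. pcurve (v a)" "\<And>t. curve_flag v t \<in> Fl U m H \<kappa>"
    "\<And>j. j \<in> {m..w} \<Longrightarrow> curve_flag v 0 j = f j \<and> curve_flag v 1 j = f2 j" using v0 dH by auto
  obtain x where x: "x \<in> W" "x \<notin> H" using hd by (metis n_not_Suc_n subsetI subset_antisym)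
  \<comment> \<open>The vector x outside H supplies the last step from H to W.\<close>
  define v' where "v' a t = (if a < w then g t (v a t) else g t x)" for a t
  have pv': "pcurve (v' a)" for a
    using pcurve_shear[OF v(1)[of a] D(1)] pcurve_shear[OF pcurve_const[of x] D(1)]
    by (cases "a < w") (auto simp: v'_def[abs_def] g_def)
  have fl1: "curve_flag v' t j = g t ` curve_flag v t j" if "j \<le> w" for t j
  proof -
    interpret G: Vector_Spaces.linear scale scale "g t" by (rule lg)
    have "(\<lambda>a. v' a t) ` {..<j} = g t ` (\<lambda>a. v a t) ` {..<j}"
      using that unfolding v'_def by (auto simp: image_image)
    then show ?thesis unfolding curve_flag_def by (simp only: G.span_image)
  qed
  have fl2: "curve_flag v' t (Suc w) = W" for t
  proof -
    interpret G: Vector_Spaces.linear scale scale "g t" by (rule lg)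
    have Hw: "span ((\<lambda>a. v a t) ` {..<w}) = H" using v(2)[of t] dH unfolding Fl_def curve_flag_def
      by auto
    have "(\<lambda>a. v' a t) ` {..<Suc w} = g t ` insert x ((\<lambda>a. v a t) ` {..<w})"
      unfolding v'_def by (auto simp: lessThan_Suc)
    then have "curve_flag v' t (Suc w) = g t ` span (insert x ((\<lambda>a. v a t) ` {..<w}))"
      unfolding curve_flag_def by (simp only: G.span_image)
    also have "span (insert x ((\<lambda>a. v a t) ` {..<w})) = span (insert x H)"
      unfolding set_eq_iff span_breakdown_eq Hw span_of_subspace[OF hd(3)] by simp
    also have "\<dots> = W" using hyperplane_span[OF hd(3-6) x] by simp
    finally show ?thesis using gW by simp
  qed
  show ?case
  proof (intro exI[of _ v'] conjI allI ballI)
    show "pcurve (v' a)" for a by (rule pv')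
    fix t
    have *: "stable (curve_flag v' t j) \<and> dim (curve_flag v' t j) = j \<and> U \<subseteq> curve_flag v' t j
      \<and> cols (curve_flag v' t j) U = \<kappa> j"
      if j: "j \<in> {m..w}" for j
    proof -
      have X: "stable (curve_flag v t j)" "U \<subseteq> curve_flag v t j" "curve_flag v t j \<subseteq> W"
        "dim (curve_flag v t j) = j" "cols (curve_flag v t j) U = \<kappa> j"
        using j v(2)[of t] Fl_mono[OF v(2)[of t], of j w] dH hd(5) unfolding Fl_def by auto
      from transport[OF lg ig gU comm U X(1-3)] X show ?thesis using fl1[of j] j by auto
    qed
    show "curve_flag v' t \<in> Fl U m W \<kappa>"
      unfolding Fl_def dW
    proof (intro CollectI conjI ballI)
      fix j assume "j \<in> {m..Suc w}"
      then consider "j \<in> {m..w}" | "j = Suc w" by fastforce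
      then have "stable (curve_flag v' t j) \<and> dim (curve_flag v' t j) = j \<and> U \<subseteq> curve_flag v' t j
        \<and> cols (curve_flag v' t j) U = \<kappa> j"
      proof cases
        case 2
        then show ?thesis using f dW mw fW unfolding Fl_def by (auto simp: fl2)
      qed (rule *)
      then show "stable (curve_flag v' t j)" "dim (curve_flag v' t j) = j" "U \<subseteq> curve_flag v' t j"
        "cols (curve_flag v' t j) U = \<kappa> j" by auto
    next
      fix j assume "j \<in> {m..<Suc w}"
      show "curve_flag v' t j \<subseteq> curve_flag v' t (Suc j)"
        unfolding curve_flag_def by (intro span_mono) auto
    qed (rule fl2)
  next
    fix j assume "j \<in> {m..dim W}"
    then consider "j \<in> {m..w}" | "j = Suc w" using dW by fastforce
    then show "curve_flag v' 0 j = f j"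
    proof cases
      case 1
      then show ?thesis using fl1[of j 0] v(3)[of j] by (auto simp: g_def)
    next
      case 2
      then show ?thesis using fl2 fW by simp
    qed
  next
    fix j assume "j \<in> {m..dim W}"
    then consider "j \<in> {m..w}" | "j = Suc w" using dW by fastforce
    then show "curve_flag v' 1 j = f' j"
    proof cases
      case 1
      then have "curve_flag v' 1 j = g 1 ` hh ` f' j" using fl1[of j 1] v(3)[of j] f2_def by auto
      then show ?thesis using gh by (simp add: image_image)
    next
      case 2
      then show ?thesis using fl2 fW by simp
    qed
  qed
qed

end

section \<open>Growth diagrams of generic flags\<close>

text \<open>The jeu de taquin slide in terms of columns: if \<open>\<kappa> j\<close> lists the column lengths of the shape of
  the entries less than \<open>j\<close>, the smallest entry being \<open>u\<close>, then \<open>pcol \<kappa> u j\<close> is the column of the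
  empty square after sliding these entries. Only \<open>j > u\<close> is meaningful.\<close>

primrec pcol :: "(nat \<Rightarrow> nat \<Rightarrow> nat) \<Rightarrow> nat \<Rightarrow> nat \<Rightarrow> nat" where
  "pcol \<kappa> u 0 = 0"
| "pcol \<kappa> u (Suc j) = (if j \<le> u then 0
     else if \<kappa> (Suc j) (Suc (pcol \<kappa> u j)) < \<kappa> (Suc j) (pcol \<kappa> u j) then pcol \<kappa> u j
     else Suc (pcol \<kappa> u j))"

declare pcol.simps(2) [simp del]

lemma pcol_first [simp]: "pcol \<kappa> u (Suc u) = 0"
  by (simp add: pcol.simps)

lemma fun_inc_inj: "(f :: nat \<Rightarrow> nat)(c := Suc (f c)) = g(c := Suc (g c)) \<Longrightarrow> f = g"
proof
  fix x assume "f(c := Suc (f c)) = g(c := Suc (g c))"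
  from fun_cong[OF this, of x] show "f x = g x" by (cases "x = c") auto
qed

lemma fun_inc_index: "(f :: nat \<Rightarrow> nat)(c := Suc (f c)) = f(d := Suc (f d)) \<Longrightarrow> c = d"
proof (rule ccontr)
  assume "f(c := Suc (f c)) = f(d := Suc (f d))" "c \<noteq> d"
  from fun_cong[OF this(1), of c] this(2) show False by simp
qed

text \<open>The shapes after the slide. In the range of \<open>pcol_corner\<close> the subtraction
  is not truncated.\<close>

definition down :: "(nat \<Rightarrow> nat \<Rightarrow> nat) \<Rightarrow> nat \<Rightarrow> nat \<Rightarrow> nat \<Rightarrow> nat" where
  "down \<kappa> u j = (\<kappa> j)(pcol \<kappa> u j := \<kappa> j (pcol \<kappa> u j) - 1)"

text \<open>The column lengths of the growing shapes of a standard tableau with entries u, ..., w -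
  1.\<close>

definition valid :: "nat \<Rightarrow> nat \<Rightarrow> (nat \<Rightarrow> nat \<Rightarrow> nat) \<Rightarrow> bool" where
  "valid u w \<kappa> \<longleftrightarrow> \<kappa> u = (\<lambda>_. 0) \<and> (\<forall>j\<in>{u..w}. antimono (\<kappa> j)) \<and>
     (\<forall>j\<in>{u..<w}. \<exists>c. \<kappa> (Suc j) = (\<kappa> j)(c := Suc (\<kappa> j c)))"

lemma valid_step:
  assumes "valid u w \<kappa>" "u \<le> j" "j < w"
  obtains c where "\<kappa> (Suc j) = (\<kappa> j)(c := Suc (\<kappa> j c))"
  using assms unfolding valid_def by force

lemma valid_anti: "valid u w \<kappa> \<Longrightarrow> u \<le> j \<Longrightarrow> j \<le> w \<Longrightarrow> k \<le> l \<Longrightarrow> \<kappa> j l \<le> \<kappa> j k"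
  unfolding valid_def antimono_def by auto

lemma valid_first:
  assumes v: "valid u w \<kappa>" and u: "u < w"
  shows "\<kappa> (Suc u) = (\<lambda>_. 0)(0 := 1)"
proof -
  obtain c where c: "\<kappa> (Suc u) = (\<kappa> u)(c := Suc (\<kappa> u c))" using valid_step[OF v order_refl u] .
  have 0: "\<kappa> u = (\<lambda>_. 0)" using v unfolding valid_def by auto
  have "\<kappa> (Suc u) c \<le> \<kappa> (Suc u) 0" using valid_anti[OF v, of "Suc u" 0 c] u by auto
  then have "c = 0" unfolding c 0 by (auto split: if_splits)
  then show ?thesis unfolding c 0 by simp
qed

text \<open>If the new square destroys the corner in column p, it must lie in column p + 1, level
  with the bottom of column p. Then column p + 1 ends in a corner, and \<open>pcol\<close> has moved
  there.\<close>

lemma pcol_corner: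
  assumes v: "valid u w \<kappa>" and "Suc u \<le> j" "j \<le> w"
  shows "\<kappa> j (Suc (pcol \<kappa> u j)) < \<kappa> j (pcol \<kappa> u j)"
  using assms(2,3)
proof (induction j rule: dec_induct)
  case base
  then show ?case using valid_first[OF v] by simp
next
  case (step j)
  obtain c where c: "\<kappa> (Suc j) = (\<kappa> j)(c := Suc (\<kappa> j c))"
    using valid_step[OF v, of j] step by auto
  let ?p = "pcol \<kappa> u j"
  show ?case
  proof (cases "\<kappa> (Suc j) (Suc ?p) < \<kappa> (Suc j) ?p")
    case False
    have 1: "\<kappa> j (Suc ?p) < \<kappa> j ?p" using step by simp
    then have "c = Suc ?p" using False c by (auto split: if_splits)
    moreover have "\<kappa> j (Suc (Suc ?p)) \<le> \<kappa> j (Suc ?p)"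
      using valid_anti[OF v, of j "Suc ?p" "Suc (Suc ?p)"] step by auto
    ultimately show ?thesis using False step c by (simp add: pcol.simps)
  qed (use step in \<open>auto simp: pcol.simps\<close>)
qed

lemma down_up:
  assumes "valid u w \<kappa>" "Suc u \<le> j" "j \<le> w"
  shows "\<kappa> j = (down \<kappa> u j)(pcol \<kappa> u j := Suc (down \<kappa> u j (pcol \<kappa> u j)))"
  using pcol_corner[OF assms] unfolding down_def by (auto simp: fun_eq_iff)

text \<open>The hole changes its column only if entry j is its right neighbour. That entry then
  moves into the hole, so the slid shape including j is the old shape without j.\<close>

lemma pcol_bump:
  assumes v: "valid u w \<kappa>" and j: "Suc u \<le> j" "j < w" and n: "pcol \<kappa> u (Suc j) \<noteq> pcol \<kappa> u j"
  shows "pcol \<kappa> u (Suc j) = Suc (pcol \<kappa> u j)"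
    "\<kappa> (Suc j) (Suc (pcol \<kappa> u j)) = \<kappa> (Suc j) (pcol \<kappa> u j)"
    "\<kappa> j (pcol \<kappa> u j) = Suc (\<kappa> j (Suc (pcol \<kappa> u j)))"
    "down \<kappa> u (Suc j) = \<kappa> j"
proof -
  let ?p = "pcol \<kappa> u j"
  have le: "\<not> \<kappa> (Suc j) (Suc ?p) < \<kappa> (Suc j) ?p" using n j
    by (auto simp: pcol.simps split: if_splits)
  then show e: "pcol \<kappa> u (Suc j) = Suc ?p" using j by (auto simp: pcol.simps)
  show eq: "\<kappa> (Suc j) (Suc ?p) = \<kappa> (Suc j) ?p"
    using le valid_anti[OF v, of "Suc j" ?p "Suc ?p"] j by auto
  obtain c where c: "\<kappa> (Suc j) = (\<kappa> j)(c := Suc (\<kappa> j c))" using valid_step[OF v, of j] j by auto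
  have 1: "\<kappa> j (Suc ?p) < \<kappa> j ?p" using pcol_corner[OF v] j by simp
  then have "c = Suc ?p" using le c by (auto split: if_splits)
  then show "\<kappa> j ?p = Suc (\<kappa> j (Suc ?p))" "down \<kappa> u (Suc j) = \<kappa> j"
    using c eq e unfolding down_def by (auto simp: fun_eq_iff)
qed

text \<open>Each slid shape again grows by one square: in the column of the old square if the hole
  keeps its column, and in the column of the old hole otherwise.\<close>

lemma valid_down:
  assumes v: "valid u w \<kappa>" and u: "u < w"
  shows "valid (Suc u) w (down \<kappa> u)"
  unfolding valid_def
proof (intro conjI ballI)
  show "down \<kappa> u (Suc u) = (\<lambda>_. 0)" unfolding down_def using valid_first[OF v u] by auto
next
  fix j assume j: "j \<in> {Suc u..w}"
  have a: "\<kappa> j l \<le> \<kappa> j k" if "k \<le> l" for k l using valid_anti[OF v _ _ that, of j] j by auto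
  have c: "\<kappa> j (Suc (pcol \<kappa> u j)) < \<kappa> j (pcol \<kappa> u j)" using pcol_corner[OF v] j by auto
  show "antimono (down \<kappa> u j)"
  proof (rule antimonoI)
    fix k l :: nat assume kl: "k \<le> l"
    show "down \<kappa> u j l \<le> down \<kappa> u j k"
    proof (cases "k = pcol \<kappa> u j \<and> l \<noteq> k")
      case True
      then have "\<kappa> j l \<le> \<kappa> j (Suc (pcol \<kappa> u j))" using kl by (intro a) auto
      then show ?thesis using True c unfolding down_def by auto
    next
      case False
      then show ?thesis using a[OF kl] unfolding down_def by (auto simp: diff_le_mono)
    qed
  qed
next
  fix j assume "j \<in> {Suc u..<w}"
  then have j: "Suc u \<le> j" "j < w" by auto
  obtain c where c: "\<kappa> (Suc j) = (\<kappa> j)(c := Suc (\<kappa> j c))" using valid_step[OF v, of j] j by auto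
  have cor: "0 < \<kappa> j (pcol \<kappa> u j)" using pcol_corner[OF v, of j] j by auto
  show "\<exists>c. down \<kappa> u (Suc j) = (down \<kappa> u j)(c := Suc (down \<kappa> u j c))"
  proof (cases "pcol \<kappa> u (Suc j) = pcol \<kappa> u j")
    case True
    then have "down \<kappa> u (Suc j) = (down \<kappa> u j)(c := Suc (down \<kappa> u j c))"
      unfolding down_def True c using cor by (auto simp: fun_eq_iff)
    then show ?thesis by blast
  next
    case False
    from pcol_bump(4)[OF v j this] show ?thesis using down_up[OF v, of j] j
      by (intro exI[of _ "pcol \<kappa> u j"]) auto
  qed
qed

lemma valid_sub: "valid u w \<kappa> \<Longrightarrow> w' \<le> w \<Longrightarrow> valid u w' \<kappa>"
  unfolding valid_def by auto

section \<open>Generic ranks of flags\<close>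

lemma generic_finite:
  fixes A :: "('x \<Rightarrow> 'a::field) set"
  assumes const: "\<And>c. (\<lambda>_. c) \<in> A" and mult: "\<And>p q. p \<in> A \<Longrightarrow> q \<in> A \<Longrightarrow> (\<lambda>x. p x * q x) \<in> A"
    and Q: "finite Q" and P: "\<And>q. q \<in> Q \<Longrightarrow> \<exists>p\<in>A. p x0 \<noteq> 0 \<and> (\<forall>x. p x \<noteq> 0 \<longrightarrow> P q x)"
  shows "\<exists>p\<in>A. p x0 \<noteq> 0 \<and> (\<forall>x. p x \<noteq> 0 \<longrightarrow> (\<forall>q\<in>Q. P q x))"
  using Q P
proof (induction Q rule: finite_induct)
  case empty
  then show ?case using const[of 1] by (intro bexI[of _ "\<lambda>_. 1"]) auto
next
  case (insert q Q)
  obtain p where p: "p \<in> A" "p x0 \<noteq> 0" "\<forall>x. p x \<noteq> 0 \<longrightarrow> (\<forall>q\<in>Q. P q x)" using insert by auto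
  obtain r where r: "r \<in> A" "r x0 \<noteq> 0" "\<forall>x. r x \<noteq> 0 \<longrightarrow> P q x" using insert.prems by auto
  show ?case using p r mult by (intro bexI[of _ "\<lambda>x. p x * r x"]) auto
qed

lemma range_poly_algebra:
  fixes p q :: "'a::field \<Rightarrow> 'a"
  shows "(\<lambda>_. c) \<in> range (poly :: 'a poly \<Rightarrow> 'a \<Rightarrow> 'a)"
    and "p \<in> range poly \<Longrightarrow> q \<in> range poly \<Longrightarrow> (\<lambda>x. p x + q x) \<in> range poly"
    and "p \<in> range poly \<Longrightarrow> q \<in> range poly \<Longrightarrow> (\<lambda>x. p x * q x) \<in> range poly"
proof -
  show "(\<lambda>_. c) \<in> range (poly :: 'a poly \<Rightarrow> 'a \<Rightarrow> 'a)" by (intro image_eqI[of _ _ "[:c:]"]) auto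
  assume "p \<in> range poly" "q \<in> range poly"
  then obtain P Q where "p = poly P" "q = poly Q" by auto
  then have "(\<lambda>x. p x + q x) = poly (P + Q)" "(\<lambda>x. p x * q x) = poly (P * Q)"
    by (auto simp: fun_eq_iff)
  then show "(\<lambda>x. p x + q x) \<in> range poly" "(\<lambda>x. p x * q x) \<in> range poly" by simp_all
qed

context nilpotent_endo
begin

lemma im_span: "im k (span A) (span B) = span ((eta ^^ k) ` A \<union> B)"
proof -
  interpret L: Vector_Spaces.linear scale scale "eta ^^ k" by (rule linear_pow)
  have "im k (span A) (span B) = {x + y |x y. x \<in> (eta ^^ k) ` span A \<and> y \<in> span B}"
  proof (intro equalityI subsetI)
    fix y assume "y \<in> im k (span A) (span B)"
    then obtain x where "x \<in> span A" "y - (eta ^^ k) x \<in> span B" unfolding im_iff by auto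
    then show "y \<in> {x + y |x y. x \<in> (eta ^^ k) ` span A \<and> y \<in> span B}"
      by (intro CollectI exI[of _ "(eta ^^ k) x"] exI[of _ "y - (eta ^^ k) x"]) auto
  next
    fix y assume "y \<in> {x + y |x y. x \<in> (eta ^^ k) ` span A \<and> y \<in> span B}"
    then show "y \<in> im k (span A) (span B)" unfolding im_iff by force
  qed
  then show ?thesis unfolding span_Un L.span_image .
qed

text \<open>The image is spanned by the transformed spanning vectors of the upper space together
  with those of the lower one, so \<open>dim_span_generic\<close> applies. The separate family
  \<open>v'\<close> admits a lower space that is not a member of the flag.\<close>

lemma rank_generic:
  fixes A :: "('x \<Rightarrow> 'a) set"
  assumes const: "\<And>c. (\<lambda>_. c) \<in> A" and add: "\<And>p q. p \<in> A \<Longrightarrow> q \<in> A \<Longrightarrow> (\<lambda>x. p x + q x) \<in> A"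
    and mult: "\<And>p q. p \<in> A \<Longrightarrow> q \<in> A \<Longrightarrow> (\<lambda>x. p x * q x) \<in> A"
    and v: "\<And>a \<phi>. a < j \<Longrightarrow> functional \<phi> \<Longrightarrow> (\<lambda>x. \<phi> (v a x)) \<in> A"
    and v': "\<And>a \<phi>. a < i \<Longrightarrow> functional \<phi> \<Longrightarrow> (\<lambda>x. \<phi> (v' a x)) \<in> A"
  shows "\<exists>p\<in>A. p x0 \<noteq> 0 \<and> (\<forall>x. p x \<noteq> 0 \<longrightarrow>
    rank k (curve_flag v x0 j) (curve_flag v' x0 i) \<le> rank k (curve_flag v x j) (curve_flag v' x
      i))"
proof -
  define w where "w s x = (case s of Inl a \<Rightarrow> (eta ^^ k) (v a x) | Inr a \<Rightarrow> v' a x)" for s x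
  define S where "S = Inl ` {..<j} \<union> Inr ` {..<i}"
  have r: "rank k (curve_flag v x j) (curve_flag v' x i) = dim (span ((\<lambda>s. w s x) ` S))" for x
    unfolding rank_def curve_flag_def im_span S_def image_Un image_image w_def by simp
  have "(\<lambda>x. \<phi> (w s x)) \<in> A" if s: "s \<in> S" and phi: "functional \<phi>" for s \<phi>
  proof (cases s)
    case (Inl a)
    then show ?thesis using v[OF _ Vector_Spaces.linear_compose[OF linear_pow phi], of a] s
      by (auto simp: w_def S_def comp_def)
  next
    case (Inr a)
    then show ?thesis using v'[OF _ phi, of a] s by (auto simp: w_def S_def)
  qed
  then have "\<exists>p\<in>A. p x0 \<noteq> 0 \<and> (\<forall>x. p x \<noteq> 0 \<longrightarrow> dim (span ((\<lambda>s. w s x0) ` S))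
    \<le> dim (span ((\<lambda>s. w s x) ` S)))"
    by (intro dim_span_generic const add mult) (auto simp: S_def)
  then show ?thesis unfolding r .
qed

lemma rank_pcurve:
  assumes v: "\<And>a. pcurve (v a)" and v': "\<And>a. pcurve (v' a)"
  shows "\<exists>p\<in>range poly. p t0 \<noteq> 0 \<and> (\<forall>t. p t \<noteq> 0 \<longrightarrow>
    rank k (curve_flag v t0 j) (curve_flag v' t0 i) \<le> rank k (curve_flag v t j) (curve_flag v' t
      i))"
proof (rule rank_generic[OF range_poly_algebra])
  fix a :: nat and \<phi> assume phi: "functional \<phi>"
  then obtain q where "\<forall>t. \<phi> (v a t) = poly q t" using v unfolding pcurve_def by blast
  then show "(\<lambda>x. \<phi> (v a x)) \<in> range poly" by (intro image_eqI[of _ _ q]) auto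
  obtain q where "\<forall>t. \<phi> (v' a t) = poly q t" using v' phi unfolding pcurve_def by blast
  then show "(\<lambda>x. \<phi> (v' a x)) \<in> range poly" by (intro image_eqI[of _ _ q]) auto
qed

text \<open>Each inequality fails only at roots of a nonzero polynomial along a curve from
  \<open>f\<close> to \<open>f'\<close>, and an infinite field has a parameter avoiding finitely
  many roots. The space X allows ranks modulo U to be controlled for flags that start at a line
  above U.\<close>

lemma Fl_common:
  assumes inf: "infinite (UNIV :: 'a set)" and U: "stable U" and m: "m \<le> dim W" and X: "subspace X"
    and f: "f \<in> Fl U m W \<kappa>" and f': "f' \<in> Fl U m W \<kappa>"
  shows "\<exists>h\<in>Fl U m W \<kappa>. \<forall>k. \<forall>j\<in>{m..dim W}.
     rank k (f j) X \<le> rank k (h j) X \<and> rank k (f' j) X \<le> rank k (h j) X \<and>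
     (\<forall>i\<in>{m..dim W}. rank k (f j) (f i) \<le> rank k (h j) (h i) \<and> rank k (f' j) (f' i) \<le> rank k (h j)
       (h i))"
proof -
  obtain v where v: "\<And>a. pcurve (v a)" "\<And>t. curve_flag v t \<in> Fl U m W \<kappa>"
    "\<And>j. j \<in> {m..dim W} \<Longrightarrow> curve_flag v 0 j = f j \<and> curve_flag v 1 j = f' j"
    using Fl_curve[OF U m f f'] by blast
  obtain b where b: "span (b ` {..<dim X}) = X" using enumerate_basis[OF X] by auto
  define vX where "vX a t = b a" for a :: nat and t :: 'a
  have vX: "pcurve (vX a)" for a unfolding vX_def by (rule pcurve_const)
  have X': "curve_flag vX t (dim X) = X" for t unfolding curve_flag_def vX_def by (rule b)
  \<comment> \<open>Finitely many conditions suffice: from k = N on, every rank is the dimension of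
    the lower space.\<close>
  let ?Q = "{..<N} \<times> {m..dim W} \<times> {m..dim W}"
  define P where "P t0 = (\<lambda>(k, j, i) t. rank k (curve_flag v t0 j) (curve_flag v t0 i)
    \<le> rank k (curve_flag v t j) (curve_flag v t i)
     \<and> rank k (curve_flag v t0 j) X \<le> rank k (curve_flag v t j) X)" for t0
  have "\<exists>p\<in>range poly. p t0 \<noteq> 0 \<and> (\<forall>t. p t \<noteq> 0 \<longrightarrow> (\<forall>q\<in>?Q. P t0 q t))" for t0
  proof (rule generic_finite[OF range_poly_algebra(1,3)])
    fix q assume "q \<in> ?Q"
    obtain k j i where q: "q = (k, j, i)" by (cases q)
    obtain p1 where p1: "p1 \<in> range poly" "p1 t0 \<noteq> 0"
      "\<And>t. p1 t \<noteq> 0 \<Longrightarrow> rank k (curve_flag v t0 j) (curve_flag v t0 i)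
      \<le> rank k (curve_flag v t j) (curve_flag v t i)"
      using rank_pcurve[of v v t0 k j i] v(1) by blast
    obtain p2 where p2: "p2 \<in> range poly" "p2 t0 \<noteq> 0"
      "\<And>t. p2 t \<noteq> 0 \<Longrightarrow> rank k (curve_flag v t0 j) X \<le> rank k (curve_flag v t j) X"
      using rank_pcurve[of v vX t0 k j "dim X"] v(1) vX unfolding X' by blast
    show "\<exists>p\<in>range poly. p t0 \<noteq> 0 \<and> (\<forall>t. p t \<noteq> 0 \<longrightarrow> P t0 q t)"
      using range_poly_algebra(3)[OF p1(1) p2(1)] p1(2,3) p2(2,3)
        by (intro bexI[of _ "\<lambda>t. p1 t * p2 t"]) (auto simp: P_def q)
  qed auto
  note ex = this
  obtain p0 where p0: "poly p0 0 \<noteq> 0" "\<And>t. poly p0 t \<noteq> 0 \<Longrightarrow> \<forall>q\<in>?Q. P 0 q t" using ex[of 0] by auto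
  obtain p1 where p1: "poly p1 1 \<noteq> 0" "\<And>t. poly p1 t \<noteq> 0 \<Longrightarrow> \<forall>q\<in>?Q. P 1 q t" using ex[of 1] by auto
  have "p0 * p1 \<noteq> 0" using p0(1) p1(1) by auto
  then have "finite {t. poly (p0 * p1) t = 0}" by (rule poly_roots_finite)
  then have "{t. poly (p0 * p1) t = 0} \<noteq> UNIV" using inf by metis
  then obtain t where t: "poly (p0 * p1) t \<noteq> 0" by blast
  have P: "\<forall>q\<in>?Q. P 0 q t" "\<forall>q\<in>?Q. P 1 q t" using p0(2)[of t] p1(2)[of t] t by auto
  define h where "h = curve_flag v t"
  have hF: "h \<in> Fl U m W \<kappa>" using v(2) h_def by simp
  have big: "rank k (g j) Y = dim Y" if "N \<le> k" "g \<in> Fl U m W \<kappa>" "j \<in> {m..dim W}" for k g j Y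
    using that im_ge_N[OF stable_subspace, of "g j" k Y] unfolding rank_def Fl_def by auto
  show ?thesis
  proof (intro bexI[OF _ hF] allI ballI)
    fix k j assume j: "j \<in> {m..dim W}"
    show "rank k (f j) X \<le> rank k (h j) X \<and> rank k (f' j) X \<le> rank k (h j) X \<and>
     (\<forall>i\<in>{m..dim W}. rank k (f j) (f i) \<le> rank k (h j) (h i) \<and> rank k (f' j) (f' i) \<le> rank k (h j)
       (h i))"
    proof (cases "k < N")
      case True
      then have "P 0 (k, j, i) t" "P 1 (k, j, i) t" if "i \<in> {m..dim W}" for i using P j that by auto
      then show ?thesis using v(3) j unfolding P_def h_def by auto
    next
      case False
      have "dim (h i) = i" "dim (f i) = i" "dim (f' i) = i" if "i \<in> {m..dim W}" for i
        using hF f f' that unfolding Fl_def by auto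
      then show ?thesis using big[of k _ j] False hF f f' j by simp
    qed
  qed
qed

text \<open>The line column weakly increases with \<open>j\<close> and must be a corner column,
  and \<open>pcol\<close> is the smallest
  sequence with these properties.\<close>

lemma upper_bound:
  assumes U: "stable U" and v: "valid (dim U) (dim W) \<kappa>" and f: "f \<in> Fl U (dim U) W \<kappa>"
    and j: "Suc (dim U) \<le> j" "j \<le> dim W"
  shows "pcol \<kappa> (dim U) j \<le> line_col U (f (Suc (dim U))) (f j)"
  using j
proof (induction j rule: dec_induct)
  case base
  then show ?case by simp
next
  case (step j)
  let ?u = "dim U" and ?L = "f (Suc (dim U))"
  have fu: "f ?u = U"
    using f step U subspace_dim_equal[of U "f ?u"] unfolding Fl_def stable_def by auto
  have h: "hyper U ?L" using Fl_hyper[OF f, of ?u] fu step by auto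
  have s: "stable (f j)" "stable (f (Suc j))" "cols (f (Suc j)) U = \<kappa> (Suc j)" using f step
    unfolding Fl_def by auto
  have L: "?L \<subseteq> f j" "f j \<subseteq> f (Suc j)" "?L \<subseteq> f (Suc j)" 
    using Fl_mono[OF f, of "Suc ?u" j] Fl_mono[OF f, of j "Suc j"] Fl_mono[OF f, of "Suc ?u"
      "Suc j"] step by auto
  let ?q = "line_col U ?L (f (Suc j))"
  have le: "pcol \<kappa> ?u j \<le> ?q" using line_col_mono[OF h s(1) L(1) s(2) L(2)] step by auto
  have "cols (f (Suc j)) ?L (Suc ?q) \<le> cols (f (Suc j)) ?L ?q"
    using cols_antimono[OF s(2) hyperD(2)[OF h]] unfolding antimono_def by auto
  then have "\<kappa> (Suc j) (Suc ?q) < \<kappa> (Suc j) ?q"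
    unfolding s(3)[symmetric] by (subst (1 2) cols_line[OF h s(2) L(3)]) simp
  then show ?case using le step by (auto simp: pcol.simps Suc_le_eq le_less)
qed

section \<open>Flags above a fixed line\<close>

text \<open>If the hole moves from column p, then columns p and p + 1 of the slid shape
  \<open>down \<kappa> u j\<close> are equally long. The line cannot add a square to column p + 1,
  since the columns of H / U decrease weakly.\<close>

lemma line_upper_step:
  assumes v: "valid u w \<kappa>" and j: "Suc u \<le> j" "j < w" and h: "hyper U L" and H: "stable H" "L \<subseteq> H"
    and c: "cols H L = down \<kappa> u j" and q: "line_col U L H \<le> pcol \<kappa> u (Suc j)"
  shows "line_col U L H \<le> pcol \<kappa> u j"
proof (cases "pcol \<kappa> u (Suc j) = pcol \<kappa> u j")
  case False
  note b = pcol_bump[OF v j False]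
  have a: "cols H U (Suc (pcol \<kappa> u j)) \<le> cols H U (pcol \<kappa> u j)"
    using cols_antimono[OF H(1) hyperD(1)[OF h]] unfolding antimono_def by auto
  have "line_col U L H \<noteq> Suc (pcol \<kappa> u j)"
  proof
    assume e: "line_col U L H = Suc (pcol \<kappa> u j)"
    show False using a cols_line[OF h H] b(3) unfolding e c down_def by simp
  qed
  then show ?thesis using q b(1) by auto
qed (use q in auto)

text \<open>The counterpart of \<open>upper_bound\<close>, which bounds line columns from below and
  thus ranks from above: here the type over L is prescribed, and the induction descends from W,
  where the line column is known.\<close>

lemma upper_bound_line:
  assumes v: "valid (dim U) (dim W) \<kappa>" and h: "hyper U L"
    and g: "g \<in> Fl L (Suc (dim U)) W (down \<kappa> (dim U))"
      and q: "line_col U L W \<le> pcol \<kappa> (dim U) (dim W)"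
    and j: "Suc (dim U) \<le> j" "j \<le> dim W"
  shows "line_col U L (g j) \<le> pcol \<kappa> (dim U) j"
  using j(2,1)
proof (induction j rule: inc_induct)
  case base
  have "g (dim W) = W" using g unfolding Fl_def by simp
  then show ?case using q by simp
next
  case (step j)
  have s: "stable (g j)" "stable (g (Suc j))" "L \<subseteq> g j" "g j \<subseteq> g (Suc j)"
    "cols (g j) L = down \<kappa> (dim U) j"
    using g step unfolding Fl_def by auto
  have "line_col U L (g j) \<le> pcol \<kappa> (dim U) (Suc j)"
    using line_col_mono[OF h s(1,3,2,4)] step by auto
  then show ?case using line_upper_step[OF v _ _ h s(1,3,5)] step by auto
qed

lemma fun_inc_cases:
  fixes g :: "nat \<Rightarrow> nat"
  assumes "(g(q := Suc (g q)))(c := Suc ((g(q := Suc (g q))) c))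
    = (g(a := Suc (g a)))(b := Suc ((g(a := Suc (g a))) b))"
  shows "q = a \<or> q = b"
  using fun_cong[OF assms, of q] by (auto split: if_splits)

text \<open>Containing \<open>Zs W L c\<close> but not \<open>Zs W L (Suc c)\<close> fixes the
  column removed by H. Stability is automatic, since \<open>eta\<close> maps W into
  \<open>Zs W L 0\<close>, which lies in S. The freedom in S allows H to be forced through a further
  vector.\<close>

lemma hyperplane_above:
  assumes W: "stable W" and L: "stable L" "L \<subseteq> W" and S: "subspace S" "Zs W L c \<subseteq> S" "S \<subseteq> W"
    and n: "\<not> Zs W L (Suc c) \<subseteq> S" and d: "cols W L = \<gamma>(c := Suc (\<gamma> c))"
  shows "\<exists>H. hyper H W \<and> S \<subseteq> H \<and> L \<subseteq> H \<and> cols H L = \<gamma>"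
proof -
  obtain x where x: "x \<in> Zs W L (Suc c)" "x \<notin> S" using n by auto
  have sW: "subspace W" and sL: "subspace L" using W L stable_subspace by auto
  have "x \<in> W" using x Zs_subset by blast
  from hyperplane_exists[OF S(1) sW S(3) this x(2)] obtain H where
    H: "subspace H" "S \<subseteq> H" "H \<subseteq> W" "x \<notin> H" "dim W = Suc (dim H)" by auto
  have Z0: "Zs W L 0 \<subseteq> H" using Zs_mono[OF W L(1), of 0 c] S H by auto
  have "eta y \<in> Zs W L 0" if "y \<in> W" for y
    unfolding Zs_def im_iff using that stable_eta[OF W] subspace_0[OF sL]
      by (auto intro!: bexI[of _ y])
  then have eH: "eta y \<in> H" if "y \<in> W" for y using that Z0 by auto
  have LH: "L \<subseteq> H"
  proof
    fix y assume "y \<in> L"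
    then have "y \<in> Zs W L 0" unfolding Zs_def using L im_superset[OF sW, of L] by auto
    then show "y \<in> H" using Z0 by auto
  qed
  have "stable H" unfolding stable_def using H eH by auto
  then have h: "hyper H W" unfolding hyper_def using H W by auto
  obtain c' where c': "\<And>k. Zs W L k \<subseteq> H \<longleftrightarrow> k \<le> c'" "cols W L = (cols H L)(c' := Suc (cols H L c'))"
    using hyper_column[OF h L(1) LH] by auto
  have "c \<le> c'" using c'(1)[of c] S H by auto
  moreover have "\<not> Suc c \<le> c'" using c'(1)[of "Suc c"] x H by auto
  ultimately have "c' = c" by simp
  then have "cols H L = \<gamma>" using c'(2) d by (metis fun_inc_inj)
  then show ?thesis using h H LH by blast
qed

text \<open>H must remove column c over L. The squares of W / U can be removed through L or through
  H first; comparing both orders shows that the line column of H is c or that of W, and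
  \<open>line_upper_step\<close> bounds it by the hole. This settles the claim unless the hole keeps
  its column p and c < p. In that case H is forced to contain a vector y with
  \<open>(eta ^^ p) y\<close> spanning L modulo U.\<close>

lemma hyperplane_step:
  assumes v: "valid u w \<kappa>" and j: "Suc u \<le> j" "j < w" and h: "hyper U L" and W: "stable W" "L \<subseteq> W"
    and cW: "cols W U = \<kappa> (Suc j)" and p: "line_col U L W = pcol \<kappa> u (Suc j)"
  shows "\<exists>H. hyper H W \<and> L \<subseteq> H \<and> cols H L = down \<kappa> u j \<and> line_col U L H = pcol \<kappa> u j"
proof -
  note hd = hyperD[OF h]
  have sW: "subspace W" using W stable_subspace by auto
  let ?p = "pcol \<kappa> u (Suc j)" and ?\<gamma> = "down \<kappa> u j"
  have "cols W U = (cols W L)(?p := Suc (cols W L ?p))" using cols_line[OF h W] p by simp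
  moreover have "cols W U = (down \<kappa> u (Suc j))(?p := Suc (down \<kappa> u (Suc j) ?p))"
    using down_up[OF v, of "Suc j"] j cW by simp
  ultimately have dl: "cols W L = down \<kappa> u (Suc j)"
    by (metis fun_inc_inj)
  have vd: "valid (Suc u) w (down \<kappa> u)" using valid_down[OF v] j by auto
  obtain c where c: "down \<kappa> u (Suc j) = ?\<gamma>(c := Suc (?\<gamma> c))" using valid_step[OF vd j] .
  have ant: "?\<gamma> (Suc c) \<le> ?\<gamma> c" using valid_anti[OF vd j(1), of c "Suc c"] j by auto
  have dZ: "cols W L k + dim (Zs W L k) = dim W" for k using dim_Zs[OF W(1) hd(4)] .
  have Zn: "\<not> Zs W L (Suc c) \<subseteq> Zs W L c"
    using dim_subset[of "Zs W L (Suc c)" "Zs W L c"] dZ[of c] dZ[of "Suc c"] dl c ant by auto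
  have sZ: "subspace (Zs W L k)" for k using subspace_Zs[OF W(1) hd(4)] .
  have fin: "?p = pcol \<kappa> u j \<longrightarrow> c < ?p \<longrightarrow> ?p \<le> line_col U L H \<Longrightarrow> line_col U L H = pcol \<kappa> u j"
    if H: "hyper H W" "L \<subseteq> H" "cols H L = ?\<gamma>" for H
  proof -
    assume imp: "?p = pcol \<kappa> u j \<longrightarrow> c < ?p \<longrightarrow> ?p \<le> line_col U L H"
    note hH = hyperD[OF H(1)]
    let ?q = "line_col U L H"
    have "?q \<le> ?p" using line_col_mono[OF h hH(1) H(2) W(1) hH(5)] p by simp
    then have le: "?q \<le> pcol \<kappa> u j" using line_upper_step[OF v j h hH(1) H(2,3)] by simp
    have cH: "cols H U = ?\<gamma>(?q := Suc (?\<gamma> ?q))" using cols_line[OF h hH(1) H(2)] H(3) by simp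
    obtain c2 where "cols W U = (cols H U)(c2 := Suc (cols H U c2))"
      using hyper_column[OF H(1) hd(1)] hd(5) H(2) by blast
    moreover have "cols W U = (?\<gamma>(c := Suc (?\<gamma> c)))(?p := Suc ((?\<gamma>(c := Suc (?\<gamma> c))) ?p))"
      using cols_line[OF h W] p dl c by simp
    ultimately have q: "?q = c \<or> ?q = ?p" using fun_inc_cases cH by metis
    show "?q = pcol \<kappa> u j"
    proof (cases "?p = pcol \<kappa> u j")
      case True
      then show ?thesis using imp q le by auto
    next
      case False
      note b = pcol_bump[OF v j False]
      have "?\<gamma>(c := Suc (?\<gamma> c)) = ?\<gamma>(pcol \<kappa> u j := Suc (?\<gamma> (pcol \<kappa> u j)))"
        using b(4) c down_up[OF v j(1)] j by simp
      then have "c = pcol \<kappa> u j" by (rule fun_inc_index)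
      then show ?thesis using q le b(1) by auto
    qed
  qed
  show ?thesis
  proof (cases "?p = pcol \<kappa> u j \<and> c < ?p")
    case False
    from hyperplane_above[OF W(1) hd(2) W(2) sZ order_refl Zs_subset Zn dl[unfolded c]]
    show ?thesis using fin False by blast
  next
    case True
    obtain x where x: "x \<in> L" "x \<notin> U" using hd by (metis n_not_Suc_n subsetI subset_antisym)
    have "L \<subseteq> im ?p W U" using line_col_iff[OF h W] p by simp
    then obtain y where y: "y \<in> W" "x - (eta ^^ ?p) y \<in> U" using x unfolding subset_iff im_iff
      by blast
    let ?l = "(eta ^^ ?p) y"
    have "x - (x - ?l) \<in> L" using subspace_diff[OF hd(4) x(1)] y(2) hd(5) by blast
    then have lL: "?l \<in> L" by simp
    have lU: "?l \<notin> U"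
    proof
      assume "?l \<in> U"
      from subspace_add[OF hd(3) y(2) this] show False using x by simp
    qed
    have Lsp: "L = span (insert ?l U)" using hyperplane_span[OF hd(3-6) lL lU] .
    have Lim: "L \<subseteq> im k X U" if "?l \<in> im k X U" "subspace X" for k X
      unfolding Lsp using that hd im_superset[of X U k] by (intro span_minimal subspace_im) auto
    \<comment> \<open>Once y lies in H, the line lies in \<open>im ?p H U\<close>, so its column in
      H is at least \<open>?p\<close>.\<close>
    define S where "S = span (insert y (Zs W L c))"
    have S: "subspace S" "Zs W L c \<subseteq> S" "S \<subseteq> W" "y \<in> S"
      unfolding S_def using y(1) Zs_subset[of W L c] span_superset[of "insert y (Zs W L c)"]
        span_minimal[OF _ sW, of "insert y (Zs W L c)"] by auto
    have "\<not> Zs W L (Suc c) \<subseteq> S"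
    proof
      assume sub: "Zs W L (Suc c) \<subseteq> S"
      show False
      proof (cases "?p = Suc c")
        case eq: True
        \<comment> \<open>Adding y enlarges \<open>Zs W L c\<close> by at most one dimension. The
          step to \<open>Zs W L (Suc c)\<close> has at least two: the slide shortened column c + 1
          of \<open>\<kappa> j\<close>, and W has one more square in column c.\<close>
        have "dim (insert y (Zs W L c)) \<le> Suc (dim (Zs W L c))" unfolding dim_insert by simp
        then have "dim (Zs W L (Suc c)) \<le> Suc (dim (Zs W L c))" using dim_subset[OF sub]
          unfolding S_def by simp
        then have 1: "cols W L c \<le> Suc (cols W L (Suc c))" using dZ[of c] dZ[of "Suc c"] by simp
        have "\<kappa> j (Suc c) \<le> \<kappa> j c" using valid_anti[OF v, of j c "Suc c"] j by auto
        then have "Suc (?\<gamma> (Suc c)) \<le> ?\<gamma> c"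
          by (subst (asm) (1 2) down_up[OF v j(1) less_imp_le[OF j(2)]]) (use True eq in auto)
        then show False using 1 unfolding dl c by simp
      next
        case neq: False
        \<comment> \<open>Here the inclusion would put y itself into \<open>Zs W L (Suc c)\<close>.
          Since \<open>eta\<close> maps L into U, applying further powers of \<open>eta\<close>
          would move L into \<open>im (Suc ?p) W U\<close>, against the line column of W.\<close>
        then have gt: "Suc c < ?p" using True by auto
        obtain z where z: "z \<in> Zs W L (Suc c)" "z \<notin> Zs W L c" using Zn by auto
        then obtain a where a: "z - a *s y \<in> Zs W L c"
          using sub unfolding S_def subset_iff span_breakdown_eq span_of_subspace[OF sZ] by blast
        have a0: "a \<noteq> 0" using a z by auto
        have "z - a *s y \<in> Zs W L (Suc c)" using a Zs_Suc[OF W(1) hd(2)] by blast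
        then have "inverse a *s (z - (z - a *s y)) \<in> Zs W L (Suc c)"
          using subspace_scale[OF sZ subspace_diff[OF sZ z(1)]] by blast
        then have "y \<in> Zs W L (Suc c)" using a0 by simp
        then obtain w' where w': "w' \<in> W" "(eta ^^ Suc c) y - (eta ^^ Suc (Suc c)) w' \<in> L"
          unfolding Zs_def im_iff by auto
        define d where "d = ?p - Suc (Suc c)"
        have pd: "?p = d + Suc (Suc c)" using gt d_def by simp
        have "eta ((eta ^^ Suc c) y - (eta ^^ Suc (Suc c)) w') \<in> U" using hd(7)[OF w'(2)] .
        from stable_pow[OF hd(1) this, of d]
        have "(eta ^^ (d + Suc (Suc c))) y - (eta ^^ (d + Suc (Suc (Suc c)))) w' \<in> U"
          by (simp add: eta_diff pow_diff pow_eta funpow_add)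
        then have "?l \<in> im (Suc ?p) W U" unfolding im_iff pd using w'(1) by auto
        from Lim[OF this sW] show False using line_col_iff[OF h W] p by auto
      qed
    qed
    from hyperplane_above[OF W(1) hd(2) W(2) S(1-3) this dl[unfolded c]] obtain H where
      H: "hyper H W" "S \<subseteq> H" "L \<subseteq> H" "cols H L = ?\<gamma>" by auto
    have "?l \<in> im ?p H U" using pow_in_im[OF hd(3)] H(2) S(4) by blast
    then have "L \<subseteq> im ?p H U" using Lim hyperD(3)[OF H(1)] by blast
    then have "?p \<le> line_col U L H" using line_col_iff[OF h hyperD(1)[OF H(1)] H(3)] by simp
    then show ?thesis using fin[OF H(1,3,4)] H by blast
  qed
qed

lemma flag_above_line:
  assumes v: "valid u w \<kappa>" and h: "hyper U L" and "Suc u \<le> w" and dL: "dim L = Suc u"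
    and "stable W" "L \<subseteq> W" "dim W = w" "cols W U = \<kappa> w" "line_col U L W = pcol \<kappa> u w"
  shows "\<exists>g\<in>Fl L (Suc u) W (down \<kappa> u). \<forall>j\<in>{Suc u..w}. cols (g j) U = \<kappa> j"
  using assms(3,1,5-)
proof (induction w arbitrary: W rule: dec_induct)
  case base
  have "L = W" using base dL subspace_dim_equal[of L W] hyperD[OF h] stable_subspace by auto
  have "cols W U = (cols W L)(0 := Suc (cols W L 0))" using cols_line[OF h base(2,3)] base(6)
    by simp
  moreover have "\<kappa> (Suc u) = (down \<kappa> u (Suc u))(0 := Suc (down \<kappa> u (Suc u) 0))"
    using down_up[OF base(1), of "Suc u"] by simp
  ultimately have "cols W L = down \<kappa> u (Suc u)"
    using base(5) by (metis fun_inc_inj)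
  then show ?case using base \<open>L = W\<close> by (intro bexI[of _ "\<lambda>_. W"]) (auto simp: Fl_def)
next
  case (step w)
  obtain H where H: "hyper H W" "L \<subseteq> H" "cols H L = down \<kappa> u w" "line_col U L H = pcol \<kappa> u w"
    using hyperplane_step[OF step.prems(1) _ _ h step.prems(2,3,5,6)] step by auto
  note hH = hyperD[OF H(1)]
  have dH: "dim H = w" using hH step by simp
  have vw: "valid u w \<kappa>" using valid_sub[OF step.prems(1)] by simp
  have "cols H U = \<kappa> w" using cols_line[OF h hH(1) H(2)] H(3,4) down_up[OF vw] step.hyps by simp
  with step.IH[OF vw hH(1) H(2) dH this H(4)] obtain g where
    g: "g \<in> Fl L (Suc u) H (down \<kappa> u)" "\<forall>j\<in>{Suc u..w}. cols (g j) U = \<kappa> j" by auto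
  have "cols W U = (cols W L)(pcol \<kappa> u (Suc w) := Suc (cols W L (pcol \<kappa> u (Suc w))))"
    using cols_line[OF h step.prems(2,3)] step.prems(6) by simp
  moreover have "\<kappa> (Suc w) = (down \<kappa> u (Suc w))(pcol \<kappa> u (Suc w) := Suc (down \<kappa> u (Suc w) (pcol \<kappa> u
    (Suc w))))"
    using down_up[OF step.prems(1), of "Suc w"] step.hyps by simp
  ultimately have cWL: "cols W L = down \<kappa> u (Suc w)"
    using step.prems(5) by (metis fun_inc_inj)
  let ?g = "g(Suc w := W)"
  have gw: "g w = H" using g(1) dH unfolding Fl_def by auto
  have "?g \<in> Fl L (Suc u) W (down \<kappa> u)"
    unfolding Fl_def
  proof (intro CollectI conjI ballI)
    fix j assume j: "j \<in> {Suc u..dim W}"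
    then have "stable (?g j) \<and> dim (?g j) = j \<and> L \<subseteq> ?g j \<and> cols (?g j) L = down \<kappa> u j"
      using g(1) dH step.prems cWL unfolding Fl_def by (cases "j = Suc w") auto
    then show "stable (?g j)" "dim (?g j) = j" "L \<subseteq> ?g j" "cols (?g j) L = down \<kappa> u j" by auto
  next
    fix j assume "j \<in> {Suc u..<dim W}"
    then show "?g j \<subseteq> ?g (Suc j)"
      using g(1) dH step.prems gw hH(5) unfolding Fl_def by (cases "j = w") auto
  qed (use step in auto)
  moreover have "\<forall>j\<in>{Suc u..Suc w}. cols (?g j) U = \<kappa> j" using g(2) step.prems by auto
  ultimately show ?case by blast
qed

lemma Fl_bottom:
  assumes "f \<in> Fl U (dim U) W \<kappa>" "stable U" "dim U \<le> dim W"
  shows "f (dim U) = U"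
  using assms subspace_dim_equal[of U "f (dim U)"] unfolding Fl_def stable_def by auto

lemma Fl_extend_line:
  assumes h: "hyper U L" and g: "g \<in> Fl L (Suc (dim U)) W \<delta>" and W: "dim U < dim W"
    and c: "\<And>j. j \<in> {Suc (dim U)..dim W} \<Longrightarrow> cols (g j) U = \<kappa> j" and 0: "\<kappa> (dim U) = (\<lambda>_. 0)"
  shows "g(dim U := U) \<in> Fl U (dim U) W \<kappa>"
proof -
  note hd = hyperD[OF h]
  have s: "L \<subseteq> g j" "stable (g j)" "dim (g j) = j" "U \<subseteq> g j" if "j \<in> {Suc (dim U)..dim W}" for j
  proof -
    show 1: "L \<subseteq> g j" "stable (g j)" "dim (g j) = j" using g that unfolding Fl_def by auto
    show "U \<subseteq> g j" using hd(5) 1(1) by blast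
  qed
  have "rank k U U = dim U" for k
    unfolding rank_def using im_subset[OF hd(1) order_refl] im_superset[OF hd(3)]
      by (metis subset_antisym)
  then have cU: "cols U U = (\<lambda>_. 0)" unfolding cols_def by auto
  show ?thesis
    unfolding Fl_def
  proof (intro CollectI conjI ballI)
    fix j assume j: "j \<in> {dim U..dim W}"
    show "stable ((g(dim U := U)) j)" "dim ((g(dim U := U)) j) = j" "U \<subseteq> (g(dim U := U)) j"
      "cols ((g(dim U := U)) j) U = \<kappa> j"
      using s[of j] c[of j] hd(1) cU 0 j by (cases "j = dim U"; auto)+
  next
    fix j assume "j \<in> {dim U..<dim W}"
    then show "(g(dim U := U)) j \<subseteq> (g(dim U := U)) (Suc j)"
      using g s[of "Suc j"] unfolding Fl_def by (cases "j = dim U") auto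
  next
    show "(g(dim U := U)) (dim W) = W" using g W unfolding Fl_def by auto
  qed
qed

lemma Fl_restrict_line:
  assumes U: "stable U" and v: "valid (dim U) (dim W) \<kappa>" and lt: "dim U < dim W"
    and f: "f \<in> Fl U (dim U) W \<kappa>"
    and c: "\<And>j. j \<in> {Suc (dim U)..dim W} \<Longrightarrow> line_col U (f (Suc (dim U))) (f j) = pcol \<kappa> (dim U) j"
  shows "f \<in> Fl (f (Suc (dim U))) (Suc (dim U)) W (down \<kappa> (dim U))"
proof -
  let ?L = "f (Suc (dim U))"
  have h: "hyper U ?L" using Fl_hyper[OF f, of "dim U"] Fl_bottom[OF f U] lt by auto
  have "cols (f j) ?L = down \<kappa> (dim U) j" "?L \<subseteq> f j" if j: "j \<in> {Suc (dim U)..dim W}" for j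
  proof -
    show L: "?L \<subseteq> f j" using Fl_mono[OF f, of "Suc (dim U)" j] j by auto
    have s: "stable (f j)" "cols (f j) U = \<kappa> j" using f j unfolding Fl_def by auto
    show "cols (f j) ?L = down \<kappa> (dim U) j"
      using cols_line[OF h s(1) L] down_up[OF v, of j] j s(2) c[OF j]
        by (metis atLeastAtMost_iff fun_inc_inj)
  qed
  then show ?thesis using f unfolding Fl_def by auto
qed

text \<open>By \<open>rank_line\<close> the line column is where the ranks over the line begin to
  exceed those over U. With the ranks over U fixed, raising the others makes this happen
  earlier.\<close>

lemma line_col_le_of_rank:
  assumes h: "hyper U L" "hyper U L'" and W: "stable W" "L \<subseteq> W" and W': "stable W'" "L' \<subseteq> W'"
    and eq: "\<And>k. rank k W U = rank k W' U" and le: "\<And>k. rank k W L \<le> rank k W' L'"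
  shows "line_col U L' W' \<le> line_col U L W"
proof -
  let ?p = "Suc (line_col U L W)"
  have "rank ?p W L = Suc (rank ?p W U)" using rank_line[OF h(1) W] by simp
  then have "rank ?p W' L' \<noteq> rank ?p W' U" using le[of ?p] eq[of ?p] by simp
  then show ?thesis using rank_line[OF h(2) W', of ?p] by (auto split: if_splits)
qed

text \<open>With the line and the ranks over it fixed, raising the ranks over U delays the excess in
  \<open>rank_line\<close>: the direction is reversed.\<close>

lemma line_col_ge_of_rank:
  assumes h: "hyper U L" and W: "stable W" "L \<subseteq> W" and W': "stable W'" "L \<subseteq> W'"
    and eq: "\<And>k. rank k W L = rank k W' L" and le: "\<And>k. rank k W U \<le> rank k W' U"
  shows "line_col U L W \<le> line_col U L W'"
proof -
  let ?p = "line_col U L W"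
  have "rank ?p W L = rank ?p W U" using rank_line[OF h(1) W] by simp
  then have "rank ?p W' L \<le> rank ?p W' U" using le[of ?p] eq[of ?p] by simp
  then show ?thesis using rank_line[OF h W', of ?p] by (auto split: if_splits)
qed

text \<open>\<open>\<Gamma> i j\<close> is the growth diagram of the slides. A flag of maximal ranks is found above a line \<open>L\<close>
  by induction; maximality with respect to \<open>L\<close> and the prescribed type with respect to \<open>U\<close> are both
  generic among the flags above \<open>L\<close>, hence hold simultaneously.\<close>

theorem growth:
  assumes inf: "infinite (UNIV :: 'a set)" and \<Gamma>: "\<And>i. \<Gamma> (Suc i) = down (\<Gamma> i) i"
    and "stable U" "stable W" "U \<subseteq> W" "cols W U = \<Gamma> (dim U) (dim W)"
      "valid (dim U) (dim W) (\<Gamma> (dim U))"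
  shows "(\<exists>f\<in>Fl U (dim U) W (\<Gamma> (dim U)). \<forall>i j. dim U \<le> i \<and> i \<le> j \<and> j \<le> dim W \<longrightarrow> cols (f j) (f i)
    = \<Gamma> i j) \<and>
    (\<forall>f\<in>Fl U (dim U) W (\<Gamma> (dim U)). \<forall>i j k. dim U \<le> i \<and> i \<le> j \<and> j \<le> dim W \<longrightarrow>
       rank k (f j) (f i) \<le> i + (\<Sum>l=k..<N. \<Gamma> i j l))"
  using assms(3-)
proof (induction "dim W - dim U" arbitrary: U)
  case 0
  have "dim U \<le> dim W" using 0 dim_subset by auto
  then have d: "dim U = dim W" using 0 by simp
  then have UW: "U = W" using 0 subspace_dim_equal[of U W] unfolding stable_def by auto
  have F: "(\<lambda>_. U) \<in> Fl U (dim U) W (\<Gamma> (dim U))" using 0 UW unfolding Fl_def by auto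
  have R: "rank k (f j) (f i) \<le> i + (\<Sum>l=k..<N. \<Gamma> i j l)"
    if "f \<in> Fl U (dim U) W (\<Gamma> (dim U))" "dim U \<le> i \<and> i \<le> j \<and> j \<le> dim W" for f i j k
  proof -
    have "i = dim U" "j = dim U" using that d by auto
    then show ?thesis using rank_eq_sum[of U U k] Fl_bottom[OF that(1)] 0 UW unfolding stable_def
      by auto
  qed
  have C: "cols U U = \<Gamma> i j" if "dim U \<le> i \<and> i \<le> j \<and> j \<le> dim W" for i j
  proof -
    have "i = dim U" "j = dim W" using that d by auto
    then show ?thesis using 0(5) UW by simp
  qed
  show ?case
  proof (intro conjI bexI[OF _ F] ballI allI impI)
    show "cols U U = \<Gamma> i j" if "dim U \<le> i \<and> i \<le> j \<and> j \<le> dim W" for i j using that by (rule C)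
  qed (rule R)
next
  case (Suc d)
  define u w where "u = dim U" and "w = dim W"
  let ?\<kappa> = "\<Gamma> u" and ?\<delta> = "\<Gamma> (Suc u)"
  have uw: "u < w" "Suc u \<le> w" using Suc.hyps(2) u_def w_def by auto
  note U = Suc.prems(1) and W = Suc.prems(2) and UW = Suc.prems(3)
  have sU: "subspace U" using U stable_subspace by auto
  have v: "valid u w ?\<kappa>" and cW: "cols W U = ?\<kappa> w" using Suc.prems u_def w_def by auto
  have k0: "?\<kappa> u = (\<lambda>_. 0)" using v unfolding valid_def by auto
  have vd: "valid (Suc u) w ?\<delta>" using valid_down[OF v uw(1)] \<Gamma> by simp
  have IH: "(\<exists>f\<in>Fl L (Suc u) W ?\<delta>. \<forall>i j. Suc u \<le> i \<and> i \<le> j \<and> j \<le> w \<longrightarrow> cols (f j) (f i) = \<Gamma> i j) \<and>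
    (\<forall>f\<in>Fl L (Suc u) W ?\<delta>. \<forall>i j k. Suc u \<le> i \<and> i \<le> j \<and> j \<le> w \<longrightarrow>
       rank k (f j) (f i) \<le> i + (\<Sum>l=k..<N. \<Gamma> i j l))"
    if L: "hyper U L" "L \<subseteq> W" "cols W L = ?\<delta> w" for L
  proof -
    have dL: "dim L = Suc u" using hyperD(6)[OF L(1)] u_def by simp
    have "d = dim W - dim L" using Suc.hyps(2) dL u_def by simp
    from Suc.hyps(1)[OF this hyperD(2)[OF L(1)] W L(2)] show ?thesis using dL L(3) vd w_def by simp
  qed
  have ex: "\<exists>f\<in>Fl U u W ?\<kappa>. \<forall>i j. u \<le> i \<and> i \<le> j \<and> j \<le> w \<longrightarrow> cols (f j) (f i) = \<Gamma> i j"
  proof -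
    have "cols W U (Suc (pcol ?\<kappa> u w)) < cols W U (pcol ?\<kappa> u w)"
      using pcol_corner[OF v uw(2) order_refl] cW by simp
    then obtain L where L: "hyper U L" "L \<subseteq> W" "line_col U L W = pcol ?\<kappa> u w"
      using line_exists[OF U W UW] by blast
    note hL = hyperD[OF L(1)]
    have dL: "dim L = Suc u" using hL(6) u_def by simp
    have cL: "cols W L = ?\<delta> w"
      using cols_line[OF L(1) W L(2)] down_up[OF v uw(2) order_refl] cW L(3) \<Gamma>
        by (metis fun_inc_inj)
    obtain g0 where g0: "g0 \<in> Fl L (Suc u) W ?\<delta>" "\<forall>j\<in>{Suc u..w}. cols (g0 j) U = ?\<kappa> j"
      using flag_above_line[OF v L(1) uw(2) dL W L(2) w_def[symmetric] cW L(3)] \<Gamma> by auto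
    obtain g1 where g1: "g1 \<in> Fl L (Suc u) W ?\<delta>"
      "\<And>i j. Suc u \<le> i \<Longrightarrow> i \<le> j \<Longrightarrow> j \<le> w \<Longrightarrow> cols (g1 j) (g1 i) = \<Gamma> i j" using IH[OF L(1,2) cL] by blast
    have mw: "Suc u \<le> dim W" using uw w_def by simp
    \<comment> \<open>\<open>g0\<close> has the right types over U, and \<open>g1\<close> among the
      members from L on. For g, which dominates both, the upper bounds of the induction hypothesis
      and of \<open>upper_bound_line\<close> turn the inequalities into equalities.\<close>
    obtain g where g: "g \<in> Fl L (Suc u) W ?\<delta>"
      "\<And>k j. j \<in> {Suc u..w} \<Longrightarrow> rank k (g0 j) U \<le> rank k (g j) U"
      "\<And>k j i. j \<in> {Suc u..w} \<Longrightarrow> i \<in> {Suc u..w} \<Longrightarrow> rank k (g1 j) (g1 i) \<le> rank k (g j) (g i)"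
      using Fl_common[OF inf hL(2) mw sU g0(1) g1(1)] unfolding w_def[symmetric] by blast
    have st: "stable (h j)" "dim (h j) = j" "L \<subseteq> h j" "cols (h j) L = ?\<delta> j"
      if "h \<in> Fl L (Suc u) W ?\<delta>" "j \<in> {Suc u..w}" for h j
      using that unfolding Fl_def w_def by auto
    have gr: "cols (g j) (g i) = \<Gamma> i j" if ij: "Suc u \<le> i" "i \<le> j" "j \<le> w" for i j
    proof -
      have m: "i \<in> {Suc u..w}" "j \<in> {Suc u..w}" using ij by auto
      have "rank k (g1 j) (g1 i) = i + (\<Sum>l=k..<N. \<Gamma> i j l)" for k
        using rank_eq_sum[of "g1 j"
          "g1 i" k] st[OF g1(1) m(1)] st[OF g1(1) m(2)] g1(2)[OF ij] stable_subspace by auto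
      moreover have "rank k (g j) (g i) \<le> i + (\<Sum>l=k..<N. \<Gamma> i j l)" for k
        using IH[OF L(1,2) cL] g(1) ij by blast
      ultimately have "rank k (g j) (g i) = rank k (g1 j) (g1 i)" for k using g(3)[OF m(2,1), of k]
        by (metis le_antisym)
      then have "cols (g j) (g i) = cols (g1 j) (g1 i)" unfolding cols_def by simp
      then show ?thesis using g1(2)[OF ij] by simp
    qed
    have cg: "cols (g j) U = ?\<kappa> j" if j: "j \<in> {Suc u..w}" for j
    proof -
      have up: "line_col U L (g j) \<le> pcol ?\<kappa> u j"
        using upper_bound_line[of U W ?\<kappa> L g j] v L g(1) \<Gamma> j unfolding u_def w_def by auto
      have c0: "cols (g0 j) U = (cols (g0 j) L)(line_col U L (g0 j) := Suc (cols (g0 j) L (line_col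
        U L (g0 j))))"
        using cols_line[OF L(1) st(1)[OF g0(1) j] st(3)[OF g0(1) j]] .
      have "?\<kappa> j = (?\<delta> j)(pcol ?\<kappa> u j := Suc (?\<delta> j (pcol ?\<kappa> u j)))" using down_up[OF v, of j] j \<Gamma>
        by auto
      then have "line_col U L (g0 j) = pcol ?\<kappa> u j" using c0 g0(2) j st(4)[OF g0(1) j]
        by (metis fun_inc_index)
      moreover have "line_col U L (g0 j) \<le> line_col U L (g j)"
      proof (rule line_col_ge_of_rank[OF L(1)])
        show "rank k (g0 j) L = rank k (g j) L" for k
          using rank_eq_sum[of _ L k] st[OF g0(1) j] st[OF g(1) j] hL by auto
      qed (use st[OF g0(1) j] st[OF g(1) j] g(2) j in auto)
      ultimately have "line_col U L (g j) = pcol ?\<kappa> u j" using up by simp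
      then show ?thesis
        using cols_line[OF L(1) st(1)[OF g(1) j] st(3)[OF g(1) j]] st(4)[OF g(1) j] down_up[OF v, of
          j] j \<Gamma> by auto
    qed
    let ?f = "g(u := U)"
    have fF: "?f \<in> Fl U u W ?\<kappa>"
      using Fl_extend_line[OF L(1), of g W ?\<delta> ?\<kappa>] g(1) uw cg k0 unfolding u_def w_def by auto
    moreover have "cols (?f j) (?f i) = \<Gamma> i j" if "u \<le> i" "i \<le> j" "j \<le> w" for i j
    proof (cases "i = u")
      case True
      then have "cols (?f j) U = \<Gamma> i j" using fF that unfolding Fl_def w_def by auto
      then show ?thesis using True by simp
    next
      case False
      then show ?thesis using gr[of i j] that by auto
    qed
    ultimately show ?thesis by blast
  qed
  then obtain f1 where f1: "f1 \<in> Fl U u W ?\<kappa>"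
    "\<And>i j. u \<le> i \<Longrightarrow> i \<le> j \<Longrightarrow> j \<le> w \<Longrightarrow> cols (f1 j) (f1 i) = \<Gamma> i j" by blast
  have ub: "rank k (f j) (f i) \<le> i + (\<Sum>l=k..<N. \<Gamma> i j l)"
    if f: "f \<in> Fl U u W ?\<kappa>" and ij: "u \<le> i" "i \<le> j" "j \<le> w" for f i j k
  proof (cases "i = u")
    case True
    have "f u = U" using Fl_bottom[of f U W] f U uw unfolding u_def w_def by auto
    moreover have "stable (f j)" "cols (f j) U = ?\<kappa> j" using f ij unfolding Fl_def w_def by auto
    ultimately show ?thesis using rank_eq_sum[of "f j" U k] sU True u_def by simp
  next
    case False
    have mw: "u \<le> dim W" using uw w_def by simp
    \<comment> \<open>The flag f need not have the slid type over its own line, so the induction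
      hypothesis may not apply to it. It does apply to a flag g dominating both f and the optimal
      \<open>f1\<close>: the line columns of g are squeezed between \<open>upper_bound\<close> and
      those of \<open>f1\<close>.\<close>
    obtain g where g: "g \<in> Fl U u W ?\<kappa>"
      "\<And>k j i. j \<in> {u..w} \<Longrightarrow> i \<in> {u..w} \<Longrightarrow> rank k (f j) (f i) \<le> rank k (g j) (g i)
        \<and> rank k (f1 j) (f1 i) \<le> rank k (g j) (g i)"
      using Fl_common[OF inf U mw sU f f1(1)] unfolding w_def[symmetric] by blast
    have hy: "hyper U (h (Suc u))" if "h \<in> Fl U u W ?\<kappa>" for h
      using Fl_hyper[OF that, of u] Fl_bottom[of h U W] that U uw unfolding u_def w_def by auto
    have st: "stable (h j)" "dim (h j) = j" "cols (h j) U = ?\<kappa> j" "h (Suc u) \<subseteq> h j"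
      if "h \<in> Fl U u W ?\<kappa>" "j \<in> {Suc u..w}" for h j
      using that Fl_mono[OF that(1), of "Suc u" j] unfolding Fl_def w_def by auto
    have lc: "line_col U (g (Suc u)) (g j) = pcol ?\<kappa> u j" if j: "j \<in> {Suc u..w}" for j
    proof (rule antisym)
      show "pcol ?\<kappa> u j \<le> line_col U (g (Suc u)) (g j)"
        using upper_bound[OF U, of W ?\<kappa> g j] v g(1) j unfolding u_def w_def by auto
      have c0: "cols (f1 j) U = (cols (f1 j) (f1 (Suc u)))(line_col U (f1 (Suc u)) (f1 j) := Suc
        (cols (f1 j) (f1 (Suc u)) (line_col U (f1 (Suc u)) (f1 j))))"
        using cols_line[OF hy[OF f1(1)] st(1)[OF f1(1) j] st(4)[OF f1(1) j]] .
      have d1: "cols (f1 j) (f1 (Suc u)) = ?\<delta> j" using f1(2)[of "Suc u" j] j by auto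
      have "?\<kappa> j = (?\<delta> j)(pcol ?\<kappa> u j := Suc (?\<delta> j (pcol ?\<kappa> u j)))" using down_up[OF v, of j] j \<Gamma>
        by auto
      then have "line_col U (f1 (Suc u)) (f1 j) = pcol ?\<kappa> u j" using c0 st(3)[OF f1(1) j] d1
        by (metis fun_inc_index)
      moreover have "line_col U (g (Suc u)) (g j) \<le> line_col U (f1 (Suc u)) (f1 j)"
      proof (rule line_col_le_of_rank[OF hy[OF f1(1)] hy[OF g(1)] st(1)[OF f1(1) j] st(4)[OF f1(1)
        j] st(1)[OF g(1) j] st(4)[OF g(1) j]])
        show "rank k (f1 j) U = rank k (g j) U" for k
          using rank_eq_sum[of _ U k] st[OF f1(1) j] st[OF g(1) j] sU by auto
        show "rank k (f1 j) (f1 (Suc u)) \<le> rank k (g j) (g (Suc u))" for k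
          using g(2)[of j "Suc u" k] j by auto
      qed
      ultimately show "line_col U (g (Suc u)) (g j) \<le> pcol ?\<kappa> u j" by simp
    qed
    have gL: "g \<in> Fl (g (Suc u)) (Suc u) W ?\<delta>"
      using Fl_restrict_line[OF U, of W ?\<kappa> g] v uw g(1) lc \<Gamma> unfolding u_def w_def by auto
    have "g w = W" using g(1) unfolding Fl_def w_def by auto
    moreover have "\<forall>j\<in>{Suc u..w}. cols (g j) (g (Suc u)) = ?\<delta> j" using gL unfolding Fl_def w_def
      by blast
    then have "cols (g w) (g (Suc u)) = ?\<delta> w" "g (Suc u) \<subseteq> g w"
      using uw st(4)[OF g(1), of w] by auto
    ultimately have "rank k (g j) (g i) \<le> i + (\<Sum>l=k..<N. \<Gamma> i j l)"
      using IH[OF hy[OF g(1)]] gL ij False by auto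
    moreover have "rank k (f j) (f i) \<le> rank k (g j) (g i)" using g(2)[of j i k] ij by auto
    ultimately show ?thesis by simp
  qed
  show ?case using f1 ub unfolding u_def w_def by blast
qed

end

section \<open>Jeu de taquin\<close>

definition is_young :: "(nat \<times> nat) set \<Rightarrow> bool" where
  "is_young D \<longleftrightarrow> (\<forall>r c. (r, Suc c) \<in> D \<longrightarrow> (r, c) \<in> D) \<and> (\<forall>r c. (Suc r, c) \<in> D \<longrightarrow> (r, c) \<in> D)"

definition colh :: "(nat \<times> nat) set \<Rightarrow> nat \<Rightarrow> nat" where
  "colh D c = card {r. (r, c) \<in> D}"

text \<open>Conjugation of partitions, from column lengths to row lengths.\<close>

definition shape_of_cols :: "(nat \<Rightarrow> nat) \<Rightarrow> partition" where
  "shape_of_cols \<kappa> r = card {c. r < \<kappa> c}"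

definition adj :: "nat \<times> nat \<Rightarrow> nat \<times> nat \<Rightarrow> bool" where
  "adj s t \<longleftrightarrow> t = (fst s, Suc (snd s)) \<or> t = (Suc (fst s), snd s)"

lemma is_young_down:
  assumes "is_young D" "(r, c) \<in> D" "r' \<le> r" "c' \<le> c"
  shows "(r', c') \<in> D"
proof -
  have y: "(r, Suc c) \<in> D \<Longrightarrow> (r, c) \<in> D" "(Suc r, c) \<in> D \<Longrightarrow> (r, c) \<in> D" for r c
    using assms(1) unfolding is_young_def by blast+
  have "(r', c) \<in> D" using assms(3,2) by (induction rule: inc_induct) (simp, blast intro: y(2))
  then show ?thesis using assms(4)
  proof (induction "c" arbitrary: c' rule: nat.induct)
    case (Suc c)
    then show ?case using y(1)[of r' c] by (cases "c' = Suc c") auto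
  qed simp
qed

lemma is_young_adj:
  assumes "is_young D" "adj s t" "t \<in> D"
  shows "s \<in> D"
proof -
  have "(fst s, snd s) \<in> D"
    using is_young_down[OF assms(1), of "fst t" "snd t" "fst s" "snd s"] assms(2,3)
      unfolding adj_def by auto
  then show ?thesis by simp
qed

lemma young_initial:
  fixes A :: "nat set"
  assumes "finite A" "\<And>r r'. r \<in> A \<Longrightarrow> r' \<le> r \<Longrightarrow> r' \<in> A"
  shows "A = {..<card A}"
proof (cases "A = {}")
  case False
  define m where "m = Max A"
  have "m \<in> A" using False assms(1) m_def by simp
  then have "A = {..m}" using assms m_def by (auto intro: Max_ge)
  then have "A = {..<Suc m}" using lessThan_Suc_atMost by simp
  then show ?thesis by (metis card_lessThan)
qed simp

lemma finite_column: "finite D \<Longrightarrow> finite {r. (r, c) \<in> D}"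
  and finite_row: "finite D \<Longrightarrow> finite {c. (r, c) \<in> D}"
  using finite_subset[of "{r. (r, c) \<in> D}" "fst ` D"] finite_subset[of "{c. (r, c) \<in> D}" "snd ` D"]
    by force+

lemma young_colh:
  assumes "finite D" "is_young D"
  shows "(r, c) \<in> D \<longleftrightarrow> r < colh D c"
proof -
  have "finite {r. (r, c) \<in> D}" by (rule finite_column[OF assms(1)])
  then have "{r. (r, c) \<in> D} = {..<colh D c}"
    unfolding colh_def using is_young_down[OF assms(2)] by (intro young_initial) auto
  then show ?thesis by auto
qed

lemma shape_of_colh:
  assumes "finite D" "is_young D"
  shows "shape_of_cols (colh D) = (\<lambda>r. card {c. (r, c) \<in> D})"
  unfolding shape_of_cols_def young_colh[OF assms] ..

lemma colh_insert:
  assumes "finite D" "(r, c) \<notin> D"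
  shows "colh (insert (r, c) D) = (colh D)(c := Suc (colh D c))"
proof
  fix c'
  have f: "finite {r. (r, c) \<in> D}" by (rule finite_column[OF assms(1)])
  have "{r'. (r', c) \<in> insert (r, c) D} = insert r {r'. (r', c) \<in> D}" by auto
  then have "colh (insert (r, c) D) c = Suc (colh D c)" unfolding colh_def using f assms(2) by simp
  moreover have "colh (insert (r, c) D) c' = colh D c'" if "c' \<noteq> c" unfolding colh_def using that
    by simp
  ultimately show "colh (insert (r, c) D) c' = ((colh D)(c := Suc (colh D c))) c'" by simp
qed

lemma antimono_colh:
  assumes "finite D" "is_young D"
  shows "antimono (colh D)"
proof (rule antimonoI)
  fix k l :: nat assume "k \<le> l"
  then have "r < colh D l \<Longrightarrow> r < colh D k" for r
    using is_young_down[OF assms(2), of r l r k] young_colh[OF assms] by auto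
  then show "colh D l \<le> colh D k" by (meson not_le_imp_less less_irrefl)
qed

text \<open>The tableau with entry \<open>j\<close> in the square \<open>b j\<close>, for \<open>i \<le> j < n\<close>.\<close>

primrec tab :: "(nat \<Rightarrow> nat \<times> nat) \<Rightarrow> nat \<Rightarrow> nat \<Rightarrow> tableau" where
  "tab b i 0 = Map.empty"
| "tab b i (Suc n) = (if i \<le> n then (tab b i n)(b n \<mapsto> n) else Map.empty)"

text \<open>Rows and columns of \<open>tab b i n\<close> increase exactly when each initial segment
  of squares is a Young diagram. The entries start at i because slides keep their values.\<close>

definition grows :: "(nat \<Rightarrow> nat \<times> nat) \<Rightarrow> nat \<Rightarrow> nat \<Rightarrow> bool" where
  "grows b i n \<longleftrightarrow> inj_on b {i..<n} \<and> (\<forall>j\<in>{i..n}. is_young (b ` {i..<j}))"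

lemma tab_empty [simp]: "n \<le> i \<Longrightarrow> tab b i n = Map.empty"
  by (cases n) auto

lemma tab_Some: "inj_on b {i..<n} \<Longrightarrow> tab b i n s = Some j \<longleftrightarrow> i \<le> j \<and> j < n \<and> b j = s"
proof (induction n)
  case (Suc n)
  show ?case
  proof (cases "i \<le> n")
    case True
    have inj: "inj_on b {i..<n}" using Suc.prems by (rule inj_on_subset) auto
    have "b j \<noteq> b n" if "i \<le> j" "j < n" for j using inj_onD[OF Suc.prems, of j n] that True by auto
    then show ?thesis using Suc.IH[OF inj] True by (auto simp: less_Suc_eq)
  qed auto
qed simp

lemma dom_tab:
  assumes "inj_on b {i..<n}"
  shows "dom (tab b i n) = b ` {i..<n}"
proof (rule Set.set_eqI)
  fix s
  have "s \<in> dom (tab b i n) \<longleftrightarrow> (\<exists>j. tab b i n s = Some j)" by blast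
  then show "s \<in> dom (tab b i n) \<longleftrightarrow> s \<in> b ` {i..<n}" unfolding tab_Some[OF assms] by auto
qed

lemma ran_tab:
  assumes "inj_on b {i..<n}"
  shows "ran (tab b i n) = {i..<n}"
  unfolding ran_def tab_Some[OF assms] by auto

lemma tab_less_tab:
  assumes "inj_on b {i..<n}" "m \<le> n"
  shows "tab_less (tab b i n) m = tab b i m"
proof
  fix s
  have inj: "inj_on b {i..<m}" using assms by (auto intro: inj_on_subset)
  show "tab_less (tab b i n) m s = tab b i m s"
  proof (cases "tab b i n s")
    case None
    then have "tab b i m s \<noteq> Some a" for a
      using tab_Some[OF inj, of s a] tab_Some[OF assms(1), of s a] assms(2) by auto
    then have "tab b i m s = None" by (cases "tab b i m s") auto
    then show ?thesis using None unfolding tab_less_def restrict_map_def by auto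
  next
    case (Some a)
    note a = Some[unfolded tab_Some[OF assms(1)]]
    show ?thesis
    proof (cases "a < m")
      case True
      then have "tab b i m s = Some a" unfolding tab_Some[OF inj] using a by simp
      then show ?thesis using Some True unfolding tab_less_def restrict_map_def by auto
    next
      case False
      have "tab b i m s \<noteq> Some a'" for a'
      proof
        assume "tab b i m s = Some a'"
        then have "a' < m" "tab b i n s = Some a'"
          using tab_Some[OF inj] tab_Some[OF assms(1)] assms(2) by auto
        then show False using Some False by simp
      qed
      then have "tab b i m s = None" by (cases "tab b i m s") auto
      then show ?thesis using Some False unfolding tab_less_def restrict_map_def by auto
    qed
  qed
qed

lemma growsD:
  assumes "grows b i n"
  shows "inj_on b {i..<n}" "j \<le> n \<Longrightarrow> is_young (b ` {i..<j})"
proof -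
  show "inj_on b {i..<n}" using assms unfolding grows_def by simp
  show "is_young (b ` {i..<j})" if "j \<le> n"
  proof (cases "i \<le> j")
    case True
    then show ?thesis using assms that unfolding grows_def by simp
  next
    case False
    then show ?thesis by (simp add: is_young_def)
  qed
qed

lemma grows_sub: "grows b i n \<Longrightarrow> m \<le> n \<Longrightarrow> grows b i m"
  unfolding grows_def by (auto intro: inj_on_subset)

definition gcols :: "(nat \<Rightarrow> nat \<times> nat) \<Rightarrow> nat \<Rightarrow> nat \<Rightarrow> nat \<Rightarrow> nat" where
  "gcols b i j = colh (b ` {i..<j})"

lemma tab_shape_tab:
  assumes "grows b i n"
  shows "tab_shape (tab b i n) = shape_of_cols (gcols b i n)"
  unfolding tab_shape_def dom_tab[OF growsD(1)[OF assms]] gcols_def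
  using growsD(2)[OF assms order_refl] by (simp add: shape_of_colh)

lemma young_image: "grows b i n \<Longrightarrow> j \<le> n \<Longrightarrow> (r, c) \<in> b ` {i..<j} \<longleftrightarrow> r < gcols b i j c"
  unfolding gcols_def using young_colh growsD(2) by blast

lemma grows_step:
  assumes "grows b i n" "i \<le> j" "j < n"
  shows "b j \<notin> b ` {i..<j}" "b ` {i..<Suc j} = insert (b j) (b ` {i..<j})"
    "gcols b i (Suc j) = (gcols b i j)(snd (b j) := Suc (gcols b i j (snd (b j))))"
    "fst (b j) = gcols b i j (snd (b j))"
proof -
  show n: "b j \<notin> b ` {i..<j}" using inj_onD[OF growsD(1)[OF assms(1)], of j] assms by fastforce
  have "{i..<Suc j} = insert j {i..<j}" using assms by auto
  then show e: "b ` {i..<Suc j} = insert (b j) (b ` {i..<j})" by simp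
  show g: "gcols b i (Suc j) = (gcols b i j)(snd (b j) := Suc (gcols b i j (snd (b j))))"
    unfolding gcols_def e using colh_insert[of "b ` {i..<j}" "fst (b j)" "snd (b j)"] n by simp
  have "\<not> fst (b j) < gcols b i j (snd (b j))" using young_image[OF assms(1), of j] n assms
    by (metis less_imp_le prod.collapse)
  moreover have "fst (b j) < gcols b i (Suc j) (snd (b j))"
    using young_image[OF assms(1), of "Suc j" "fst (b j)" "snd (b j)"] e assms by auto
  ultimately show "fst (b j) = gcols b i j (snd (b j))" unfolding g by simp
qed

lemma grows_valid:
  assumes "grows b i n"
  shows "valid i n (gcols b i)"
  unfolding valid_def
proof (intro conjI ballI)
  show "gcols b i i = (\<lambda>_. 0)" unfolding gcols_def colh_def by simp
  show "antimono (gcols b i j)" if "j \<in> {i..n}" for j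
    unfolding gcols_def using that growsD(2)[OF assms] by (intro antimono_colh) auto
  show "\<exists>c. gcols b i (Suc j) = (gcols b i j)(c := Suc (gcols b i j c))" if "j \<in> {i..<n}" for j
    using grows_step(3)[OF assms, of j] that by auto
qed

text \<open>\<open>slide\<close> with the final empty square recorded in the third argument.\<close>

inductive slide_to :: "nat \<times> nat \<Rightarrow> tableau \<Rightarrow> nat \<times> nat \<Rightarrow> tableau \<Rightarrow> bool" where
  stop: "T (fst s, Suc (snd s)) = None \<Longrightarrow> T (Suc (fst s), snd s) = None \<Longrightarrow> slide_to s T s T"
| right: "T (fst s, Suc (snd s)) = Some x \<Longrightarrow> (\<And>y. T (Suc (fst s), snd s) = Some y \<Longrightarrow> x < y) \<Longrightarrow>
    slide_to (fst s, Suc (snd s)) (T(s := Some x, (fst s, Suc (snd s)) := None)) e T' \<Longrightarrow> slide_to s T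
      e T'"
| below: "T (Suc (fst s), snd s) = Some y \<Longrightarrow> (\<And>x. T (fst s, Suc (snd s)) = Some x \<Longrightarrow> \<not> x < y) \<Longrightarrow>
    slide_to (Suc (fst s), snd s) (T(s := Some y, (Suc (fst s), snd s) := None)) e T' \<Longrightarrow> slide_to s T
      e T'"

text \<open>\<open>slide\<close> is a partial function without an induction rule along its run; the
  relation supplies one for terminating runs.\<close>

lemma slide_eq: "slide_to s T e T' \<Longrightarrow> slide s T = T'"
proof (induction rule: slide_to.induct)
  case (stop T s)
  then show ?case by (subst slide.simps) simp
next
  case (right T s x e T')
  have "slide s T = slide (fst s, Suc (snd s)) (T(s := Some x, (fst s, Suc (snd s)) := None))"
    by (subst slide.simps) (use right.hyps(1,2) in \<open>auto simp: Let_def split: option.split\<close>)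
  then show ?case using right.IH by simp
next
  case (below T s y e T')
  have "slide s T = slide (Suc (fst s), snd s) (T(s := Some y, (Suc (fst s), snd s) := None))"
    by (subst slide.simps) (use below.hyps(1,2) in \<open>auto simp: Let_def split: option.split\<close>)
  then show ?case using below.IH by simp
qed

text \<open>A largest entry loses every comparison, so the run is unchanged up to the square e where
  it used to stop. It makes one more move exactly if b is the right or lower neighbour of e, and
  then it stops, since nothing lies right of or below b.\<close>

lemma slide_to_add_max:
  assumes "slide_to s T e T'" "\<And>t y. T t = Some y \<Longrightarrow> y < x" "T b = None" "b \<noteq> s" "\<not> adj b s"
    "\<And>t. adj b t \<Longrightarrow> T t = None"
  shows "slide_to s (T(b \<mapsto> x)) (if adj e b then b else e) (T'((if adj e b then e else b) \<mapsto> x))"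
  using assms
proof (induction rule: slide_to.induct)
  case (stop T s)
  show ?case
  proof (cases "adj s b")
    case True
    have z: "slide_to b (T(s \<mapsto> x)) b (T(s \<mapsto> x))"
      using stop.prems(4,5) by (intro slide_to.stop) (auto simp: adj_def)
    have eq: "(T(b \<mapsto> x))(s \<mapsto> x, b := None) = T(s \<mapsto> x)" using stop.prems(2,3)
      by (auto simp: fun_eq_iff)
    consider "b = (fst s, Suc (snd s))" | "b = (Suc (fst s), snd s)" using True unfolding adj_def
      by auto
    then have "slide_to s (T(b \<mapsto> x)) b (T(s \<mapsto> x))"
    proof cases
      case 1
      show ?thesis
      proof (rule slide_to.right[where x = x])
        show "(T(b \<mapsto> x)) (fst s, Suc (snd s)) = Some x" using 1 by simp
        show "x < y" if "(T(b \<mapsto> x)) (Suc (fst s), snd s) = Some y" for y using that 1 stop.hyps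
          by simp
        show "slide_to (fst s, Suc (snd s)) ((T(b \<mapsto> x))(s \<mapsto> x, (fst s, Suc (snd s)) := None)) b (T(s
          \<mapsto> x))"
          unfolding 1[symmetric] eq by (rule z)
      qed
    next
      case 2
      show ?thesis
      proof (rule slide_to.below[where y = x])
        show "(T(b \<mapsto> x)) (Suc (fst s), snd s) = Some x" using 2 by simp
        show "\<not> y < x" if "(T(b \<mapsto> x)) (fst s, Suc (snd s)) = Some y" for y using that 2 stop.hyps
          by simp
        show "slide_to (Suc (fst s), snd s) ((T(b \<mapsto> x))(s \<mapsto> x, (Suc (fst s), snd s) := None)) b (T(s
          \<mapsto> x))"
          unfolding 2[symmetric] eq by (rule z)
      qed
    qed
    then show ?thesis using True by (simp only: if_True)
  next
    case False
    then have "slide_to s (T(b \<mapsto> x)) s (T(b \<mapsto> x))" using stop.hyps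
      by (intro slide_to.stop) (auto simp: adj_def)
    then show ?thesis using False by (simp only: if_False)
  qed
next
  case (right T s y e T')
  let ?r = "(fst s, Suc (snd s))"
  have br: "b \<noteq> ?r" using right.hyps(1) right.prems(2) by auto
  have ab: "\<not> adj b ?r" using right.prems(5)[of ?r] right.hyps(1) by auto
  have "slide_to ?r ((T(s \<mapsto> y, ?r := None))(b \<mapsto> x)) (if adj e b then b else e) (T'((if adj e b then
    e else b) \<mapsto> x))"
  proof (rule right.IH)
    show "t' < x" if "(T(s \<mapsto> y, ?r := None)) t = Some t'" for t t'
      using that right.prems(1) right.hyps(1) by (auto split: if_splits)
    show "(T(s \<mapsto> y, ?r := None)) b = None" using right.prems(2,3) br by auto
    show "(T(s \<mapsto> y, ?r := None)) t = None" if "adj b t" for t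
      using that right.prems(4,5) by auto
  qed (use br ab in auto)
  moreover have "(T(s \<mapsto> y, ?r := None))(b \<mapsto> x) = (T(b \<mapsto> x))(s \<mapsto> y, ?r := None)"
    using br right.prems(3) by (auto simp: fun_eq_iff)
  ultimately have "slide_to ?r ((T(b \<mapsto> x))(s \<mapsto> y, ?r := None)) (if adj e b then b else e) (T'((if
    adj e b then e else b) \<mapsto> x))"
    by (simp only:)
  then show ?case
  proof (rule slide_to.right[rotated 2])
    show "(T(b \<mapsto> x)) ?r = Some y" using br right.hyps(1) by simp
    show "y < z" if "(T(b \<mapsto> x)) (Suc (fst s), snd s) = Some z" for z
      using that right.hyps(2)[of z] right.prems(1)[OF right.hyps(1)] by (simp split: if_splits)
  qed
next
  case (below T s y e T')
  let ?r = "(Suc (fst s), snd s)"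
  have br: "b \<noteq> ?r" using below.hyps(1) below.prems(2) by auto
  have ab: "\<not> adj b ?r" using below.prems(5)[of ?r] below.hyps(1) by auto
  have yx: "y < x" using below.prems(1) below.hyps(1) by blast
  have "slide_to ?r ((T(s \<mapsto> y, ?r := None))(b \<mapsto> x)) (if adj e b then b else e) (T'((if adj e b then
    e else b) \<mapsto> x))"
  proof (rule below.IH)
    show "t' < x" if "(T(s \<mapsto> y, ?r := None)) t = Some t'" for t t'
      using that below.prems(1) below.hyps(1) by (auto split: if_splits)
    show "(T(s \<mapsto> y, ?r := None)) b = None" using below.prems(2,3) br by auto
    show "(T(s \<mapsto> y, ?r := None)) t = None" if "adj b t" for t
      using that below.prems(4,5) by auto
  qed (use br ab in auto)
  moreover have "(T(s \<mapsto> y, ?r := None))(b \<mapsto> x) = (T(b \<mapsto> x))(s \<mapsto> y, ?r := None)"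
    using br below.prems(3) by (auto simp: fun_eq_iff)
  ultimately have "slide_to ?r ((T(b \<mapsto> x))(s \<mapsto> y, ?r := None)) (if adj e b then b else e) (T'((if
    adj e b then e else b) \<mapsto> x))"
    by (simp only:)
  then show ?case
  proof (rule slide_to.below[rotated 2])
    show "(T(b \<mapsto> x)) ?r = Some y" using br below.hyps(1) by simp
    show "\<not> z < y" if "(T(b \<mapsto> x)) (fst s, Suc (snd s)) = Some z" for z
      using that below.hyps(2)[of z] yx by (simp split: if_splits)
  qed
qed

text \<open>\<open>hole b i n\<close> is the final empty square of the slide of the entries less than \<open>n\<close>,
  and \<open>slid b i n\<close>
  the new position of entry \<open>n\<close>: adding a largest entry extends the slide by at most one step.\<close>

primrec hole :: "(nat \<Rightarrow> nat \<times> nat) \<Rightarrow> nat \<Rightarrow> nat \<Rightarrow> nat \<times> nat" where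
  "hole b i 0 = (0, 0)"
| "hole b i (Suc n) = (if n \<le> i then (0, 0) else if adj (hole b i n) (b n) then b n else hole b i
  n)"

definition slid :: "(nat \<Rightarrow> nat \<times> nat) \<Rightarrow> nat \<Rightarrow> nat \<Rightarrow> nat \<times> nat" where
  "slid b i n = (if adj (hole b i n) (b n) then hole b i n else b n)"

lemma grows_first:
  assumes "grows b i n" "i < n"
  shows "b i = (0, 0)"
proof -
  have "is_young {b i}" using growsD(2)[OF assms(1), of "Suc i"] assms by simp
  then have "(0, 0) \<in> {b i}" using is_young_down[of "{b i}" "fst (b i)" "snd (b i)" 0 0] by simp
  then show ?thesis by simp
qed

lemma insert_remove_if:
  "h \<in> D \<Longrightarrow> x \<notin> D \<Longrightarrow> insert (if P then h else x) (D - {h}) = insert x D - {if P then x else h}"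
  by auto

text \<open>Since the hole is always a corner of the diagram, each new entry affects it only by
  being adjacent to it. The last conjunct identifies the rule \<open>pcol\<close> on columns with
  the actual slide.\<close>

lemma hole_invariant:
  assumes g: "grows b i n" and "Suc i \<le> j" "j \<le> n"
  shows "hole b i j \<in> b ` {i..<j} \<and> (\<forall>t. adj (hole b i j) t \<longrightarrow> t \<notin> b ` {i..<j}) \<and>
    slid b i ` {Suc i..<j} = b ` {i..<j} - {hole b i j} \<and> inj_on (slid b i) {Suc i..<j} \<and>
    snd (hole b i j) = pcol (gcols b i) i j"
  using assms(2,3)
proof (induction j rule: dec_induct)
  case base
  then show ?case using grows_first[OF g] by (auto simp: adj_def)
next
  case (step j)
  let ?h = "hole b i j" and ?\<kappa> = "gcols b i"
  have IH: "?h \<in> b ` {i..<j}" "\<And>t. adj ?h t \<Longrightarrow> t \<notin> b ` {i..<j}"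
    "slid b i ` {Suc i..<j} = b ` {i..<j} - {?h}" "inj_on (slid b i) {Suc i..<j}"
      "snd ?h = pcol ?\<kappa> i j"
    using step.IH step.prems by auto
  have jn: "i \<le> j" "j < n" using step by auto
  note gs = grows_step[OF g jn]
  have hs: "hole b i (Suc j) = (if adj ?h (b j) then b j else ?h)" using step by simp
  have 0: "{Suc i..<Suc j} = insert j {Suc i..<j}" using step by auto
  have y: "is_young (b ` {i..<j})" using growsD(2)[OF g] jn by auto
  have hin: "hole b i (Suc j) \<in> b ` {i..<Suc j}" using hs IH(1) gs(2) by auto
  have corner: "t \<notin> b ` {i..<Suc j}" if "adj (hole b i (Suc j)) t" for t
  proof (cases "adj ?h (b j)")
    case True
    then have a: "adj (b j) t" using that hs by simp
    then have "t \<notin> b ` {i..<j}" using is_young_adj[OF y a] gs(1) by auto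
    moreover have "t \<noteq> b j" using a by (cases "b j") (auto simp: adj_def)
    ultimately show ?thesis using gs(2) by auto
  next
    case False
    then show ?thesis using that hs IH(2) gs(2) by auto
  qed
  have img: "slid b i ` {Suc i..<Suc j} = b ` {i..<Suc j} - {hole b i (Suc j)}"
    unfolding 0 image_insert IH(3) gs(2) hs unfolding slid_def
      by (rule insert_remove_if[OF IH(1) gs(1)])
  have "slid b i j \<notin> slid b i ` {Suc i..<j}" unfolding IH(3) unfolding slid_def using gs(1) by auto
  then have inj: "inj_on (slid b i) {Suc i..<Suc j}" unfolding 0 using IH(4) by auto
  have "snd (hole b i (Suc j)) = pcol ?\<kappa> i (Suc j)"
  proof -
    obtain r p where h: "?h = (r, p)" by (cases ?h)
    have p: "p = pcol ?\<kappa> i j" using IH(5) h by simp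
    obtain r' c where bj: "b j = (r', c)" by (cases "b j")
    have r': "r' = ?\<kappa> j c" and k: "?\<kappa> (Suc j) = (?\<kappa> j)(c := Suc (?\<kappa> j c))" using gs(3,4) bj by auto
    have yi: "(a, d) \<in> b ` {i..<j} \<longleftrightarrow> a < ?\<kappa> j d" for a d using young_image[OF g] jn by auto
    \<comment> \<open>The hole (r, p) is a corner. The new square lies at the foot of its column c:
      for c = p it is directly below the hole, and the column is kept; for c = p + 1 it is adjacent
      only if r' = r, and then the column increases.\<close>
    have 1: "r < ?\<kappa> j p" using IH(1) h yi by simp
    have 2: "\<not> Suc r < ?\<kappa> j p" "\<not> r < ?\<kappa> j (Suc p)"
      using IH(2)[of "(Suc r, p)"] IH(2)[of "(r, Suc p)"] h yi by (auto simp: adj_def)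
    have ps: "pcol ?\<kappa> i (Suc j) = (if ?\<kappa> (Suc j) (Suc p) < ?\<kappa> (Suc j) p then p else Suc p)"
      using step by (simp add: pcol.simps p)
    show ?thesis
      unfolding hs ps using 1 2 r' by (auto simp: h bj k adj_def)
  qed
  then show ?case using hin corner img inj by blast
qed

lemma gcols_slid:
  assumes g: "grows b i n" and j: "Suc i \<le> j" "j \<le> n"
  shows "gcols (slid b i) (Suc i) j = down (gcols b i) i j"
proof -
  let ?D = "b ` {i..<j}" and ?h = "hole b i j"
  note inv = hole_invariant[OF g j]
  have "?h \<in> ?D" using inv by blast
  then have "insert (fst ?h, snd ?h) (?D - {?h}) = ?D" by (simp only: prod.collapse insert_Diff)
  then have "colh ?D = (colh (?D - {?h}))(snd ?h := Suc (colh (?D - {?h}) (snd ?h)))"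
    using colh_insert[of "?D - {?h}" "fst ?h" "snd ?h"] by simp
  moreover have "slid b i ` {Suc i..<j} = ?D - {?h}" "snd ?h = pcol (gcols b i) i j" using inv
    by auto
  ultimately show ?thesis unfolding gcols_def[of "slid b i"] down_def
    by (simp add: gcols_def fun_eq_iff)
qed

lemma grows_slid:
  assumes g: "grows b i n" and i: "i < n"
  shows "grows (slid b i) (Suc i) n"
  unfolding grows_def
proof (intro conjI ballI)
  show "inj_on (slid b i) {Suc i..<n}" using hole_invariant[OF g, of n] i by auto
  fix j assume j: "j \<in> {Suc i..n}"
  let ?D = "b ` {i..<j}" and ?h = "hole b i j"
  have inv: "slid b i ` {Suc i..<j} = ?D - {?h}" "\<And>t. adj ?h t \<Longrightarrow> t \<notin> ?D"
    using hole_invariant[OF g, of j] j by auto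
  have y: "is_young ?D" using growsD(2)[OF g] j by auto
  show "is_young (slid b i ` {Suc i..<j})"
    unfolding inv(1) is_young_def
  proof (intro conjI allI impI)
    fix r c assume a: "(r, Suc c) \<in> ?D - {?h}"
    then have "(r, c) \<in> ?D" using y unfolding is_young_def by blast
    moreover have "(r, c) \<noteq> ?h"
    proof
      assume "(r, c) = ?h"
      then have "adj ?h (r, Suc c)" unfolding adj_def by (metis fst_conv snd_conv)
      then show False using inv(2) a by blast
    qed
    ultimately show "(r, c) \<in> ?D - {?h}" by blast
  next
    fix r c assume a: "(Suc r, c) \<in> ?D - {?h}"
    then have "(r, c) \<in> ?D" using y unfolding is_young_def by blast
    moreover have "(r, c) \<noteq> ?h"
    proof
      assume "(r, c) = ?h"
      then have "adj ?h (Suc r, c)" unfolding adj_def by (metis fst_conv snd_conv)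
      then show False using inv(2) a by blast
    qed
    ultimately show "(r, c) \<in> ?D - {?h}" by blast
  qed
qed

lemma slide_to_tab:
  assumes g: "grows b i n" and "Suc i \<le> j" "j \<le> n"
  shows "slide_to (0, 0) ((tab b i j)((0, 0) := None)) (hole b i j) (tab (slid b i) (Suc i) j)"
  using assms(2,3)
proof (induction j rule: dec_induct)
  case base
  have "(tab b i (Suc i))((0, 0) := None) = Map.empty" using grows_first[OF g] base by auto
  moreover have "hole b i (Suc i) = (0, 0)" "tab (slid b i) (Suc i) (Suc i) = Map.empty" by simp_all
  moreover have "slide_to (0, 0) Map.empty (0, 0) Map.empty" by (rule slide_to.stop) auto
  ultimately show ?case by (simp only:)
next
  case (step j)
  let ?T = "(tab b i j)((0, 0) := None)"
  have jn: "i \<le> j" "j < n" using step by auto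
  note gs = grows_step[OF g jn]
  have inj: "inj_on b {i..<j}" using growsD(1)[OF g] jn by (auto intro: inj_on_subset)
  have y: "is_young (b ` {i..<j})" using growsD(2)[OF g] jn by auto
  have "b i = (0, 0)" using grows_first[OF g] jn by auto
  then have "(0, 0) \<in> b ` {i..<j}" using step.hyps by force
  then have b0: "b j \<noteq> (0, 0)" using gs(1) by auto
  have dom: "?T t = None" if "t \<notin> b ` {i..<j}" for t using dom_tab[OF inj] that
    by (auto simp: dom_def)
  have "slide_to (0, 0) (?T(b j \<mapsto> j)) (if adj (hole b i j) (b j) then b j else hole b i j)
      ((tab (slid b i) (Suc i) j)((if adj (hole b i j) (b j) then hole b i j else b j) \<mapsto> j))"
  proof (rule slide_to_add_max)
    show "slide_to (0, 0) ?T (hole b i j) (tab (slid b i) (Suc i) j)"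
      by (rule step.IH) (use jn in simp)
    show "y < j" if "?T t = Some y" for t y using that tab_Some[OF inj, of t y]
      by (auto split: if_splits)
    show "?T (b j) = None" using gs(1) by (rule dom)
    show "\<not> adj (b j) (0, 0)" by (auto simp: adj_def)
    show "?T t = None" if "adj (b j) t" for t using is_young_adj[OF y that] gs(1)
      by (intro dom) auto
  qed (rule b0)
  moreover have "?T(b j \<mapsto> j) = (tab b i (Suc j))((0, 0) := None)" using jn b0
    by (simp add: fun_upd_twist)
  moreover have "hole b i (Suc j) = (if adj (hole b i j) (b j) then b j else hole b i j)"
    using step.hyps by simp
  moreover have "tab (slid b i) (Suc i) (Suc j) =
    (tab (slid b i) (Suc i) j)((if adj (hole b i j) (b j) then hole b i j else b j) \<mapsto> j)"
    using step.hyps slid_def[of b i j] by simp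
  ultimately show ?case by (simp only:)
qed

lemma tab_down_tab:
  assumes "grows b i n" "i < n"
  shows "tab_down (tab b i n) = tab (slid b i) (Suc i) n"
  unfolding tab_down_def using slide_eq[OF slide_to_tab[OF assms(1)]] assms(2) by simp

lemma tab_down_empty: "tab_down Map.empty = Map.empty"
proof -
  have "slide_to (0, 0) (Map.empty((0, 0) := None)) (0, 0) (Map.empty((0, 0) := None))"
    by (rule slide_to.stop) auto
  from slide_eq[OF this] show ?thesis unfolding tab_down_def by simp
qed

section \<open>Iterated slides and the growth diagram\<close>

primrec boxes :: "(nat \<Rightarrow> nat \<times> nat) \<Rightarrow> nat \<Rightarrow> nat \<Rightarrow> nat \<times> nat" where
  "boxes b 0 = b"
| "boxes b (Suc i) = slid (boxes b i) i"

primrec gamma :: "(nat \<Rightarrow> nat \<Rightarrow> nat) \<Rightarrow> nat \<Rightarrow> nat \<Rightarrow> nat \<Rightarrow> nat" where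
  "gamma \<kappa> 0 = \<kappa>"
| "gamma \<kappa> (Suc i) = down (gamma \<kappa> i) i"

lemma pcol_cong:
  assumes "\<And>j'. u \<le> j' \<Longrightarrow> j' \<le> j \<Longrightarrow> \<kappa> j' = \<kappa>' j'"
  shows "pcol \<kappa> u j = pcol \<kappa>' u j"
  using assms by (induction j) (auto simp: pcol.simps)

lemma grows_boxes:
  assumes "grows b 0 n" "i \<le> n"
  shows "grows (boxes b i) i n" "(tab_down ^^ i) (tab b 0 n) = tab (boxes b i) i n"
    "\<And>j. i \<le> j \<Longrightarrow> j \<le> n \<Longrightarrow> gamma (gcols b 0) i j = gcols (boxes b i) i j"
  using assms(2)
proof (induction i)
  case 0
  { case 1 show ?case using assms by simp
  next case 2 show ?case by simp
  next case (3 j) then show ?case by simp }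
next
  case (Suc i)
  { case 1 then show ?case using grows_slid Suc.IH(1) by simp
  next case 2 then show ?case using tab_down_tab[OF Suc.IH(1)] Suc.IH(2) by simp
  next case (3 j)
    have "pcol (gamma (gcols b 0) i) i j = pcol (gcols (boxes b i) i) i j"
      using Suc.IH(3) 3 by (intro pcol_cong) auto
    moreover have "gamma (gcols b 0) i j = gcols (boxes b i) i j" using Suc.IH(3)[of j] 3 by simp
    ultimately have "down (gamma (gcols b 0) i) i j = down (gcols (boxes b i) i) i j"
      unfolding down_def by simp
    then show ?case using gcols_slid[OF Suc.IH(1), of j] 3 by simp }
qed

text \<open>\<open>jdt\<close> bounds i by m but not m by the number of entries, so slides of the
  empty tableau can occur.\<close>

lemma tab_down_pow_ge:
  assumes "grows b 0 n" "n \<le> i"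
  shows "(tab_down ^^ i) (tab b 0 n) = Map.empty"
  using assms(2)
proof (induction i rule: dec_induct)
  case base
  then show ?case using grows_boxes(2)[OF assms(1), of n] by simp
qed (simp add: tab_down_empty)

definition shapes :: "(nat \<Rightarrow> nat \<times> nat) \<Rightarrow> nat \<Rightarrow> nat \<Rightarrow> nat \<Rightarrow> partition list" where
  "shapes b i m n = map (\<lambda>j. shape_of_cols (gcols b i j)) (rev [m..<Suc n])"

lemma tab_chain_tab:
  assumes g: "grows b i n" and i: "i \<le> n"
  shows "tab_chain (tab b i n) = shapes b i i n"
proof -
  note inj = growsD(1)[OF g]
  have "tab_shape (tab_less (tab b i n) a) = shape_of_cols (gcols b i a)" if "a < n" for a
    using tab_less_tab[OF inj, of a] tab_shape_tab[OF grows_sub[OF g, of a]] that by simp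
  then have "map (\<lambda>a. tab_shape (tab_less (tab b i n) a)) (rev [i..<n])
    = map (\<lambda>j. shape_of_cols (gcols b i j)) (rev [i..<n])"
    by (intro map_cong) auto
  then show ?thesis using i tab_shape_tab[OF g] unfolding tab_chain_def shapes_def ran_tab[OF inj]
    by simp
qed

lemma young_of_shape:
  assumes g: "grows b i n" and j: "j \<le> n"
  shows "young_diagram (shape_of_cols (gcols b i j)) = b ` {i..<j}"
proof -
  let ?D = "b ` {i..<j}"
  have y: "is_young ?D" using growsD(2)[OF g j] .
  have "c < shape_of_cols (gcols b i j) r \<longleftrightarrow> (r, c) \<in> ?D" for r c
  proof -
    have "finite {c. (r, c) \<in> ?D}" by (rule finite_row) simp
    then have "{c. (r, c) \<in> ?D} = {..<card {c. (r, c) \<in> ?D}}"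
      using is_young_down[OF y] by (intro young_initial) auto
    also have "card {c. (r, c) \<in> ?D} = shape_of_cols (gcols b i j) r"
      unfolding gcols_def using shape_of_colh[OF _ y] by simp
    finally show ?thesis by blast
  qed
  then show ?thesis unfolding young_diagram_def by auto
qed

text \<open>Distinct shapes make the \<open>takeWhile\<close> in \<open>tab_ge\<close> cut the chain
  at the intended place.\<close>

lemma shape_of_cols_inj:
  assumes g: "grows b i n" and "i \<le> j" "j < k" "k \<le> n"
  shows "shape_of_cols (gcols b i j) \<noteq> shape_of_cols (gcols b i k)"
proof
  assume "shape_of_cols (gcols b i j) = shape_of_cols (gcols b i k)"
  then have "b ` {i..<j} = b ` {i..<k}"
    using young_of_shape[OF g, of j] young_of_shape[OF g, of k] assms by simp
  moreover have "b j \<in> b ` {i..<k}" using assms by simp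
  ultimately show False using grows_step(1)[OF g, of j] assms by simp
qed

lemma tab_ge_tab:
  assumes g: "grows b i n" and m: "i \<le> m" "m \<le> n"
  shows "tab_ge (tab b i n) m = shapes b i m n"
proof -
  let ?s = "\<lambda>j. shape_of_cols (gcols b i j)"
  have sm: "tab_shape (tab_less (tab b i n) m) = ?s m"
    using tab_less_tab[OF growsD(1)[OF g] m(2)] tab_shape_tab[OF grows_sub[OF g m(2)]] by simp
  have "[i..<Suc n] = [i..<m] @ [m..<Suc n]" using upt_add_eq_append[of i m "Suc n - m"] m by simp
  also have "[m..<Suc n] = m # [Suc m..<Suc n]" using m by (simp add: upt_conv_Cons del: upt_Suc)
  finally have "[i..<Suc n] = [i..<m] @ m # [Suc m..<Suc n]" .
  then have e: "shapes b i i n = map ?s (rev [Suc m..<Suc n]) @ ?s m # map ?s (rev [i..<m])"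
    unfolding shapes_def by simp
  have "?s j \<noteq> ?s m" if "m < j" "j \<le> n" for j using shape_of_cols_inj[OF g m(1) that] by metis
  then have "takeWhile (\<lambda>\<kappa>. \<kappa> \<noteq> ?s m) (shapes b i i n) = map ?s (rev [Suc m..<Suc n])"
    unfolding e by (subst takeWhile_append2) auto
  moreover have "[m..<Suc n] = m # [Suc m..<Suc n]" using m
    by (simp add: upt_conv_Cons del: upt_Suc)
  ultimately show ?thesis unfolding tab_ge_def sm tab_chain_tab[OF g order_trans[OF m]] shapes_def
    by simp
qed

lemma tab_ge_large:
  assumes g: "grows b i n" and m: "i \<le> n" "n \<le> m"
  shows "tab_ge (tab b i n) m = tab_ge (tab b i n) n"
proof -
  have "tab_less (tab b i n) m = tab b i n"
    unfolding tab_less_def restrict_map_def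
    using m tab_Some[OF growsD(1)[OF g]]
      by (auto simp: fun_eq_iff) (metis not_None_eq order_less_le_trans)
  moreover have "tab_less (tab b i n) n = tab b i n" using tab_less_tab[OF growsD(1)[OF g]] by simp
  ultimately show ?thesis unfolding tab_ge_def by simp
qed

lemma young_diagram_is_young:
  assumes "is_partition lam"
  shows "is_young (young_diagram lam)"
proof -
  have "lam (Suc r) \<le> lam r" for r using assms unfolding is_partition_def antimono_def by simp
  then show ?thesis unfolding is_young_def young_diagram_def using less_le_trans by auto
qed

lemma finite_young_diagram:
  assumes "is_partition lam"
  shows "finite (young_diagram lam)" "card (young_diagram lam) = psize lam"
proof -
  let ?I = "{i. lam i \<noteq> 0}"
  have e: "young_diagram lam = (SIGMA i:?I. {..<lam i})" unfolding young_diagram_def by auto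
  have f: "finite ?I" using assms unfolding is_partition_def by simp
  show "finite (young_diagram lam)" unfolding e using f by simp
  show "card (young_diagram lam) = psize lam" unfolding e psize_def using f
    by (simp add: card_SigmaI)
qed

lemma tableau_as_tab:
  assumes T: "T \<in> tableaux lam"
  shows "\<exists>b. grows b 0 (psize lam) \<and> T = tab b 0 (psize lam)"
proof -
  let ?n = "psize lam"
  have t: "is_partition lam" "dom T = young_diagram lam" "inj_on T (dom T)"
    "\<And>i j x y. T (i, j) = Some x \<Longrightarrow> T (i, Suc j) = Some y \<Longrightarrow> x < y"
    "\<And>i j x y. T (i, j) = Some x \<Longrightarrow> T (Suc i, j) = Some y \<Longrightarrow> x < y" "ran T = {..<?n}"
    using T unfolding tableaux_def is_tableau_def by auto
  define b where "b j = (SOME s. T s = Some j)" for j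
  have Tb: "T (b j) = Some j" if "j < ?n" for j
  proof -
    have "\<exists>s. T s = Some j" using t(6) that unfolding ran_def by auto
    then show ?thesis unfolding b_def by (rule someI_ex)
  qed
  have lt: "j < ?n" if "T s = Some j" for s j using ranI[of T, OF that] t(6) by simp
  have bT: "b j = s" if "T s = Some j" for s j
    using inj_onD[OF t(3), of "b j" s] Tb[OF lt[OF that]] that by auto
  have D: "s \<in> b ` {0..<j} \<longleftrightarrow> (\<exists>a<j. T s = Some a)" if "j \<le> ?n" for s j
  proof
    assume "s \<in> b ` {0..<j}"
    then obtain a where "a < j" "s = b a" by auto
    then show "\<exists>a<j. T s = Some a" using Tb[of a] that by auto
  next
    assume "\<exists>a<j. T s = Some a"
    then obtain a where "a < j" "T s = Some a" by auto
    then show "s \<in> b ` {0..<j}" using bT[of s a] by (intro image_eqI[of _ _ a]) auto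
  qed
  have inj: "inj_on b {0..<?n}" using Tb
    by (intro inj_onI) (metis atLeastLessThan_iff option.inject)
  have y: "is_young (dom T)" using t(1,2) young_diagram_is_young by simp
  have "is_young (b ` {0..<j})" if j: "j \<le> ?n" for j
    unfolding is_young_def D[OF j]
  proof (intro conjI allI impI)
    fix r c assume "\<exists>a<j. T (r, Suc c) = Some a"
    then obtain a where a: "a < j" "T (r, Suc c) = Some a" by auto
    then have "(r, c) \<in> dom T" using y unfolding is_young_def by blast
    then obtain a' where "T (r, c) = Some a'" by auto
    then show "\<exists>a<j. T (r, c) = Some a" using t(4) a by fastforce
  next
    fix r c assume "\<exists>a<j. T (Suc r, c) = Some a"
    then obtain a where a: "a < j" "T (Suc r, c) = Some a" by auto
    then have "(r, c) \<in> dom T" using y unfolding is_young_def by blast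
    then obtain a' where "T (r, c) = Some a'" by auto
    then show "\<exists>a<j. T (r, c) = Some a" using t(5) a by fastforce
  qed
  then have g: "grows b 0 ?n" unfolding grows_def using inj by auto
  moreover have "T = tab b 0 ?n"
  proof
    fix s
    show "T s = tab b 0 ?n s"
    proof (cases "T s")
      case None
      then have "tab b 0 ?n s \<noteq> Some a" for a using tab_Some[OF inj, of s a] Tb by auto
      then show ?thesis using None by (cases "tab b 0 ?n s") auto
    next
      case (Some a)
      then show ?thesis using tab_Some[OF inj, of s a] bT lt by auto
    qed
  qed
  ultimately show ?thesis by blast
qed

section \<open>Jordan types\<close>

definition young_rows :: "partition \<Rightarrow> nat" where
  "young_rows lam = card {i. lam i \<noteq> 0}"

lemma shape_of_colh_young:
  assumes "is_partition lam"
  shows "shape_of_cols (colh (young_diagram lam)) = lam"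
  using shape_of_colh[OF finite_young_diagram(1)[OF assms] young_diagram_is_young[OF assms]]
  by (simp add: young_diagram_def fun_eq_iff)

lemma partition_rows:
  assumes "is_partition lam"
  shows "lam i \<noteq> 0 \<longleftrightarrow> i < young_rows lam"
proof -
  have "i' \<in> {i. lam i \<noteq> 0}" if "i \<in> {i. lam i \<noteq> 0}" "i' \<le> i" for i i'
    using that antimonoD[of lam i' i] assms unfolding is_partition_def by auto
  then have "{i. lam i \<noteq> 0} = {..<young_rows lam}"
    unfolding young_rows_def using assms by (intro young_initial) (auto simp: is_partition_def)
  then show ?thesis by auto
qed

context nilpotent_endo
begin

section \<open>Jordan bases modulo a subspace\<close>

definition indep_mod :: "'b set \<Rightarrow> 's set \<Rightarrow> ('s \<Rightarrow> 'b) \<Rightarrow> bool" where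
  "indep_mod U A e \<longleftrightarrow> (\<forall>c. (\<Sum>s\<in>A. c s *s e s) \<in> U \<longrightarrow> (\<forall>s\<in>A. c s = 0))"

lemma indep_modD: "indep_mod U A e \<Longrightarrow> (\<Sum>s\<in>A. c s *s e s) \<in> U \<Longrightarrow> s \<in> A \<Longrightarrow> c s = 0"
  unfolding indep_mod_def by blast

lemma span_mod_iff:
  assumes U: "subspace U" and A: "finite A"
  shows "x \<in> span (U \<union> e ` A) \<longleftrightarrow> (\<exists>c. x - (\<Sum>s\<in>A. c s *s e s) \<in> U)"
  using A
proof (induction A arbitrary: x rule: finite_induct)
  case empty
  then show ?case using U by (simp add: span_of_subspace)
next
  case (insert a A)
  have "x \<in> span (U \<union> e ` insert a A) \<longleftrightarrow> (\<exists>k. x - k *s e a \<in> span (U \<union> e ` A))"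
    by (simp add: span_breakdown_eq)
  also have "\<dots> \<longleftrightarrow> (\<exists>k c. x - k *s e a - (\<Sum>s\<in>A. c s *s e s) \<in> U)" unfolding insert.IH ..
  also have "\<dots> \<longleftrightarrow> (\<exists>c. x - (\<Sum>s\<in>insert a A. c s *s e s) \<in> U)"
  proof
    assume "\<exists>k c. x - k *s e a - (\<Sum>s\<in>A. c s *s e s) \<in> U"
    then obtain k c where kc: "x - k *s e a - (\<Sum>s\<in>A. c s *s e s) \<in> U" by auto
    have "(\<Sum>s\<in>A. (c(a := k)) s *s e s) = (\<Sum>s\<in>A. c s *s e s)" using insert.hyps
      by (intro sum.cong) auto
    then show "\<exists>c. x - (\<Sum>s\<in>insert a A. c s *s e s) \<in> U"
      using kc insert.hyps by (intro exI[of _ "c(a := k)"]) (simp add: algebra_simps)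
  next
    assume "\<exists>c. x - (\<Sum>s\<in>insert a A. c s *s e s) \<in> U"
    then show "\<exists>k c. x - k *s e a - (\<Sum>s\<in>A. c s *s e s) \<in> U"
      using insert.hyps by (auto simp: algebra_simps)
  qed
  finally show ?case .
qed

lemma indep_mod_insert:
  assumes U: "subspace U" and A: "finite A" "a \<notin> A"
  shows "indep_mod U (insert a A) e \<longleftrightarrow> indep_mod U A e \<and> e a \<notin> span (U \<union> e ` A)"
proof (intro iffI conjI)
  assume I: "indep_mod U (insert a A) e"
  show "indep_mod U A e" unfolding indep_mod_def
  proof (intro allI impI ballI)
    fix c s assume c: "(\<Sum>s\<in>A. c s *s e s) \<in> U" and s: "s \<in> A"
    have "(\<Sum>s\<in>A. (c(a := 0)) s *s e s) = (\<Sum>s\<in>A. c s *s e s)" using A by (intro sum.cong) auto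
    then have "(\<Sum>s\<in>insert a A. (c(a := 0)) s *s e s) \<in> U" using c A by simp
    from indep_modD[OF I this, of s] show "c s = 0" using s A by (auto split: if_splits)
  qed
  show "e a \<notin> span (U \<union> e ` A)"
  proof
    assume "e a \<in> span (U \<union> e ` A)"
    then obtain c where c: "e a - (\<Sum>s\<in>A. c s *s e s) \<in> U" unfolding span_mod_iff[OF U A(1)] by auto
    have "(\<Sum>s\<in>A. ((\<lambda>s. - c s)(a := 1)) s *s e s) = - (\<Sum>s\<in>A. c s *s e s)"
      unfolding sum_negf[symmetric] using A by (intro sum.cong) auto
    then have "(\<Sum>s\<in>insert a A. ((\<lambda>s. - c s)(a := 1)) s *s e s) \<in> U" using c A by simp
    from indep_modD[OF I this, of a] show False by simp
  qed
next
  assume *: "indep_mod U A e \<and> e a \<notin> span (U \<union> e ` A)"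
  show "indep_mod U (insert a A) e" unfolding indep_mod_def
  proof (intro allI impI)
    fix c assume c: "(\<Sum>s\<in>insert a A. c s *s e s) \<in> U"
    have ca: "c a = 0"
    proof (rule ccontr)
      assume nz: "c a \<noteq> 0"
      have "inverse (c a) *s (\<Sum>s\<in>insert a A. c s *s e s)
        = e a - (\<Sum>s\<in>A. (- inverse (c a) * c s) *s e s)"
        using A nz by (simp add: scale_right_distrib scale_sum_right sum_negf)
      then have "e a - (\<Sum>s\<in>A. (- inverse (c a) * c s) *s e s) \<in> U" using subspace_scale[OF U c]
        by metis
      then have "\<exists>d. e a - (\<Sum>s\<in>A. d s *s e s) \<in> U" by (rule exI[of _ "\<lambda>s. - inverse (c a) * c s"])
      then show False using * span_mod_iff[OF U A(1)] by blast
    qed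
    then have "(\<Sum>s\<in>A. c s *s e s) \<in> U" using c A by simp
    then show "\<forall>s\<in>insert a A. c s = 0" using * ca indep_modD[of U A e c] by blast
  qed
qed

lemma dim_span_mod:
  assumes U: "subspace U" and A: "finite A"
  shows "indep_mod U A e \<Longrightarrow> dim (span (U \<union> e ` A)) = dim U + card A"
  using A
proof (induction A rule: finite_induct)
  case (insert a A)
  then have i: "indep_mod U A e" "e a \<notin> span (U \<union> e ` A)"
    using indep_mod_insert[OF U insert.hyps(1,2), of e] insert.prems by auto
  have "dim (insert (e a) (U \<union> e ` A)) = Suc (dim (U \<union> e ` A))" unfolding dim_insert using i(2)
    by simp
  then show ?case using insert i by simp
qed simp

lemma indep_mod_subset:
  assumes "indep_mod U A e" "B \<subseteq> A" "finite A"
  shows "indep_mod U B e"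
  unfolding indep_mod_def
proof (intro allI impI ballI)
  fix c s assume c: "(\<Sum>s\<in>B. c s *s e s) \<in> U" and s: "s \<in> B"
  let ?c = "\<lambda>s. if s \<in> B then c s else 0"
  have "(\<Sum>s\<in>A. ?c s *s e s) = (\<Sum>s\<in>B. ?c s *s e s)" using assms
    by (intro sum.mono_neutral_right) auto
  also have "\<dots> = (\<Sum>s\<in>B. c s *s e s)" by (intro sum.cong) auto
  finally have "(\<Sum>s\<in>A. ?c s *s e s) \<in> U" using c by simp
  from indep_modD[OF assms(1) this, of s] s assms show "c s = 0" by auto
qed

text \<open>Representatives in W of a Jordan basis of W / U.\<close>

definition sq_basis :: "'b set \<Rightarrow> 'b set \<Rightarrow> partition \<Rightarrow> (nat \<times> nat \<Rightarrow> 'b) \<Rightarrow> bool" where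
  "sq_basis U W lam e \<longleftrightarrow> (\<forall>s\<in>young_diagram lam. e s \<in> W) \<and> indep_mod U (young_diagram lam) e \<and>
     W \<subseteq> span (U \<union> e ` young_diagram lam) \<and>
     (\<forall>(i, j)\<in>young_diagram lam. eta (e (i, j)) - (if j = 0 then 0 else e (i, j - 1)) \<in> U)"

lemma sq_basis_pow:
  assumes b: "sq_basis U W lam e" and U: "stable U" and s: "(i, j) \<in> young_diagram lam"
  shows "(eta ^^ k) (e (i, j)) - (if k \<le> j then e (i, j - k) else 0) \<in> U"
proof (induction k)
  case 0
  then show ?case using subspace_0[OF stable_subspace[OF U]] by simp
next
  case (Suc k)
  have sU: "subspace U" using U stable_subspace by auto
  have 1: "eta ((eta ^^ k) (e (i, j)) - (if k \<le> j then e (i, j - k) else 0)) \<in> U"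
    using stable_eta[OF U Suc] .
  show ?case
  proof (cases "k \<le> j")
    case True
    then have "(i, j - k) \<in> young_diagram lam" using s unfolding young_diagram_def by auto
    then have "eta (e (i, j - k)) - (if j - k = 0 then 0 else e (i, j - k - 1)) \<in> U" using b
      unfolding sq_basis_def by auto
    from subspace_add[OF sU 1 this] show ?thesis using True
      by (auto simp: eta_diff split: if_splits)
  next
    case False
    then show ?thesis using 1 by simp
  qed
qed

lemma sq_basis_im:
  assumes b: "sq_basis U W lam e" and U: "stable U" and W: "stable W" "U \<subseteq> W"
    and lam: "is_partition lam"
  shows "im k W U = span (U \<union> e ` {(i, j). j + k < lam i})"
proof
  let ?Y = "young_diagram lam" and ?A = "{(i, j). j + k < lam i}"
  have sU: "subspace U" and sW: "subspace W" using U W stable_subspace by auto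
  have fin: "finite ?Y" using finite_young_diagram[OF lam] by simp
  show "span (U \<union> e ` ?A) \<subseteq> im k W U"
  proof (rule span_minimal[OF _ subspace_im[OF sW sU]], intro Un_least subsetI)
    show "x \<in> im k W U" if "x \<in> U" for x using that im_superset[OF sW] by blast
    fix x assume "x \<in> e ` ?A"
    then obtain i j where ij: "x = e (i, j)" "j + k < lam i" by auto
    then have Y: "(i, j + k) \<in> ?Y" unfolding young_diagram_def by simp
    have "(eta ^^ k) (e (i, j + k)) - e (i, j) \<in> U" using sq_basis_pow[OF b U Y, of k] by simp
    from subspace_neg[OF sU this] have "e (i, j) - (eta ^^ k) (e (i, j + k)) \<in> U" by simp
    then show "x \<in> im k W U" unfolding im_iff ij(1) using b Y unfolding sq_basis_def by blast
  qed
  show "im k W U \<subseteq> span (U \<union> e ` ?A)"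
  proof
    fix y assume "y \<in> im k W U"
    then obtain x where x: "x \<in> W" "y - (eta ^^ k) x \<in> U" unfolding im_iff by auto
    have inU: "z \<in> span (U \<union> e ` ?A)" if "z \<in> U" for z using that span_base by blast
    obtain c where c: "x - (\<Sum>s\<in>?Y. c s *s e s) \<in> U"
      using b x(1) span_mod_iff[OF sU fin] unfolding sq_basis_def by blast
    interpret L: Vector_Spaces.linear scale scale "eta ^^ k" by (rule linear_pow)
    have "(eta ^^ k) (x - (\<Sum>s\<in>?Y. c s *s e s)) \<in> U" using stable_pow[OF U c] .
    then have 1: "(eta ^^ k) x - (\<Sum>s\<in>?Y. c s *s (eta ^^ k) (e s)) \<in> U"
      by (simp add: L.diff L.sum L.scale)
    have "(eta ^^ k) (e s) \<in> span (U \<union> e ` ?A)" if s: "s \<in> ?Y" for s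
    proof -
      obtain i j where ij: "s = (i, j)" by (cases s)
      have p: "(eta ^^ k) (e (i, j)) - (if k \<le> j then e (i, j - k) else 0) \<in> U"
        using sq_basis_pow[OF b U] s ij by simp
      have "(if k \<le> j then e (i, j - k) else 0) \<in> span (U \<union> e ` ?A)"
      proof (cases "k \<le> j")
        case True
        then have "(i, j - k) \<in> ?A" using s ij unfolding young_diagram_def by simp
        then have "e (i, j - k) \<in> span (U \<union> e ` ?A)" by (intro span_base) blast
        then show ?thesis using True by simp
      qed (simp add: span_zero)
      from span_add[OF inU[OF p] this] show ?thesis using ij by simp
    qed
    then have 2: "(\<Sum>s\<in>?Y. c s *s (eta ^^ k) (e s)) \<in> span (U \<union> e ` ?A)"
      by (intro span_sum span_scale)
    have "y = (y - (eta ^^ k) x) + ((eta ^^ k) x - (\<Sum>s\<in>?Y. c s *s (eta ^^ k) (e s))) + (\<Sum>s\<in>?Y. c s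
      *s (eta ^^ k) (e s))"
      by simp
    then show "y \<in> span (U \<union> e ` ?A)" using span_add[OF span_add[OF inU[OF x(2)] inU[OF 1]] 2]
      by metis
  qed
qed

text \<open>The rank of \<open>eta ^^ k\<close> on W / U is the number of squares with at least k
  squares to their right in the row. Successive differences of these numbers are the column lengths,
  so the basis can have only one shape.\<close>

lemma sq_basis_unique:
  assumes b: "sq_basis U W lam e" and U: "stable U" and W: "stable W" "U \<subseteq> W"
    and lam: "is_partition lam"
  shows "lam = shape_of_cols (cols W U)"
proof -
  let ?Y = "young_diagram lam" and ?A = "\<lambda>k. {(i, j). j + k < lam i}"
  have sU: "subspace U" using U stable_subspace by auto
  have fin: "finite ?Y" using finite_young_diagram[OF lam] by simp
  have AY: "?A k \<subseteq> ?Y" for k unfolding young_diagram_def by auto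
  have fA: "finite (?A k)" for k using fin AY finite_subset by blast
  have "indep_mod U (?A k) e" for k using b AY fin indep_mod_subset unfolding sq_basis_def by blast
  then have r: "rank k W U = dim U + card (?A k)" for k
    unfolding rank_def sq_basis_im[OF b U W lam] using dim_span_mod[OF sU fA] by blast
  have "card (?A k) = card (?A (Suc k)) + colh ?Y k" for k
  proof -
    \<comment> \<open>The squares with exactly k squares to their right: one in each row longer than
      k, hence as many as column k has.\<close>
    let ?B = "(\<lambda>i. (i, lam i - Suc k)) ` {i. (i, k) \<in> ?Y}"
    have f: "finite {i. (i, k) \<in> ?Y}" by (rule finite_column[OF fin])
    have "?A k = ?A (Suc k) \<union> ?B"
    proof (intro equalityI subsetI)
      fix s assume s: "s \<in> ?A k"
      obtain i j where ij: "s = (i, j)" by (cases s)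
      show "s \<in> ?A (Suc k) \<union> ?B"
      proof (cases "j + Suc k < lam i")
        case False
        then have "j = lam i - Suc k" "(i, k) \<in> ?Y" using s ij unfolding young_diagram_def by auto
        then show ?thesis using ij by blast
      qed (use ij in auto)
    next
      fix s assume "s \<in> ?A (Suc k) \<union> ?B"
      then show "s \<in> ?A k" unfolding young_diagram_def by auto
    qed
    moreover have "?A (Suc k) \<inter> ?B = {}" by auto
    ultimately have "card (?A k) = card (?A (Suc k)) + card ?B"
      using card_Un_disjoint[OF fA[of "Suc k"] finite_imageI[OF f, of "\<lambda>i. (i, lam i - Suc k)"]]
        by simp
    moreover have "card ?B = colh ?Y k" unfolding colh_def by (intro card_image inj_onI) auto
    ultimately show ?thesis by simp
  qed
  then have "cols W U = colh ?Y" unfolding cols_def r by (simp add: fun_eq_iff)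
  then show ?thesis using shape_of_colh_young[OF lam] by simp
qed

lemma extend_indep_mod:
  assumes U: "subspace U" and K: "subspace K" "U \<subseteq> K"
    and v: "indep_mod U {..<r} v" "\<And>i. i < r \<Longrightarrow> v i \<in> K"
  shows "\<exists>t v'. r \<le> t \<and> (\<forall>i<r. v' i = v i) \<and> (\<forall>i<t. v' i \<in> K) \<and> indep_mod U {..<t} v' \<and> K
    \<subseteq> span (U \<union> v' ` {..<(t::nat)})"
  using v
proof (induction "dim K - dim (span (U \<union> v ` {..<r}))" arbitrary: r v rule: less_induct)
  case less
  let ?S = "span (U \<union> v ` {..<r})"
  have SK: "?S \<subseteq> K" using K less.prems(2) by (intro span_minimal) auto
  show ?case
  proof (cases "K \<subseteq> ?S")
    case True
    then show ?thesis using less.prems by (intro exI[of _ r] exI[of _ v]) auto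
  next
    case False
    then obtain x where x: "x \<in> K" "x \<notin> ?S" by auto
    define v1 where "v1 = v(r := x)"
    have im: "v1 ` {..<r} = v ` {..<r}" unfolding v1_def by auto
    have "indep_mod U {..<r} v1" using less.prems(1) unfolding indep_mod_def v1_def by auto
    then have i1: "indep_mod U {..<Suc r} v1"
      using indep_mod_insert[OF U, of "{..<r}" r v1] x im unfolding lessThan_Suc
        by (simp add: v1_def)
    have K1: "v1 i \<in> K" if "i < Suc r" for i using that less.prems(2) x unfolding v1_def
      by (auto simp: less_Suc_eq)
    have e: "U \<union> v1 ` {..<Suc r} = insert x (U \<union> v ` {..<r})" unfolding lessThan_Suc image_insert im
      by (simp add: v1_def)
    have "dim (span (U \<union> v1 ` {..<Suc r})) = Suc (dim ?S)" unfolding e dim_span dim_insert using x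
      by simp
    moreover have "dim (span (U \<union> v1 ` {..<Suc r})) \<le> dim K"
      using K K1 by (intro dim_subset span_minimal) auto
    ultimately have "dim K - dim (span (U \<union> v1 ` {..<Suc r})) < dim K - dim ?S" by linarith
    from less.hyps[OF this i1 K1] obtain t v'
      where t: "Suc r \<le> t" "\<forall>i<Suc r. v' i = v1 i" "\<forall>i<t. v' i \<in> K"
      "indep_mod U {..<t} v'" "K \<subseteq> span (U \<union> v' ` {..<t})" by blast
    moreover have "\<forall>i<r. v' i = v i" using t(2) unfolding v1_def by auto
    ultimately show ?thesis by (intro exI[of _ t] exI[of _ v']) auto
  qed
qed

text \<open>A Jordan basis of \<open>eta W + U\<close> is lifted along \<open>eta\<close> and completed by vectors of the kernel.\<close>

lemma sq_basis_exists:
  assumes U: "stable U" and "stable W" "U \<subseteq> W"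
  shows "\<exists>lam e. is_partition lam \<and> sq_basis U W lam e"
  using assms(2,3)
proof (induction "dim W" arbitrary: W rule: less_induct)
  case less
  note W = less.prems
  have sU: "subspace U" and sW: "subspace W" using U W stable_subspace by auto
  show ?case
  proof (cases "W = U")
    case True
    have "young_diagram (\<lambda>_. 0) = {}" unfolding young_diagram_def by auto
    then have "sq_basis U W (\<lambda>_. 0) (\<lambda>_. 0)"
      unfolding sq_basis_def using True span_superset by (auto simp: indep_mod_def)
    then show ?thesis by (intro exI[of _ "\<lambda>_. 0"]) (auto simp: is_partition_def antimono_def)
  next
    case False
    define W1 where "W1 = im 1 W U"
    have W1W: "W1 \<subseteq> W" unfolding W1_def by (rule im_subset[OF W])
    have UW1: "U \<subseteq> W1" unfolding W1_def by (rule im_superset[OF sW])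
    have sW1: "subspace W1" unfolding W1_def by (rule subspace_im[OF sW sU])
    have etaW1: "eta x \<in> W1" if "x \<in> W" for x unfolding W1_def using pow_in_im[OF sU that, of 1]
      by simp
    have st1: "stable W1" unfolding stable_def using sW1 etaW1 W1W by auto
    \<comment> \<open>Equality would propagate to \<open>im k W U = W\<close> for all k, against
      nilpotency.\<close>
    have "W1 \<noteq> W"
    proof
      assume eq: "W1 = W"
      have "im k W U = W" for k
      proof (induction k)
        case 0 then show ?case using im_0[OF sW W(2) sU] .
      next
        case (Suc k)
        have "W \<subseteq> im (Suc k) W U"
        proof
          fix x assume "x \<in> W"
          then obtain y where y: "y \<in> W" "x - (eta ^^ k) y \<in> U" using Suc im_iff by blast
          then obtain z where z: "z \<in> W" "y - eta z \<in> U" using eq unfolding W1_def set_eq_iff im_iff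
            by auto
          have "(x - (eta ^^ k) y) + (eta ^^ k) (y - eta z) \<in> U"
            using subspace_add[OF sU y(2) stable_pow[OF U z(2)]] .
          then have "x - (eta ^^ Suc k) z \<in> U" by (simp add: pow_diff pow_eta)
          then show "x \<in> im (Suc k) W U" unfolding im_iff using z(1) by blast
        qed
        then show ?case using im_subset[OF W] by blast
      qed
      then show False using im_N[OF sW] False by metis
    qed
    then have "dim W1 < dim W" using dim_psubset[of W1 W] W1W sW sW1
      by (auto simp: span_of_subspace)
    from less.hyps[OF this st1 UW1] obtain lam1 e1 where
      lam1: "is_partition lam1" and b1: "sq_basis U W1 lam1 e1" by auto
    let ?Y1 = "young_diagram lam1"
    have fin1: "finite ?Y1" using finite_young_diagram[OF lam1] by simp
    have e1W: "e1 s \<in> W1" if "s \<in> ?Y1" for s using b1 that unfolding sq_basis_def by auto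
    have ind1: "indep_mod U ?Y1 e1" using b1 unfolding sq_basis_def by auto
    have sh1: "eta (e1 (i, j)) - (if j = 0 then 0 else e1 (i, j - 1)) \<in> U" if "(i, j) \<in> ?Y1" for i j
      using b1 that unfolding sq_basis_def by auto
    define r where "r = young_rows lam1"
    have rr: "lam1 i \<noteq> 0 \<longleftrightarrow> i < r" for i unfolding r_def by (rule partition_rows[OF lam1])
    define K where "K = {x \<in> W. eta x \<in> U}"
    have K: "subspace K" "U \<subseteq> K"
      unfolding K_def using W(2) stable_eta[OF U] subspace_0[OF sU]
      by (auto intro!: subspaceI simp: eta_add eta_scale eta_zero subspace_0[OF sW] subspace_add[OF
        sW]
          subspace_scale[OF sW] subspace_add[OF sU] subspace_scale[OF sU])
    have in1: "(i, 0) \<in> ?Y1" if "i < r" for i using that rr unfolding young_diagram_def by auto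
    have v0: "indep_mod U {..<r} (\<lambda>i. e1 (i, 0))"
    proof -
      have I: "indep_mod U ((\<lambda>i. (i, 0)) ` {..<r}) e1"
        using in1 by (intro indep_mod_subset[OF ind1 _ fin1]) auto
      show ?thesis unfolding indep_mod_def
      proof (intro allI impI ballI)
        fix c s assume c: "(\<Sum>s\<in>{..<r}. c s *s e1 (s, 0)) \<in> U" and s: "s \<in> {..<r}"
        have "inj_on (\<lambda>i::nat. (i, 0::nat)) {..<r}" by (auto intro: inj_onI)
        then have "(\<Sum>s\<in>(\<lambda>i. (i, 0)) ` {..<r}. (c \<circ> fst) s *s e1 s) \<in> U" using c
          by (simp add: sum.reindex)
        from indep_modD[OF I this, of "(s, 0)"] show "c s = 0" using s by auto
      qed
    qed
    have vK: "e1 (i, 0) \<in> K" if "i < r" for i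
      using sh1[OF in1[OF that]] e1W[OF in1[OF that]] W1W unfolding K_def by auto
    obtain t v where t: "r \<le> t" "\<And>i. i < r \<Longrightarrow> v i = e1 (i, 0)" "\<And>i. i < t \<Longrightarrow> v i \<in> K"
      "indep_mod U {..<t} v" "K \<subseteq> span (U \<union> v ` {..<t})"
      using extend_indep_mod[OF sU K v0 vK] by metis
    have "\<exists>y\<in>W. eta y - e1 (i, lam1 i - 1) \<in> U" if "i < r" for i
    proof -
      have "(i, lam1 i - 1) \<in> ?Y1" using that rr[of i] unfolding young_diagram_def by auto
      then have "e1 (i, lam1 i - 1) \<in> im 1 W U" using e1W W1_def by auto
      then obtain y where "y \<in> W" "e1 (i, lam1 i - 1) - eta y \<in> U" unfolding im_iff by auto
      then show ?thesis using subspace_neg[OF sU] by (metis minus_diff_eq)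
    qed
    then obtain y where y: "\<And>i. i < r \<Longrightarrow> y i \<in> W \<and> eta (y i) - e1 (i, lam1 i - 1) \<in> U" by metis
    \<comment> \<open>Each of the r rows of \<open>lam1\<close> becomes one square longer, the new
      last vector being the lift \<open>y i\<close> of its old last one. The kernel vectors
      \<open>v i\<close> with r \<le> i < t form new rows of length 1.\<close>
    define lam where "lam i = (if i < t then Suc (lam1 i) else 0)" for i
    define e where "e = (\<lambda>(i, j). if j < lam1 i then e1 (i, j) else if i < r then y i else v i)"
    let ?Y = "young_diagram lam"
    have an1: "antimono lam1" using lam1 unfolding is_partition_def by auto
    have lam: "is_partition lam" unfolding is_partition_def
    proof
      show "antimono lam"
      proof (rule antimonoI)
        fix i i' :: nat assume "i \<le> i'"
        then show "lam i' \<le> lam i" using antimonoD[OF an1, of i i'] unfolding lam_def by auto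
      qed
      have "{i. lam i \<noteq> 0} \<subseteq> {..<t}" unfolding lam_def by auto
      then show "finite {i. lam i \<noteq> 0}" using finite_subset by blast
    qed
    have fin: "finite ?Y" using finite_young_diagram[OF lam] by simp
    have Y_iff: "(i, j) \<in> ?Y \<longleftrightarrow> i < t \<and> j \<le> lam1 i" for i j unfolding young_diagram_def lam_def
      by auto
    have Y1_iff: "(i, j) \<in> ?Y1 \<longleftrightarrow> i < r \<and> j < lam1 i" for i j unfolding young_diagram_def
      using rr[of i] by auto
    have lam10: "lam1 i = 0" if "\<not> i < r" for i using rr that by auto
    have eW: "e s \<in> W" if s: "s \<in> ?Y" for s
    proof -
      obtain i j where ij: "s = (i, j)" by (cases s)
      consider "j < lam1 i" | "\<not> j < lam1 i" "i < r" | "\<not> j < lam1 i" "\<not> i < r" by blast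
      then show ?thesis
      proof cases
        case 1
        then have "(i, j) \<in> ?Y1" unfolding young_diagram_def by simp
        then show ?thesis using e1W W1W 1 ij by (auto simp: e_def)
      next
        case 2
        then show ?thesis using y ij by (auto simp: e_def)
      next
        case 3
        then have "v i \<in> K" using t(3) s ij Y_iff by auto
        then show ?thesis using 3 ij by (auto simp: e_def K_def)
      qed
    qed
    have e0: "e (i, 0) = v i" if "i < t" for i using t(2)[of i] lam10[of i] rr[of i]
      by (auto simp: e_def)
    have sh0: "eta (e (i, 0)) \<in> U" if "i < t" for i using e0[OF that] t(3)[OF that] unfolding K_def
      by auto
    have shS: "eta (e (i, Suc j)) - e1 (i, j) \<in> U" if "(i, j) \<in> ?Y1" for i j
    proof (cases "Suc j < lam1 i")
      case True
      then have "(i, Suc j) \<in> ?Y1" unfolding young_diagram_def by simp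
      from sh1[OF this] show ?thesis using True by (simp add: e_def)
    next
      case False
      then have "j = lam1 i - 1" "i < r" using that Y1_iff by auto
      then show ?thesis using y[of i] False by (auto simp: e_def)
    qed
    \<comment> \<open>Modulo U, \<open>eta\<close> kills the first sum and carries the second to a
      combination of the basis \<open>e1\<close>, so independence can be checked for the two parts
      in turn.\<close>
    have split: "(\<Sum>s\<in>?Y. c s *s e s)
      = (\<Sum>i<t. c (i, 0) *s v i) + (\<Sum>(i, j)\<in>?Y1. c (i, Suc j) *s e (i, Suc j))" for c
    proof -
      have Yd: "?Y = (\<lambda>i. (i, 0)) ` {..<t} \<union> (\<lambda>(i, j). (i, Suc j)) ` ?Y1"
      proof (intro equalityI subsetI)
        fix s assume s: "s \<in> ?Y"
        obtain i j where ij: "s = (i, j)" by (cases s)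
        show "s \<in> (\<lambda>i. (i, 0)) ` {..<t} \<union> (\<lambda>(i, j). (i, Suc j)) ` ?Y1"
        proof (cases j)
          case 0
          then show ?thesis using s ij Y_iff by auto
        next
          case (Suc j')
          then have "(i, j') \<in> ?Y1" using s ij Y_iff unfolding young_diagram_def by auto
          then show ?thesis using ij Suc by (intro UnI2 image_eqI[of _ _ "(i, j')"]) auto
        qed
      next
        fix s assume "s \<in> (\<lambda>i. (i, 0)) ` {..<t} \<union> (\<lambda>(i, j). (i, Suc j)) ` ?Y1"
        then show "s \<in> ?Y" using Y_iff Y1_iff t(1) by auto
      qed
      have i1: "inj_on (\<lambda>i::nat. (i, 0::nat)) {..<t}" and i2: "inj_on (\<lambda>(i, j). (i, Suc j)) ?Y1"
        by (auto intro!: inj_onI)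
      have dj: "(\<lambda>i. (i, 0)) ` {..<t} \<inter> (\<lambda>(i, j). (i, Suc j)) ` ?Y1 = {}" by auto
      have "(\<Sum>s\<in>?Y. c s *s e s)
        = (\<Sum>s\<in>(\<lambda>i. (i, 0)) ` {..<t}. c s *s e s) + (\<Sum>s\<in>(\<lambda>(i, j). (i, Suc j)) ` ?Y1. c s *s e s)"
        unfolding Yd by (rule sum.union_disjoint) (use fin1 dj in auto)
      also have "(\<Sum>s\<in>(\<lambda>i. (i, 0)) ` {..<t}. c s *s e s) = (\<Sum>i<t. c (i, 0) *s v i)"
        unfolding sum.reindex[OF i1] by (intro sum.cong) (auto simp: e0)
      also have "(\<Sum>s\<in>(\<lambda>(i, j). (i, Suc j)) ` ?Y1. c s *s e s)
        = (\<Sum>(i, j)\<in>?Y1. c (i, Suc j) *s e (i, Suc j))"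
        unfolding sum.reindex[OF i2] by (intro sum.cong) auto
      finally show ?thesis .
    qed
    interpret L: Vector_Spaces.linear scale scale eta by (rule linear_eta)
    have etasum: "eta (\<Sum>(i, j)\<in>?Y1. c (i, j) *s e (i, Suc j)) - (\<Sum>s\<in>?Y1. c s *s e1 s) \<in> U" for c
    proof -
      have "eta (\<Sum>(i, j)\<in>?Y1. c (i, j) *s e (i, Suc j)) - (\<Sum>s\<in>?Y1. c s *s e1 s) =
        (\<Sum>(i, j)\<in>?Y1. c (i, j) *s (eta (e (i, Suc j)) - e1 (i, j)))"
        by (simp add: L.sum case_prod_unfold L.scale scale_right_diff_distrib sum_subtractf)
      also have "\<dots> \<in> U" using shS
        by (intro subspace_sum[OF sU]) (auto intro!: subspace_scale[OF sU])
      finally show ?thesis .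
    qed
    have span: "W \<subseteq> span (U \<union> e ` ?Y)"
    proof
      fix x assume x: "x \<in> W"
      obtain c where c: "eta x - (\<Sum>s\<in>?Y1. c s *s e1 s) \<in> U"
        using b1 etaW1[OF x] span_mod_iff[OF sU fin1] unfolding sq_basis_def by blast
      define z where "z = (\<Sum>(i, j)\<in>?Y1. c (i, j) *s e (i, Suc j))"
      have SY: "(i, Suc j) \<in> ?Y" if "(i, j) \<in> ?Y1" for i j using that Y_iff Y1_iff t(1) by auto
      have zW: "z \<in> W" unfolding z_def using eW SY
        by (intro subspace_sum[OF sW]) (auto intro!: subspace_scale[OF sW])
      have "(eta x - (\<Sum>s\<in>?Y1. c s *s e1 s)) - (eta z - (\<Sum>s\<in>?Y1. c s *s e1 s)) \<in> U"
        using subspace_diff[OF sU c etasum[of c]] unfolding z_def .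
      then have "x - z \<in> K" unfolding K_def using x zW
        by (auto simp: eta_diff intro: subspace_diff[OF sW])
      then have "x - z \<in> span (U \<union> v ` {..<t})" using t(5) by auto
      moreover have "U \<union> v ` {..<t} \<subseteq> U \<union> e ` ?Y"
      proof -
        have "v i \<in> e ` ?Y" if "i < t" for i using e0[OF that] Y_iff that
          by (metis image_eqI zero_le)
        then show ?thesis by auto
      qed
      ultimately have "x - z \<in> span (U \<union> e ` ?Y)" using span_mono by blast
      moreover have "c (i, j) *s e (i, Suc j) \<in> span (U \<union> e ` ?Y)" if "(i, j) \<in> ?Y1" for i j
        by (intro span_scale span_base UnI2 imageI SY that)
      then have "z \<in> span (U \<union> e ` ?Y)" unfolding z_def by (intro span_sum) auto
      ultimately have "(x - z) + z \<in> span (U \<union> e ` ?Y)" by (rule span_add)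
      then show "x \<in> span (U \<union> e ` ?Y)" by simp
    qed
    have ind: "indep_mod U ?Y e" unfolding indep_mod_def
    proof (intro allI impI)
      fix c assume c: "(\<Sum>s\<in>?Y. c s *s e s) \<in> U"
      let ?c = "\<lambda>(i, j). c (i, Suc j)"
      have "eta (\<Sum>s\<in>?Y. c s *s e s) \<in> U" using stable_eta[OF U c] .
      moreover have "eta (\<Sum>i<t. c (i, 0) *s v i) \<in> U"
        unfolding L.sum L.scale using t(3) unfolding K_def
          by (intro subspace_sum[OF sU] subspace_scale[OF sU]) auto
      ultimately have "eta (\<Sum>s\<in>?Y. c s *s e s) - eta (\<Sum>i<t. c (i, 0) *s v i) \<in> U"
        by (rule subspace_diff[OF sU])
      then have 1: "eta (\<Sum>(i, j)\<in>?Y1. ?c (i, j) *s e (i, Suc j)) \<in> U" unfolding split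
        by (simp add: L.add)
      from subspace_diff[OF sU 1 etasum[of ?c]] have "(\<Sum>s\<in>?Y1. ?c s *s e1 s) \<in> U" by simp
      then have z: "?c s = 0" if "s \<in> ?Y1" for s using indep_modD[OF ind1] that by blast
      then have "(\<Sum>(i, j)\<in>?Y1. c (i, Suc j) *s e (i, Suc j)) = 0" by (intro sum.neutral) auto
      then have "(\<Sum>i<t. c (i, 0) *s v i) \<in> U" using c unfolding split by simp
      then have z0: "c (i, 0) = 0" if "i < t" for i
        using indep_modD[OF t(4), of "\<lambda>i. c (i, 0)"] that by blast
      show "\<forall>s\<in>?Y. c s = 0"
      proof
        fix s assume s: "s \<in> ?Y"
        obtain i j where ij: "s = (i, j)" by (cases s)
        show "c s = 0"
        proof (cases j)
          case 0
          then show ?thesis using z0 s ij Y_iff by auto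
        next
          case (Suc j')
          then have "(i, j') \<in> ?Y1" using s ij Y_iff unfolding young_diagram_def by auto
          from z[OF this] show ?thesis using ij Suc by simp
        qed
      qed
    qed
    have sh: "eta (e (i, j)) - (if j = 0 then 0 else e (i, j - 1)) \<in> U" if s: "(i, j) \<in> ?Y" for i j
    proof (cases j)
      case 0
      then show ?thesis using sh0 s Y_iff by auto
    next
      case (Suc j')
      then have "(i, j') \<in> ?Y1" "j' < lam1 i" using s Y_iff unfolding young_diagram_def by auto
      then show ?thesis using shS[of i j'] Suc by (auto simp: e_def)
    qed
    have "\<forall>(i, j)\<in>?Y. eta (e (i, j)) - (if j = 0 then 0 else e (i, j - 1)) \<in> U" using sh by blast
    then have "sq_basis U W lam e" unfolding sq_basis_def using eW ind span by blast
    then show ?thesis using lam by blast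
  qed
qed

text \<open>Covers both subspaces, with \<open>\<pi>\<close> the identity, and quotients, with \<open>\<pi>\<close> the coset map.\<close>

definition presents :: "('a, 'v) module \<Rightarrow> ('v \<Rightarrow> 'v) \<Rightarrow> ('b \<Rightarrow> 'v) \<Rightarrow> 'b set \<Rightarrow> 'b set \<Rightarrow> bool" where
  "presents M xi \<pi> U W \<longleftrightarrow> carrier M = \<pi> ` W \<and> \<zero>\<^bsub>M\<^esub> = \<pi> 0 \<and>
     (\<forall>x\<in>W. \<forall>y\<in>W. \<pi> x \<oplus>\<^bsub>M\<^esub> \<pi> y = \<pi> (x + y)) \<and> (\<forall>c. \<forall>x\<in>W. c \<odot>\<^bsub>M\<^esub> \<pi> x = \<pi> (c *s x)) \<and>
     (\<forall>x\<in>W. \<forall>y\<in>W. \<pi> x = \<pi> y \<longleftrightarrow> x - y \<in> U) \<and> (\<forall>x\<in>W. xi (\<pi> x) = \<pi> (eta x))"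

context
  fixes M :: "('a, 'v) module" and xi :: "'v \<Rightarrow> 'v" and \<pi> :: "'b \<Rightarrow> 'v" and U W :: "'b set"
  assumes pr: "presents M xi \<pi> U W" and U: "stable U" and W: "stable W" "U \<subseteq> W"
begin

lemma presentsD:
  "carrier M = \<pi> ` W" "\<zero>\<^bsub>M\<^esub> = \<pi> 0" "x \<in> W \<Longrightarrow> y \<in> W \<Longrightarrow> \<pi> x \<oplus>\<^bsub>M\<^esub> \<pi> y = \<pi> (x + y)"
  "x \<in> W \<Longrightarrow> c \<odot>\<^bsub>M\<^esub> \<pi> x = \<pi> (c *s x)" "x \<in> W \<Longrightarrow> y \<in> W \<Longrightarrow> \<pi> x = \<pi> y \<longleftrightarrow> x - y \<in> U"
  "x \<in> W \<Longrightarrow> xi (\<pi> x) = \<pi> (eta x)"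
  using pr unfolding presents_def by blast+

lemma presents_monoid: "abelian_monoid M"
proof (rule abelian_monoidI)
  have sW: "subspace W" using W stable_subspace by auto
  show "\<zero>\<^bsub>M\<^esub> \<in> carrier M" using presentsD(1,2) subspace_0[OF sW] by auto
  fix x y z assume "x \<in> carrier M" "y \<in> carrier M" "z \<in> carrier M"
  then obtain a b c where abc: "x = \<pi> a" "y = \<pi> b" "z = \<pi> c" "a \<in> W" "b \<in> W" "c \<in> W"
    using presentsD(1) by auto
  then have ab: "a + b \<in> W" "b + c \<in> W" using subspace_add[OF sW] by auto
  show "x \<oplus>\<^bsub>M\<^esub> y \<in> carrier M" using abc ab presentsD(1,3) by auto
  show "x \<oplus>\<^bsub>M\<^esub> y \<oplus>\<^bsub>M\<^esub> z = x \<oplus>\<^bsub>M\<^esub> (y \<oplus>\<^bsub>M\<^esub> z)" using abc ab presentsD(3) by (simp add: add.assoc)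
  show "x \<oplus>\<^bsub>M\<^esub> y = y \<oplus>\<^bsub>M\<^esub> x" using abc presentsD(3) by (simp add: add.commute)
  show "\<zero>\<^bsub>M\<^esub> \<oplus>\<^bsub>M\<^esub> x = x" using abc presentsD(2,3) subspace_0[OF sW] by simp
qed

lemma presents_finsum:
  assumes "finite A" "\<And>s. s \<in> A \<Longrightarrow> h s \<in> W" "\<And>s. s \<in> A \<Longrightarrow> g s = \<pi> (h s)"
  shows "finsum M g A = \<pi> (sum h A)"
  using assms
proof (induction A rule: finite_induct)
  interpret abelian_monoid M by (rule presents_monoid)
  case empty
  then show ?case using presentsD(2) by simp
next
  interpret abelian_monoid M by (rule presents_monoid)
  case (insert a A)
  have sW: "subspace W" using W stable_subspace by auto
  have c: "g \<in> A \<rightarrow> carrier M" "g a \<in> carrier M" using insert.prems presentsD(1) by auto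
  have "sum h A \<in> W" using insert.prems by (intro subspace_sum[OF sW]) auto
  moreover have "finsum M g (insert a A) = g a \<oplus>\<^bsub>M\<^esub> finsum M g A" using insert.hyps c
    by (intro finsum_insert) auto
  ultimately show ?case using insert presentsD(3)[of "h a" "sum h A"] by simp
qed

lemma jordan_basis_iff:
  assumes lam: "is_partition lam" and e: "\<And>s. s \<in> young_diagram lam \<Longrightarrow> e s \<in> W \<and> e' s = \<pi> (e s)"
  shows "jordan_basis M xi lam e' \<longleftrightarrow> sq_basis U W lam e"
proof -
  let ?Y = "young_diagram lam"
  have sU: "subspace U" and sW: "subspace W" using U W stable_subspace by auto
  have fin: "finite ?Y" using finite_young_diagram[OF lam] by simp
  have eW: "e s \<in> W" if "s \<in> ?Y" for s using e that by auto
  have sumW: "(\<Sum>s\<in>?Y. c s *s e s) \<in> W" for c using eW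
    by (intro subspace_sum[OF sW] subspace_scale[OF sW])
  have fs: "(\<Oplus>\<^bsub>M\<^esub>s\<in>?Y. c s \<odot>\<^bsub>M\<^esub> e' s) = \<pi> (\<Sum>s\<in>?Y. c s *s e s)" for c
    using e presentsD(4) by (intro presents_finsum[OF fin]) (auto intro!: subspace_scale[OF sW])
  have rep: "(\<forall>x\<in>carrier M. \<exists>!c. c \<in> extensional ?Y \<and> x = (\<Oplus>\<^bsub>M\<^esub>s\<in>?Y. c s \<odot>\<^bsub>M\<^esub> e' s)) \<longleftrightarrow>
     (\<forall>x\<in>W. \<exists>!c. c \<in> extensional ?Y \<and> x - (\<Sum>s\<in>?Y. c s *s e s) \<in> U)"
    unfolding fs presentsD(1) using presentsD(5)[OF _ sumW] by simp
  have A: "(\<forall>x\<in>W. \<exists>!c. c \<in> extensional ?Y \<and> x - (\<Sum>s\<in>?Y. c s *s e s) \<in> U) \<longleftrightarrow>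
     indep_mod U ?Y e \<and> W \<subseteq> span (U \<union> e ` ?Y)" (is "?L \<longleftrightarrow> ?R")
  proof
    assume L: ?L
    have "indep_mod U ?Y e" unfolding indep_mod_def
    proof (intro allI impI ballI)
      fix c s assume c: "(\<Sum>s\<in>?Y. c s *s e s) \<in> U" and s: "s \<in> ?Y"
      let ?c = "restrict c ?Y" and ?z = "\<lambda>s\<in>?Y. 0 :: 'a"
      have "(\<Sum>s\<in>?Y. ?c s *s e s) = (\<Sum>s\<in>?Y. c s *s e s)" by (intro sum.cong) auto
      then have "0 - (\<Sum>s\<in>?Y. ?c s *s e s) \<in> U" using subspace_neg[OF sU c] by simp
      moreover have "0 - (\<Sum>s\<in>?Y. ?z s *s e s) \<in> U" using subspace_0[OF sU] by simp
      moreover have "?c \<in> extensional ?Y" "?z \<in> extensional ?Y" by auto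
      ultimately have "?c = ?z" using bspec[OF L subspace_0[OF sW]] by blast
      from fun_cong[OF this, of s] show "c s = 0" using s by simp
    qed
    moreover have "W \<subseteq> span (U \<union> e ` ?Y)" using L unfolding subset_iff span_mod_iff[OF sU fin]
      by blast
    ultimately show ?R by simp
  next
    assume R: ?R
    show ?L
    proof
      fix x assume "x \<in> W"
      then obtain c where c: "x - (\<Sum>s\<in>?Y. c s *s e s) \<in> U" using R span_mod_iff[OF sU fin] by blast
      show "\<exists>!c. c \<in> extensional ?Y \<and> x - (\<Sum>s\<in>?Y. c s *s e s) \<in> U"
      proof (rule ex1I[of _ "restrict c ?Y"])
        have "(\<Sum>s\<in>?Y. restrict c ?Y s *s e s) = (\<Sum>s\<in>?Y. c s *s e s)" by (intro sum.cong) auto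
        then show "restrict c ?Y \<in> extensional ?Y \<and> x - (\<Sum>s\<in>?Y. restrict c ?Y s *s e s) \<in> U" using c
          by simp
        fix d assume d: "d \<in> extensional ?Y \<and> x - (\<Sum>s\<in>?Y. d s *s e s) \<in> U"
        then have "(x - (\<Sum>s\<in>?Y. c s *s e s)) - (x - (\<Sum>s\<in>?Y. d s *s e s)) \<in> U"
          using c subspace_diff[OF sU] by blast
        then have "(\<Sum>s\<in>?Y. (d s - c s) *s e s) \<in> U"
          by (simp add: scale_left_diff_distrib sum_subtractf)
        then have "d s = c s" if "s \<in> ?Y" for s using R indep_modD[of U ?Y e "\<lambda>s. d s - c s" s] that
          by auto
        then show "d = restrict c ?Y" using d by (intro extensionalityI[of _ ?Y]) auto
      qed
    qed
  qed
  have B: "(\<forall>(i, j)\<in>?Y. xi (e' (i, j)) = (if j = 0 then \<zero>\<^bsub>M\<^esub> else e' (i, j - 1))) \<longleftrightarrow>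
      (\<forall>(i, j)\<in>?Y. eta (e (i, j)) - (if j = 0 then 0 else e (i, j - 1)) \<in> U)"
  proof -
    have "xi (e' (i, j)) = (if j = 0 then \<zero>\<^bsub>M\<^esub> else e' (i, j - 1)) \<longleftrightarrow>
      eta (e (i, j)) - (if j = 0 then 0 else e (i, j - 1)) \<in> U" if ij: "(i, j) \<in> ?Y" for i j
    proof -
      have "(i, j - 1) \<in> ?Y" using ij unfolding young_diagram_def by auto
      then have r: "(if j = 0 then \<zero>\<^bsub>M\<^esub> else e' (i, j - 1)) = \<pi> (if j = 0 then 0 else e (i, j - 1))"
        "(if j = 0 then 0 else e (i, j - 1)) \<in> W" using e presentsD(2) subspace_0[OF sW] by auto
      show ?thesis unfolding r(1)
        using e[OF ij] presentsD(6) presentsD(5)[OF stable_eta[OF W(1)] r(2)] by auto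
    qed
    then show ?thesis by blast
  qed
  have C: "e' ` ?Y \<subseteq> carrier M" using e presentsD(1) by auto
  show ?thesis unfolding jordan_basis_def sq_basis_def rep A B using C eW by simp
qed

text \<open>Any Jordan basis of M lifts to a \<open>sq_basis\<close> by choosing representatives, so
  \<open>sq_basis_unique\<close> makes the description in \<open>jordan_type\<close>
  unambiguous.\<close>

lemma jordan_type_eq:
  "jordan_type M xi = shape_of_cols (cols W U)" "is_partition (shape_of_cols (cols W U))"
proof -
  obtain lam e where le: "is_partition lam" "sq_basis U W lam e" using sq_basis_exists[OF U W]
    by auto
  have lam: "lam = shape_of_cols (cols W U)" using sq_basis_unique[OF le(2) U W le(1)] .
  then show "is_partition (shape_of_cols (cols W U))" using le by simp
  have ex: "jordan_basis M xi lam (\<lambda>s. \<pi> (e s))"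
    using jordan_basis_iff[OF le(1), of e] le(2) unfolding sq_basis_def by auto
  have uniq: "lam' = lam" if l: "is_partition lam'" "jordan_basis M xi lam' e'" for lam' e'
  proof -
    have "\<forall>s\<in>young_diagram lam'. \<exists>x\<in>W. e' s = \<pi> x" using l(2) presentsD(1)
      unfolding jordan_basis_def by auto
    then obtain f where f: "\<And>s. s \<in> young_diagram lam' \<Longrightarrow> f s \<in> W \<and> e' s = \<pi> (f s)" by metis
    then have "jordan_basis M xi lam' e' \<longleftrightarrow> sq_basis U W lam' f" by (rule jordan_basis_iff[OF l(1)])
    then have "sq_basis U W lam' f" using l(2) by blast
    then show ?thesis using sq_basis_unique[OF _ U W l(1)] lam by simp
  qed
  have "jordan_type M xi = lam" unfolding jordan_type_def
  proof (rule the_equality)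
    show "is_partition lam \<and> (\<exists>e. jordan_basis M xi lam e)" using le(1) ex by blast
    fix lam' assume "is_partition lam' \<and> (\<exists>e. jordan_basis M xi lam' e)"
    then show "lam' = lam" using uniq by blast
  qed
  then show "jordan_type M xi = shape_of_cols (cols W U)" using lam by simp
qed

end

section \<open>Subspaces and quotients of the ambient space as modules\<close>

lemma presents_total: "presents ((total_space scale)\<lparr>carrier := W\<rparr>) eta (\<lambda>x. x) {0} W"
  unfolding presents_def total_space_def by auto

abbreviation coset_of :: "'b set \<Rightarrow> 'b \<Rightarrow> 'b set" where
  "coset_of U x \<equiv> U +>\<^bsub>total_space scale\<^esub> x"

lemma quotient_coset: "coset_of U x = {u + x |u. u \<in> U}"
  unfolding a_r_coset_def r_coset_def total_space_def by auto

lemma presents_quotient: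
  assumes U: "stable U"
  shows "presents ((quotient_space (total_space scale) U)\<lparr>carrier := (\<lambda>x. coset_of U x) ` W\<rparr>)
    (quotient_map_of (total_space scale) U eta) (\<lambda>x. coset_of U x) U W"
proof -
  have sU: "subspace U" using U stable_subspace by auto
  have eq: "coset_of U x = coset_of U y \<longleftrightarrow> x - y \<in> U" for x y
  proof
    assume "coset_of U x = coset_of U y"
    then have "0 + x \<in> {u + y |u. u \<in> U}" unfolding quotient_coset using subspace_0[OF sU] by blast
    then show "x - y \<in> U" by auto
  next
    assume d: "x - y \<in> U"
    have "\<exists>u'. z = u' + y \<and> u' \<in> U" if "z = u + x" "u \<in> U" for z u
      using subspace_add[OF sU that(2) d] that(1) by (intro exI[of _ "u + (x - y)"]) auto
    moreover have "\<exists>u'. z = u' + x \<and> u' \<in> U" if "z = u + y" "u \<in> U" for z u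
      using subspace_diff[OF sU that(2) d] that(1) by (intro exI[of _ "u - (x - y)"]) auto
    ultimately show "coset_of U x = coset_of U y" unfolding quotient_coset by blast
  qed
  \<comment> \<open>The unions defining the operations of the quotient run over one and the same
    coset.\<close>
  have un: "(\<Union>z\<in>coset_of U x. coset_of U (g z)) = coset_of U (g x)"
    if "\<And>u. u \<in> U \<Longrightarrow> g (u + x) - g x \<in> U" for g x
  proof -
    have "coset_of U (g z) = coset_of U (g x)" if "z \<in> coset_of U x" for z
      using \<open>\<And>u. u \<in> U \<Longrightarrow> g (u + x) - g x \<in> U\<close> that unfolding eq unfolding quotient_coset by auto
    moreover have "x \<in> coset_of U x" unfolding quotient_coset using subspace_0[OF sU] by force
    ultimately show ?thesis by blast
  qed
  have add: "(coset_of U x) <+>\<^bsub>total_space scale\<^esub> (coset_of U y) = coset_of U (x + y)" for x y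
  proof -
    have "(coset_of U x) <+>\<^bsub>total_space scale\<^esub> (coset_of U y) = {(u + x) + (w + y) |u w. u \<in> U
      \<and> w \<in> U}"
      unfolding quotient_coset set_add_def set_mult_def by (auto simp: total_space_def)
    also have "\<dots> = {u + (x + y) |u. u \<in> U}"
    proof (intro equalityI subsetI)
      fix z assume "z \<in> {(u + x) + (w + y) |u w. u \<in> U \<and> w \<in> U}"
      then obtain u w where "z = (u + x) + (w + y)" "u \<in> U" "w \<in> U" by auto
      then show "z \<in> {u + (x + y) |u. u \<in> U}"
        using subspace_add[OF sU] by (intro CollectI exI[of _ "u + w"]) (auto simp: algebra_simps)
    next
      fix z assume "z \<in> {u + (x + y) |u. u \<in> U}"
      then obtain u where "z = u + (x + y)" "u \<in> U" by auto
      then show "z \<in> {(u + x) + (w + y) |u w. u \<in> U \<and> w \<in> U}"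
        using subspace_0[OF sU]
          by (intro CollectI exI[of _ u] exI[of _ 0]) (auto simp: algebra_simps)
    qed
    finally show ?thesis unfolding quotient_coset .
  qed
  have smul: "(\<Union>z\<in>coset_of U x. coset_of U (c *s z)) = coset_of U (c *s x)" for c x
    by (rule un) (simp add: scale_right_distrib subspace_scale[OF sU])
  have map: "(\<Union>z\<in>coset_of U x. coset_of U (eta z)) = coset_of U (eta x)" for x
    by (rule un) (simp add: eta_add stable_eta[OF U])
  have zero: "U = coset_of U 0" unfolding quotient_coset by simp
  have sm: "c \<odot>\<^bsub>total_space scale\<^esub> x = c *s x" for c x unfolding total_space_def by simp
  show ?thesis
    unfolding presents_def quotient_space_def quotient_map_of_def
    using add smul map zero eq by (simp add: sm)
qed

lemma jordan_type_total:
  assumes "stable W"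
  shows "jordan_type ((total_space scale)\<lparr>carrier := W\<rparr>) eta = shape_of_cols (cols W {0})"
    "is_partition (shape_of_cols (cols W {0}))"
proof -
  have 0: "stable {0}" unfolding stable_def by (simp add: eta_zero)
  have "{0} \<subseteq> W" using subspace_0[OF stable_subspace[OF assms]] by simp
  from jordan_type_eq[OF presents_total 0 assms this]
  show "jordan_type ((total_space scale)\<lparr>carrier := W\<rparr>) eta = shape_of_cols (cols W {0})"
    "is_partition (shape_of_cols (cols W {0}))" by auto
qed

text \<open>Conjugating back: the shapes in a skew chain determine the columns, and with them the
  ranks.\<close>

lemma cols_of_shape:
  assumes U: "stable U" and W: "stable W" "U \<subseteq> W"
  shows "cols W U = colh (young_diagram (shape_of_cols (cols W U)))"
proof -
  have anti: "antimono (cols W U)" using cols_antimono[OF W(1) U] .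
  have fin: "finite {c. r < cols W U c}" for r
  proof (rule finite_subset)
    show "{c. r < cols W U c} \<subseteq> {..<N}"
    proof
      fix c assume "c \<in> {c. r < cols W U c}"
      then show "c \<in> {..<N}" using cols_ge_N[OF W(1), of c U] by (cases "c < N") auto
    qed
  qed simp
  have row: "c < shape_of_cols (cols W U) r \<longleftrightarrow> r < cols W U c" for r c
  proof -
    have "{c. r < cols W U c} = {..<shape_of_cols (cols W U) r}"
      unfolding shape_of_cols_def using antimonoD[OF anti]
        by (intro young_initial fin) (auto intro: less_le_trans)
    then show ?thesis by auto
  qed
  have "{r. (r, c) \<in> young_diagram (shape_of_cols (cols W U))} = {..<cols W U c}" for c
    unfolding young_diagram_def by (auto simp: row)
  then show ?thesis unfolding colh_def by auto
qed

end

section \<open>The Zariski topology and the theorem\<close>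

lemma last_shapes: "m \<le> n \<Longrightarrow> last (shapes b i m n) = shape_of_cols (gcols b i m)"
  unfolding shapes_def by (simp add: last_map last_rev del: upt_Suc)

lemma hd_shapes: "m \<le> n \<Longrightarrow> hd (shapes b i m n) = shape_of_cols (gcols b i n)"
  unfolding shapes_def by simp

lemma tab_shape_tableaux: "T \<in> tableaux lam \<Longrightarrow> tab_shape T = lam"
  unfolding tableaux_def is_tableau_def tab_shape_def by (auto simp: young_diagram_def)

text \<open>Consecutive shapes differ by the square of one entry, so the chain recovers the tableau.
  This gives uniqueness in the description of \<open>flag_tableau\<close>.\<close>

lemma tab_chain_inj:
  assumes T: "T \<in> tableaux lam" "T' \<in> tableaux lam" and eq: "tab_chain T = tab_chain T'"
  shows "T = T'"
proof -
  let ?n = "psize lam"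
  obtain b where b: "grows b 0 ?n" "T = tab b 0 ?n" using tableau_as_tab[OF T(1)] by auto
  obtain b' where b': "grows b' 0 ?n" "T' = tab b' 0 ?n" using tableau_as_tab[OF T(2)] by auto
  have "shapes b 0 0 ?n = shapes b' 0 0 ?n"
    using eq tab_chain_tab[OF b(1)] tab_chain_tab[OF b'(1)] b(2) b'(2) by simp
  then have "\<forall>j\<in>set (rev [0..<Suc ?n]). shape_of_cols (gcols b 0 j) = shape_of_cols (gcols b' 0 j)"
    unfolding shapes_def map_eq_conv .
  then have sh: "shape_of_cols (gcols b 0 j) = shape_of_cols (gcols b' 0 j)" if "j \<le> ?n" for j
    using that by (simp del: upt_Suc)
  have D: "b ` {0..<j} = b' ` {0..<j}" if "j \<le> ?n" for j
    using young_of_shape[OF b(1) that] young_of_shape[OF b'(1) that] sh[OF that] by simp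
  have "b j = b' j" if j: "j < ?n" for j
  proof -
    note s = grows_step[OF b(1) _ j] and s' = grows_step[OF b'(1) _ j]
    have "insert (b j) (b ` {0..<j}) = insert (b' j) (b ` {0..<j})"
      using s(2) s'(2) D[of j] D[of "Suc j"] j by simp
    then show ?thesis using s(1) s'(1) D[of j] j by auto
  qed
  then have "tab b 0 j = tab b' 0 j" if "j \<le> ?n" for j using that by (induction j) auto
  then show ?thesis using b(2) b'(2) by simp
qed

text \<open>In \<open>jdt\<close> the number i of slides is only bounded by m. But the chain of P
  ends in the empty partition, which forces as many slides as there are entries less than m. As m
  may exceed the number n of entries, this number is \<open>min m n\<close>.\<close>

lemma jdt_shapes:
  assumes P: "P \<in> tableaux nu" and K: "jdt K (tab_chain P)"
  shows "\<exists>b m n. grows b 0 n \<and> m \<le> n \<and> K = shapes b 0 m n \<and> tab_chain P = shapes (boxes b m) m m n"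
proof -
  obtain lam T m i where T: "T \<in> tableaux lam" "i \<le> m" "K = tab_ge T m"
    "tab_chain P = tab_ge ((tab_down ^^ i) T) m"
    using K unfolding jdt_def by blast
  define n where "n = psize lam"
  obtain b where b: "grows b 0 n" "T = tab b 0 n" using tableau_as_tab[OF T(1)] n_def by auto
  obtain bP where bP: "grows bP 0 (psize nu)" "P = tab bP 0 (psize nu)" using tableau_as_tab[OF P]
    by auto
  have g0: "gcols b' i' i' = (\<lambda>_. 0)" for b' i' unfolding gcols_def colh_def by simp
  have "last (tab_chain P) = shape_of_cols (\<lambda>_. 0)"
    using tab_chain_tab[OF bP(1)] bP(2) last_shapes[of 0 "psize nu" bP 0] g0 by simp
  then have last: "last (tab_ge ((tab_down ^^ i) T) m) = shape_of_cols (gcols b' i' i')" for b' i'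
    using T(4) g0 by simp
  have Kn: "K = shapes b 0 (min m n) n"
    using T(3) b(2) tab_ge_tab[OF b(1), of m] tab_ge_tab[OF b(1), of n] tab_ge_large[OF b(1), of m]
    by (cases "m \<le> n") (auto simp: min_def)
  have "tab_chain P = shapes (boxes b (min m n)) (min m n) (min m n) n"
  proof (cases "i \<le> n")
    case True
    note gi = grows_boxes(1)[OF b(1) True]
    let ?B = "boxes b i"
    have e: "tab_chain P = shapes ?B i (min m n) n"
      using T(2,4) b(2) grows_boxes(2)[OF b(1) True] True tab_ge_tab[OF gi, of m] tab_ge_tab[OF gi,
        of n] tab_ge_large[OF gi, of m]
      by (cases "m \<le> n") (auto simp: min_def)
    have "shape_of_cols (gcols ?B i (min m n)) = shape_of_cols (gcols ?B i i)"
      using last[of ?B i] e T(4) last_shapes[of "min m n" n ?B i] by simp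
    then have "i = min m n" using shape_of_cols_inj[OF gi, of i "min m n"] T(2) True
      by (cases "i < min m n") auto
    then show ?thesis using e by simp
  next
    case False
    then have mn: "min m n = n" using T(2) by simp
    note gn = grows_boxes(1)[OF b(1) order_refl]
    have "(tab_down ^^ i) T = Map.empty" using tab_down_pow_ge[OF b(1)] b(2) False by simp
    then have "(tab_down ^^ i) T = tab (boxes b n) n n" by simp
    then have "tab_chain P = tab_ge (tab (boxes b n) n n) m" using T(4) by simp
    also have "\<dots> = shapes (boxes b n) n n n" 
      using tab_ge_large[OF gn, of m] tab_ge_tab[OF gn, of n] False T(2) by simp
    finally show ?thesis using mn by simp
  qed
  then show ?thesis using b(1) Kn by (intro exI[of _ b] exI[of _ "min m n"] exI[of _ n]) auto
qed

context nilpotent_endo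
begin

declare dim_UNIV [simp del]

abbreviation dimV :: nat where "dimV \<equiv> dim (UNIV :: 'b set)"

lemma stable_zero: "stable {0}" and stable_UNIV: "stable UNIV"
  unfolding stable_def by (auto simp: eta_zero)

lemma dim_zero: "dim {0} = 0"
  by simp

section \<open>Frames, flags and rank loci\<close>

lemma partial_flags_iff:
  "f \<in> partial_flags scale m \<longleftrightarrow> f \<in> extensional {m..dimV} \<and>
     (\<forall>i\<in>{m..dimV}. subspace (f i) \<and> dim (f i) = i) \<and> (\<forall>i\<in>{m..dimV}. \<forall>j\<in>{m..dimV}. i \<le> j \<longrightarrow> f i \<subseteq> f
       j)"
  unfolding partial_flags_def Let_def by auto

lemma frames_iff: "v \<in> frames scale \<longleftrightarrow> v \<in> extensional {..<dimV} \<and> inj_on v {..<dimV}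
  \<and> independent (v ` {..<dimV})"
  unfolding frames_def Let_def by auto

lemma frame_flag_eq: "frame_flag scale m v = (\<lambda>i\<in>{m..dimV}. span (v ` {..<i}))"
  unfolding frame_flag_def by simp

lemma frame_flag_partial:
  assumes "v \<in> frames scale"
  shows "frame_flag scale m v \<in> partial_flags scale m"
proof -
  have "dim (span (v ` {..<i})) = i" if "i \<le> dimV" for i
  proof -
    have sub: "{..<i} \<subseteq> {..<dimV}" using that by auto
    have "independent (v ` {..<i})" using assms independent_mono[OF _ image_mono[OF sub]]
      unfolding frames_iff by blast
    moreover have "inj_on v {..<i}" using assms inj_on_subset[OF _ sub] unfolding frames_iff
      by blast
    ultimately show ?thesis by (simp add: dim_eq_card_independent card_image)
  qed
  moreover have "span (v ` {..<i}) \<subseteq> span (v ` {..<j})" if "i \<le> j" for i j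
    using that by (intro span_mono image_mono) auto
  ultimately show ?thesis unfolding partial_flags_iff frame_flag_eq by simp
qed

text \<open>The product of two polynomials cuts out the intersection of their principal open sets,
  so these form a basis and not just a subbasis.\<close>

lemma frame_basis:
  assumes "openin (frame_topology scale) S" "v \<in> S"
  shows "\<exists>p\<in>poly_funs scale. p v \<noteq> 0 \<and> {v \<in> frames scale. p v \<noteq> 0} \<subseteq> S"
proof -
  have "generate_topology_on {{v \<in> frames scale. p v \<noteq> 0} |p. p \<in> poly_funs scale} S"
    using assms(1) unfolding frame_topology_def openin_topology_generated_by_iff .
  then show ?thesis using assms(2)
  proof (induction arbitrary: v rule: generate_topology_on.induct)
    case (Int A B)
    then obtain p q where "p \<in> poly_funs scale" "p v \<noteq> 0" "{v \<in> frames scale. p v \<noteq> 0} \<subseteq> A"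
      "q \<in> poly_funs scale" "q v \<noteq> 0" "{v \<in> frames scale. q v \<noteq> 0} \<subseteq> B" by blast
    then show ?case by (intro bexI[of _ "\<lambda>v. p v * q v"] poly_funs.mult) auto
  next
    case (UN \<K>)
    then show ?case by blast
  next
    case (Basis S)
    then show ?case by blast
  qed simp
qed

lemma topspace_frames: "topspace (frame_topology scale) = frames scale"
proof -
  have "(\<lambda>_. 1) \<in> poly_funs scale" by (rule poly_funs.const)
  then have "frames scale \<in> {{v \<in> frames scale. p v \<noteq> 0} |p. p \<in> poly_funs scale}"
    by (intro CollectI exI[of _ "\<lambda>_. 1"]) auto
  then show ?thesis unfolding frame_topology_def topology_generated_by_topspace by auto
qed

lemma openin_frames: "p \<in> poly_funs scale \<Longrightarrow> openin (frame_topology scale) {v \<in> frames scale. p v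
  \<noteq> 0}"
  unfolding frame_topology_def by (intro topology_generated_by_Basis) auto

lemma topspace_flags: "topspace (flag_topology scale m) = partial_flags scale m"
proof -
  have "{v \<in> frames scale. frame_flag scale m v \<in> partial_flags scale m} = frames scale"
    using frame_flag_partial by auto
  then have "openin (flag_topology scale m) (partial_flags scale m)"
    unfolding openin_flag_topology using openin_topspace[of "frame_topology scale"] topspace_frames
      by simp
  then have "partial_flags scale m \<subseteq> topspace (flag_topology scale m)" by (rule openin_subset)
  moreover have "topspace (flag_topology scale m) \<subseteq> partial_flags scale m"
    using openin_topspace[of "flag_topology scale m"] unfolding openin_flag_topology by simp
  ultimately show ?thesis by simp
qed

text \<open>The restriction to k < N keeps the number of conditions finite.\<close>

definition rank_locus :: "nat \<Rightarrow> (nat \<Rightarrow> nat \<Rightarrow> nat) \<Rightarrow> (nat \<Rightarrow> 'b set) set" where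
  "rank_locus m \<rho> = {f \<in> partial_flags scale m. \<forall>j\<in>{m..dimV}. \<forall>k<N. \<rho> k j \<le> rank k (f j) (f m)}"

text \<open>Openness is tested on frames, where the members of the flag are spanned by polynomially
  varying vectors. Around each frame \<open>rank_generic\<close> yields a principal open set on
  which no rank drops.\<close>

lemma openin_rank_locus:
  assumes m: "m \<le> dimV"
  shows "openin (flag_topology scale m) (rank_locus m \<rho>)"
  unfolding openin_flag_topology
proof
  show "rank_locus m \<rho> \<subseteq> partial_flags scale m" unfolding rank_locus_def by auto
  let ?S = "{v \<in> frames scale. frame_flag scale m v \<in> rank_locus m \<rho>}"
  \<comment> \<open>Swapping the arguments makes the frame itself the parameter of
    \<open>curve_flag\<close>.\<close>
  define w :: "nat \<Rightarrow> (nat \<Rightarrow> 'b) \<Rightarrow> 'b" where "w a v = v a" for a v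
  have ff: "frame_flag scale m v j = curve_flag w v j" if "j \<in> {m..dimV}" for v j
    using that unfolding frame_flag_eq curve_flag_def w_def by simp
  show "openin (frame_topology scale) ?S"
  proof (subst openin_subopen, rule ballI)
    fix v0 assume v0: "v0 \<in> ?S"
    let ?Q = "{m..dimV} \<times> {..<N}"
    let ?P = "\<lambda>(j, k) v. rank k (curve_flag w v0 j) (curve_flag w v0 m)
      \<le> rank k (curve_flag w v j) (curve_flag w v m)"
    have "\<exists>p\<in>poly_funs scale. p v0 \<noteq> 0 \<and> (\<forall>v. p v \<noteq> 0 \<longrightarrow> (\<forall>q\<in>?Q. ?P q v))"
    proof (rule generic_finite)
      fix q assume "q \<in> ?Q"
      then obtain j k where q: "q = (j, k)" "j \<le> dimV" by auto
      have "\<exists>p\<in>poly_funs scale. p v0 \<noteq> 0 \<and> (\<forall>v. p v \<noteq> 0 \<longrightarrow>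
        rank k (curve_flag w v0 j) (curve_flag w v0 m) \<le> rank k (curve_flag w v j) (curve_flag w v
          m))"
      proof (rule rank_generic)
        show "(\<lambda>x. \<phi> (w a x)) \<in> poly_funs scale" if "a < j" "functional \<phi>" for a \<phi>
          unfolding w_def using that q by (intro poly_funs.coord) auto
        show "(\<lambda>x. \<phi> (w a x)) \<in> poly_funs scale" if "a < m" "functional \<phi>" for a \<phi>
          unfolding w_def using that m by (intro poly_funs.coord) auto
      qed (auto intro: poly_funs.intros)
      then show "\<exists>p\<in>poly_funs scale. p v0 \<noteq> 0 \<and> (\<forall>v. p v \<noteq> 0 \<longrightarrow> ?P q v)" unfolding q by simp
    qed (auto intro: poly_funs.intros)
    then obtain p where p: "p \<in> poly_funs scale" "p v0 \<noteq> 0" "\<And>v. p v \<noteq> 0 \<Longrightarrow> \<forall>q\<in>?Q. ?P q v" by blast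
    show "\<exists>T. openin (frame_topology scale) T \<and> v0 \<in> T \<and> T \<subseteq> ?S"
    proof (intro exI[of _ "{v \<in> frames scale. p v \<noteq> 0}"] conjI subsetI)
      fix v assume v: "v \<in> {v \<in> frames scale. p v \<noteq> 0}"
      have "\<rho> k j \<le> rank k (frame_flag scale m v j) (frame_flag scale m v m)"
        if jk: "j \<in> {m..dimV}" "k < N" for j k
      proof -
        have mm: "m \<in> {m..dimV}" using m by simp
        have "\<rho> k j \<le> rank k (frame_flag scale m v0 j) (frame_flag scale m v0 m)"
          using v0 jk unfolding rank_locus_def by blast
        then have "\<rho> k j \<le> rank k (curve_flag w v0 j) (curve_flag w v0 m)"
          unfolding ff[OF jk(1)] ff[OF mm] .
        also have "\<dots> \<le> rank k (curve_flag w v j) (curve_flag w v m)" using p(3)[of v] v jk by auto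
        finally show ?thesis unfolding ff[OF jk(1)] ff[OF mm] .
      qed
      then show "v \<in> ?S" using v frame_flag_partial unfolding rank_locus_def by auto
    qed (use v0 p openin_frames in auto)
  qed
qed

lemma poly_funs_pcurve:
  assumes "p \<in> poly_funs scale" and v: "\<And>a. pcurve (v a)"
  shows "\<exists>q. \<forall>t. p (\<lambda>a\<in>{..<dimV}. v a t) = poly q t"
  using assms(1)
proof (induction rule: poly_funs.induct)
  case (const c)
  show ?case by (rule exI[of _ "[:c:]"]) simp
next
  case (coord i \<phi>)
  then obtain q where "\<forall>t. \<phi> (v i t) = poly q t" using v unfolding pcurve_def by blast
  then show ?case using coord by (intro exI[of _ q]) auto
next
  case (add p q)
  then obtain r s where "\<forall>t. p (\<lambda>a\<in>{..<dimV}. v a t) = poly r t"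
    "\<forall>t. q (\<lambda>a\<in>{..<dimV}. v a t) = poly s t" by blast
  then show ?case by (intro exI[of _ "r + s"] allI) (simp only: poly_add)
next
  case (mult p q)
  then obtain r s where "\<forall>t. p (\<lambda>a\<in>{..<dimV}. v a t) = poly r t"
    "\<forall>t. q (\<lambda>a\<in>{..<dimV}. v a t) = poly s t" by blast
  then show ?case by (intro exI[of _ "r * s"] allI) (simp only: poly_mult)
qed

lemma frame_of_span:
  assumes "span (x ` {..<dimV}) = UNIV"
  shows "restrict x {..<dimV} \<in> frames scale"
proof -
  have c: "card (x ` {..<dimV}) = dimV"
    using dim_le_card[of UNIV "x ` {..<dimV}"] card_image_le[of "{..<dimV}" x] assms by auto
  have "independent (x ` {..<dimV})" using card_le_dim_spanning[of "x ` {..<dimV}" UNIV] assms c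
    by auto
  moreover have "inj_on x {..<dimV}" using c by (intro eq_card_imp_inj_on) auto
  moreover have "restrict x {..<dimV} ` {..<dimV} = x ` {..<dimV}" by auto
  ultimately show ?thesis unfolding frames_iff by (auto simp: inj_on_restrict_eq)
qed

text \<open>On a curve in S from f to the optimal flag \<open>f1\<close>, lying in \<open>O'\<close>
  holds at t = 0 and the rank conditions hold at t = 1. Each holds off the roots of a nonzero
  polynomial, so some parameter satisfies both.\<close>

lemma Fl_rank_dense:
  assumes inf: "infinite (UNIV :: 'a set)" and m: "m \<le> dimV"
    and S: "S = Fl {0} m UNIV \<kappa> \<inter> extensional {m..dimV}"
    and f1: "f1 \<in> S" "f1 \<in> rank_locus m \<rho>" and f: "f \<in> S"
      and O': "openin (flag_topology scale m) O'" "f \<in> O'"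
  shows "\<exists>g\<in>S \<inter> rank_locus m \<rho>. g \<in> O'"
proof -
  have "m \<le> dim UNIV" by (rule m)
  then obtain v where v: "\<And>a. pcurve (v a)" "\<And>t. curve_flag v t \<in> Fl {0} m UNIV \<kappa>"
    "\<And>j. j \<in> {m..dimV} \<Longrightarrow> curve_flag v 0 j = f j \<and> curve_flag v 1 j = f1 j"
    using Fl_curve[OF stable_zero, of m UNIV f \<kappa> f1] f f1 S by blast
  \<comment> \<open>The curve lifts to frames, because \<open>dimV\<close> vectors spanning V form a
    basis. Along the lift, polynomial functions on frames become polynomials in t.\<close>
  define x where "x t = (\<lambda>a\<in>{..<dimV}. v a t)" for t
  have xf: "x t \<in> frames scale" for t
    unfolding x_def
  proof (rule frame_of_span)
    show "span ((\<lambda>a. v a t) ` {..<dimV}) = UNIV" using v(2)[of t] unfolding Fl_def curve_flag_def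
      by simp
  qed
  have ff: "frame_flag scale m (x t) = restrict (curve_flag v t) {m..dimV}" for t
  proof -
    have "x t ` {..<i} = (\<lambda>a. v a t) ` {..<i}" if "i \<le> dimV" for i using that unfolding x_def
      by (intro image_cong) auto
    then show ?thesis unfolding frame_flag_eq curve_flag_def
      by (intro restrict_ext) (metis atLeastAtMost_iff)
  qed
  have gS: "frame_flag scale m (x t) \<in> S" for t
    using v(2)[of t] m unfolding ff S Fl_def by auto
  have g0: "frame_flag scale m (x 0) = f"
    unfolding ff by (rule extensionalityI[of _ "{m..dimV}"]) (use v(3) f S in auto)
  have "x 0 \<in> {v \<in> frames scale. frame_flag scale m v \<in> O'}" using g0 xf O' by simp
  moreover have "openin (frame_topology scale) {v \<in> frames scale. frame_flag scale m v \<in> O'}"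
    using O'(1) unfolding openin_flag_topology by simp
  ultimately obtain p where p: "p \<in> poly_funs scale" "p (x 0) \<noteq> 0"
    "{v \<in> frames scale. p v \<noteq> 0} \<subseteq> {v \<in> frames scale. frame_flag scale m v \<in> O'}" using frame_basis
      by blast
  obtain q0 where q0: "\<And>t. p (x t) = poly q0 t" using poly_funs_pcurve[OF p(1), of v] v(1)
    unfolding x_def by blast
  let ?Q = "{m..dimV} \<times> {..<N}"
  let ?P = "\<lambda>(j, k) t. rank k (curve_flag v 1 j) (curve_flag v 1 m)
    \<le> rank k (curve_flag v t j) (curve_flag v t m)"
  have "\<exists>p\<in>range poly. p 1 \<noteq> 0 \<and> (\<forall>t. p t \<noteq> 0 \<longrightarrow> (\<forall>q\<in>?Q. ?P q t))"
  proof (rule generic_finite[OF range_poly_algebra(1,3)])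
    fix q assume "q \<in> ?Q"
    obtain j k where q: "q = (j, k)" by (cases q)
    show "\<exists>p\<in>range poly. p 1 \<noteq> 0 \<and> (\<forall>t. p t \<noteq> 0 \<longrightarrow> ?P q t)"
      unfolding q using rank_pcurve[of v v 1 k j m] v(1) by simp
  qed auto
  then obtain q1 where q1: "poly q1 1 \<noteq> 0" "\<And>t. poly q1 t \<noteq> 0 \<Longrightarrow> \<forall>q\<in>?Q. ?P q t" by blast
  have "q0 \<noteq> 0" "q1 \<noteq> 0" using p(2) q0[of 0] q1(1) by auto
  then have "finite {t. poly (q0 * q1) t = 0}" by (intro poly_roots_finite) simp
  then have "{t. poly (q0 * q1) t = 0} \<noteq> UNIV" using inf by metis
  then obtain t where t: "poly q0 t \<noteq> 0" "poly q1 t \<noteq> 0" by auto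
  let ?g = "frame_flag scale m (x t)"
  have "?g \<in> O'" using p(3) xf[of t] q0[of t] t(1) by auto
  moreover have "?g \<in> rank_locus m \<rho>" unfolding rank_locus_def
  proof (intro CollectI conjI ballI allI impI)
    show "?g \<in> partial_flags scale m" using frame_flag_partial[OF xf] .
    fix j k assume jk: "j \<in> {m..dimV}" "k < N"
    have "\<rho> k j \<le> rank k (f1 j) (f1 m)" using f1(2) jk unfolding rank_locus_def by auto
    also have "\<dots> = rank k (curve_flag v 1 j) (curve_flag v 1 m)" using v(3)[of j] v(3)[of m] jk m
      by auto
    also have "\<dots> \<le> rank k (curve_flag v t j) (curve_flag v t m)" using q1(2)[OF t(2)] jk by auto
    also have "\<dots> = rank k (?g j) (?g m)" using jk m unfolding ff by simp
    finally show "\<rho> k j \<le> rank k (?g j) (?g m)" .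
  qed
  ultimately show ?thesis using gS[of t] by blast
qed

lemma sq_basis_dim:
  assumes U: "stable U" and W: "stable W" "U \<subseteq> W"
  shows "dim W = dim U + psize (shape_of_cols (cols W U))"
proof -
  obtain lam e where le: "is_partition lam" "sq_basis U W lam e" using sq_basis_exists[OF U W]
    by auto
  have lam: "lam = shape_of_cols (cols W U)" using sq_basis_unique[OF le(2) U W le(1)] .
  let ?Y = "young_diagram lam"
  have "span (U \<union> e ` ?Y) \<subseteq> W" using le(2) W unfolding sq_basis_def
    by (intro span_minimal stable_subspace) auto
  then have "W = span (U \<union> e ` ?Y)" using le(2) unfolding sq_basis_def by blast
  then have "dim W = dim U + card ?Y"
    using dim_span_mod[OF stable_subspace[OF U] finite_young_diagram(1)[OF le(1)], of e] le(2)
      unfolding sq_basis_def by metis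
  then show ?thesis using finite_young_diagram(2)[OF le(1)] lam by simp
qed

section \<open>Flags of a skew chain and their quotient flags\<close>

text \<open>Brings the set of flags of a skew chain into the form \<open>Fl\<close>, for which
  curves and rank bounds are available.\<close>

lemma flags_of_chain_eq:
  assumes g: "grows b 0 dimV" and m: "m \<le> dimV"
  shows "flags_of_chain scale eta m (shapes b 0 m dimV)
    = Fl {0} m UNIV (gcols b 0) \<inter> extensional {m..dimV}"
proof (intro equalityI subsetI)
  fix f assume f: "f \<in> flags_of_chain scale eta m (shapes b 0 m dimV)"
  have p: "f \<in> extensional {m..dimV}" "\<And>i. i \<in> {m..dimV} \<Longrightarrow> subspace (f i) \<and> dim (f i) = i"
    "\<And>i j. i \<in> {m..dimV} \<Longrightarrow> j \<in> {m..dimV} \<Longrightarrow> i \<le> j \<Longrightarrow> f i \<subseteq> f j"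
    "\<And>i. i \<in> {m..dimV} \<Longrightarrow> eta ` f i \<subseteq> f i"
    using f unfolding flags_of_chain_def stable_flags_def partial_flags_iff by auto
  have st: "stable (f j)" if "j \<in> {m..dimV}" for j unfolding stable_def using p(2,4) that by auto
  have "flag_skew_chain scale eta m f = shapes b 0 m dimV" using f unfolding flags_of_chain_def
    by auto
  then have "\<forall>j\<in>set (rev [m..<Suc dimV]). jordan_type ((total_space scale)\<lparr>carrier := f j\<rparr>) eta
    = shape_of_cols (gcols b 0 j)"
    unfolding flag_skew_chain_def shapes_def map_eq_conv .
  then have J: "jordan_type ((total_space scale)\<lparr>carrier := f j\<rparr>) eta = shape_of_cols (gcols b 0 j)"
    if "j \<in> {m..dimV}" for j
    using that by (simp del: upt_Suc)
  have c: "cols (f j) {0} = gcols b 0 j" if j: "j \<in> {m..dimV}" for j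
  proof -
    have "shape_of_cols (cols (f j) {0}) = shape_of_cols (gcols b 0 j)"
      using J[OF j] jordan_type_total(1)[OF st[OF j]] by simp
    moreover have "{0} \<subseteq> f j" using subspace_0[OF stable_subspace[OF st[OF j]]] by simp
    ultimately have "cols (f j) {0} = colh (young_diagram (shape_of_cols (gcols b 0 j)))"
      using cols_of_shape[OF stable_zero st[OF j]] by metis
    then show ?thesis using young_of_shape[OF g, of j] j unfolding gcols_def by simp
  qed
  have "f dimV = UNIV" using subspace_dim_equal[of "f dimV" UNIV] p(2)[of dimV] m by auto
  then show "f \<in> Fl {0} m UNIV (gcols b 0) \<inter> extensional {m..dimV}"
    unfolding Fl_def using p c st subspace_0 by (auto dest: stable_subspace)
next
  fix f assume "f \<in> Fl {0} m UNIV (gcols b 0) \<inter> extensional {m..dimV}"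
  then have f: "f \<in> Fl {0} m UNIV (gcols b 0)" "f \<in> extensional {m..dimV}" by auto
  have st: "stable (f j)" "dim (f j) = j" "cols (f j) {0} = gcols b 0 j" if "j \<in> {m..dimV}" for j
    using f that unfolding Fl_def by auto
  have "f \<in> stable_flags scale eta m"
    unfolding stable_flags_def partial_flags_iff using f(2) st Fl_mono[OF f(1)] unfolding stable_def
      by auto
  moreover have "flag_skew_chain scale eta m f = shapes b 0 m dimV"
    unfolding flag_skew_chain_def shapes_def map_eq_conv using jordan_type_total(1)[OF st(1)] st(3)
      by (auto simp del: upt_Suc)
  ultimately show "f \<in> flags_of_chain scale eta m (shapes b 0 m dimV)" unfolding flags_of_chain_def
    by simp
qed

lemma quotient_flag_tableau_eq:
  assumes P: "P \<in> tableaux nu" and B: "tab_chain P = shapes B m m dimV" and m: "m \<le> dimV"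
    and f: "f \<in> Fl {0} m UNIV \<kappa>" and c: "\<And>j. j \<in> {m..dimV} \<Longrightarrow> cols (f j) (f m) = gcols B m j"
  shows "quotient_flag_tableau scale eta m f = P"
proof -
  let ?Q = "quotient_space (total_space scale) (f m)"
    and ?xi = "quotient_map_of (total_space scale) (f m) eta"
  have st: "stable (f j)" "f m \<subseteq> f j" if "j \<in> {m..dimV}" for j using f that Fl_mono[OF f, of m j]
    unfolding Fl_def by auto
  have sm: "stable (f m)" using st m by simp
  have J: "jordan_type (?Q\<lparr>carrier := quotient_flag scale m f i\<rparr>) ?xi
    = shape_of_cols (gcols B m (m + i))" if "i \<le> dimV - m" for i
  proof -
    have i: "m + i \<in> {m..dimV}" using that m by auto
    show ?thesis unfolding quotient_flag_def
      using jordan_type_eq(1)[OF presents_quotient[OF sm] sm st(1)[OF i] st(2)[OF i]] c[OF i]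
        by simp
  qed
  have fn: "f dimV = UNIV" using f unfolding Fl_def by simp
  have "carrier ?Q = quotient_flag scale m f (dimV - m)"
    unfolding quotient_flag_def quotient_space_def A_RCOSETS_def RCOSETS_def a_r_coset_def
      using m fn by (auto simp: total_space_def)
  \<comment> \<open>The quotient is its own restriction to the full carrier, so the top case of J
    computes its Jordan type.\<close>
  then have "?Q = ?Q\<lparr>carrier := quotient_flag scale m f (dimV - m)\<rparr>"
    by (metis module.surjective module.update_convs(1) partial_object.select_convs(1)
    partial_object.update_convs(1))
  then have JQ: "jordan_type ?Q ?xi = shape_of_cols (gcols B m dimV)" using J[of "dimV - m"] m
    by simp
  have nu: "nu = shape_of_cols (gcols B m dimV)"
    using tab_shape_tableaux[OF P] B hd_shapes[OF m, of B m] unfolding tab_chain_def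
      by (metis list.sel(1))
  have chain: "map (\<lambda>i. jordan_type (?Q\<lparr>carrier := quotient_flag scale m f i\<rparr>) ?xi) (rev [0..<Suc
    (dimV - m)]) = tab_chain P"
  proof -
    have "map (\<lambda>i. jordan_type (?Q\<lparr>carrier := quotient_flag scale m f i\<rparr>) ?xi) (rev [0..<Suc (dimV -
      m)]) =
      map (\<lambda>i. shape_of_cols (gcols B m (i + m))) (rev [0..<Suc (dimV - m)])"
      unfolding map_eq_conv using J by (auto simp: add.commute simp del: upt_Suc)
    also have "\<dots> = map (\<lambda>j. shape_of_cols (gcols B m j)) (rev (map (\<lambda>i. i + m) [0..<Suc (dimV -
      m)]))"
      by (simp add: rev_map del: upt_Suc)
    also have "map (\<lambda>i. i + m) [0..<Suc (dimV - m)] = [m..<Suc dimV]"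
      using map_add_upt[of m "Suc (dimV - m)"] m by (simp add: Suc_diff_le del: upt_Suc)
    finally show ?thesis unfolding B shapes_def .
  qed
  show ?thesis unfolding quotient_flag_tableau_def flag_tableau_def
  proof (rule the_equality)
    show "P \<in> tableaux (jordan_type ?Q ?xi) \<and> tab_chain P =
      map (\<lambda>i. jordan_type (?Q\<lparr>carrier := quotient_flag scale m f i\<rparr>) ?xi) (rev [0..<Suc (dimV -
        m)])"
      using P JQ nu chain by simp
    fix T assume "T \<in> tableaux (jordan_type ?Q ?xi) \<and> tab_chain T =
      map (\<lambda>i. jordan_type (?Q\<lparr>carrier := quotient_flag scale m f i\<rparr>) ?xi) (rev [0..<Suc (dimV -
        m)])"
    then show "T = P" using tab_chain_inj[of T nu P] P JQ nu chain by simp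
  qed
qed

lemma generic_quotient_tableau:
  assumes inf: "infinite (UNIV :: 'a set)" and K:
    "K \<in> skew_chains (jordan_type (total_space scale) eta) mu"
    and P: "P \<in> tableaux nu" and jdt: "jdt K (tab_chain P)"
  shows "\<exists>F'. openin (subtopology (flag_topology scale (psize mu)) (flags_of_chain scale eta (psize
    mu) K)) F' \<and>
    subtopology (flag_topology scale (psize mu)) (flags_of_chain scale eta (psize mu) K) closure_of
      F' =
      flags_of_chain scale eta (psize mu) K \<and> (\<forall>f\<in>F'. quotient_flag_tableau scale eta (psize mu) f =
        P)"
proof -
  obtain b m n where b: "grows b 0 n" "m \<le> n" "K = shapes b 0 m n"
    "tab_chain P = shapes (boxes b m) m m n"
    using jdt_shapes[OF P jdt] by auto
  have K': "hd K = jordan_type (total_space scale) eta" "last K = mu"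
    "\<And>\<kappa>. \<kappa> \<in> set K \<Longrightarrow> is_partition \<kappa>" "K \<noteq> []"
    using K unfolding skew_chains_def by auto
  have size: "psize (shape_of_cols (gcols b 0 j)) = j"
    if "is_partition (shape_of_cols (gcols b 0 j))" "j \<le> n" for j
    using finite_young_diagram(2)[OF that(1)] young_of_shape[OF b(1) that(2)] growsD(1)[OF
      grows_sub[OF b(1) that(2)]]
    by (simp add: card_image)
  have mu: "mu = shape_of_cols (gcols b 0 m)" using K'(2) b(2,3) last_shapes by simp
  \<comment> \<open>The numbers m and n come from the tableau behind \<open>jdt\<close>. Counting
    squares identifies m with the size of mu, and below n with the dimension of V.\<close>
  have pm: "psize mu = m" using size[of m] K'(2,3,4) mu b(2) last_in_set[of K] by metis
  have tot: "total_space scale = (total_space scale)\<lparr>carrier := UNIV\<rparr>" unfolding total_space_def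
    by simp
  have lam: "shape_of_cols (cols UNIV {0}) = shape_of_cols (gcols b 0 n)"
    using K'(1) b(2,3) hd_shapes[of m n b 0] jordan_type_total(1)[OF stable_UNIV] tot by simp
  then have pn: "is_partition (shape_of_cols (gcols b 0 n))"
    using jordan_type_total(2)[OF stable_UNIV] by simp
  have n: "n = dimV"
    using sq_basis_dim[OF stable_zero stable_UNIV] lam size[OF pn order_refl] dim_zero by simp
  note b = b[unfolded n]
  have cV: "cols UNIV {0} = gcols b 0 dimV"
    using cols_of_shape[OF stable_zero stable_UNIV] lam young_of_shape[OF b(1) order_refl]
      unfolding n gcols_def by simp
  define \<kappa> where "\<kappa> = gcols b 0"
  define \<Gamma> where "\<Gamma> = gamma \<kappa>"
  have G0: "\<Gamma> 0 = \<kappa>" and GS: "\<Gamma> (Suc i) = down (\<Gamma> i) i" for i unfolding \<Gamma>_def by auto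
  have v: "valid 0 dimV \<kappa>" unfolding \<kappa>_def by (rule grows_valid[OF b(1)])
  have Gm: "\<Gamma> m j = gcols (boxes b m) m j" if "j \<in> {m..dimV}" for j
    unfolding \<Gamma>_def \<kappa>_def using grows_boxes(3)[OF b(1,2)] that by simp
  \<comment> \<open>General W is needed: besides V, the theorem \<open>growth\<close> is applied to
    the lowest member of a partial flag.\<close>
  have gr: "(\<exists>f\<in>Fl {0} 0 W \<kappa>. \<forall>i j. 0 \<le> i \<and> i \<le> j \<and> j \<le> dim W \<longrightarrow> cols (f j) (f i) = \<Gamma> i j) \<and>
    (\<forall>f\<in>Fl {0} 0 W \<kappa>. \<forall>i j k. 0 \<le> i \<and> i \<le> j \<and> j \<le> dim W \<longrightarrow> rank k (f j) (f i) \<le> i + (\<Sum>l=k..<N. \<Gamma> i j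
      l))"
    if W: "stable W" "cols W {0} = \<kappa> (dim W)" for W
  proof -
    have "dim W \<le> dimV" by (rule dim_subset) simp
    moreover have "{0} \<subseteq> W" using subspace_0[OF stable_subspace[OF W(1)]] by simp
    ultimately show ?thesis
      using growth[OF inf GS stable_zero W(1)] W(2) G0 valid_sub[OF v] unfolding dim_zero by simp
  qed
  obtain f1 where f1: "f1 \<in> Fl {0} 0 UNIV \<kappa>" "\<And>i j. i \<le> j \<Longrightarrow> j \<le> dimV \<Longrightarrow> cols (f1 j) (f1 i) = \<Gamma> i j"
    using gr[OF stable_UNIV] cV unfolding \<kappa>_def by auto
  have ub: "rank k (f j) (f i) \<le> i + (\<Sum>l=k..<N. \<Gamma> i j l)"
    if "f \<in> Fl {0} 0 UNIV \<kappa>" "i \<le> j" "j \<le> dimV" for f i j k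
    using gr[OF stable_UNIV] cV that unfolding \<kappa>_def by auto
  \<comment> \<open>The bound of \<open>growth\<close> for ranks modulo \<open>f m\<close>. It is
    attained by \<open>f1\<close>, so the locus consists of the flags of maximal ranks.\<close>
  define \<rho> where "\<rho> k j = m + (\<Sum>l=k..<N. \<Gamma> m j l)" for k j
  define S where "S = flags_of_chain scale eta m K"
  have S: "S = Fl {0} m UNIV \<kappa> \<inter> extensional {m..dimV}"
    unfolding S_def b(3) \<kappa>_def by (rule flags_of_chain_eq[OF b(1,2)])
  have f1st: "stable (f1 j)" "dim (f1 j) = j" if "j \<le> dimV" for j using f1(1) that unfolding Fl_def
    by auto
  have f1rank: "rank k (f1 j) (f1 m) = \<rho> k j" if "j \<in> {m..dimV}" for k j
    using rank_eq_sum[of "f1 j" "f1 m" k] f1st[of j] f1st[of m] f1(2)[of m j] that stable_subspace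
      unfolding \<rho>_def by auto
  define f2 where "f2 = restrict f1 {m..dimV}"
  have f2S: "f2 \<in> S" using f1(1) b(2) unfolding S f2_def Fl_def by auto
  have SP: "S \<subseteq> partial_flags scale m" unfolding S_def flags_of_chain_def stable_flags_def by auto
  have f2R: "f2 \<in> rank_locus m \<rho>"
    using f2S SP f1rank b(2) unfolding rank_locus_def f2_def by auto
  have top: "topspace (subtopology (flag_topology scale m) S) = S" using topspace_flags SP by auto
  define F' where "F' = S \<inter> rank_locus m \<rho>"
  have "openin (subtopology (flag_topology scale m) S) F'"
    unfolding F'_def by (rule openin_subtopology_Int2[OF openin_rank_locus[OF b(2)]])
  moreover have "subtopology (flag_topology scale m) S closure_of F' = S"
  proof
    show "subtopology (flag_topology scale m) S closure_of F' \<subseteq> S"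
      using closure_of_subset_topspace top by metis
    show "S \<subseteq> subtopology (flag_topology scale m) S closure_of F'"
    proof
      fix f assume f: "f \<in> S"
      show "f \<in> subtopology (flag_topology scale m) S closure_of F'"
        unfolding in_closure_of top
      proof (intro conjI f allI impI)
        fix T assume T: "f \<in> T \<and> openin (subtopology (flag_topology scale m) S) T"
        then obtain O' where O': "openin (flag_topology scale m) O'" "T = O' \<inter> S"
          unfolding openin_subtopology by auto
        then obtain g where "g \<in> S \<inter> rank_locus m \<rho>" "g \<in> O'"
          using Fl_rank_dense[OF inf b(2) S f2S f2R f] T by blast
        then show "\<exists>y. y \<in> F' \<and> y \<in> T" using O' unfolding F'_def by blast
      qed
    qed
  qed
  moreover have "quotient_flag_tableau scale eta m f = P" if f: "f \<in> F'" for f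
  proof (rule quotient_flag_tableau_eq[OF P b(4,2)])
    show fF: "f \<in> Fl {0} m UNIV \<kappa>" using f unfolding F'_def S by auto
    have fm: "stable (f m)" "dim (f m) = m" "cols (f m) {0} = \<kappa> (dim (f m))" using fF b(2)
      unfolding Fl_def by auto
    \<comment> \<open>The bound \<open>ub\<close> concerns complete flags. A flag of the types
      \<kappa> inside \<open>f m\<close> exists by \<open>growth\<close> and completes f without
      changing its members from m on.\<close>
    obtain h where h: "h \<in> Fl {0} 0 (f m) \<kappa>"
      using conjunct1[OF gr[OF fm(1,3)]] unfolding Bex_def by (elim exE conjE) (rule that)
    define fc where "fc j = (if j < m then h j else f j)" for j
    have fcF: "fc \<in> Fl {0} 0 UNIV \<kappa>" unfolding Fl_def
    proof (intro CollectI conjI ballI)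
      fix j assume "j \<in> {0..dimV}"
      then have "stable (fc j) \<and> dim (fc j) = j \<and> {0} \<subseteq> fc j \<and> cols (fc j) {0} = \<kappa> j"
        using h fF fm(2) unfolding Fl_def fc_def by (cases "j < m") auto
      then show "stable (fc j)" "dim (fc j) = j" "{0} \<subseteq> fc j" "cols (fc j) {0} = \<kappa> j" by auto
    next
      fix j assume j: "j \<in> {0..<dimV}"
      show "fc j \<subseteq> fc (Suc j)"
      proof (cases "j < m")
        case True
        then have "h j \<subseteq> h (Suc j)" "h m = f m" using h fm(2) unfolding Fl_def by auto
        then show ?thesis using True unfolding fc_def by (cases "Suc j = m") auto
      next
        case False
        then show ?thesis using fF j unfolding Fl_def fc_def by auto
      qed
    next
      show "fc dimV = UNIV" using fF b(2) unfolding Fl_def fc_def by auto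
    qed
    fix j assume j: "j \<in> {m..dimV}"
    have fj: "stable (f j)" using fF j unfolding Fl_def by auto
    have "rank k (f j) (f m) = rank k (f1 j) (f1 m)" for k
    proof (cases "k < N")
      case True
      have "rank k (f j) (f m) \<le> \<rho> k j" using ub[OF fcF, of m j k] j unfolding fc_def \<rho>_def by auto
      moreover have "\<rho> k j \<le> rank k (f j) (f m)" using f True j unfolding F'_def rank_locus_def
        by auto
      ultimately show ?thesis using f1rank[OF j] by simp
    next
      case False
      then show ?thesis using im_ge_N[of _ k] fj f1st[of j] f1st[of m] j fm(2) stable_subspace
        unfolding rank_def by auto
    qed
    then have "cols (f j) (f m) = cols (f1 j) (f1 m)" unfolding cols_def by simp
    then show "cols (f j) (f m) = gcols (boxes b m) m j" using f1(2)[of m j] Gm[OF j] j by auto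
  qed
  ultimately show ?thesis unfolding pm S_def by blast
qed

end

theorem corollary4p2:
  fixes smul :: "'a::field \<Rightarrow> 'b::ab_group_add \<Rightarrow> 'b"
    and Basis :: "'b set"
    and eta :: "'b \<Rightarrow> 'b"
    and lam mu nu :: partition
    and K :: "partition list"
    and P :: tableau
  assumes "infinite (UNIV :: 'a set)"
    and "finite_dimensional_vector_space smul Basis"
    and "Vector_Spaces.linear smul smul eta"
    and "\<exists>k. \<forall>v. (eta ^^ k) v = 0"
    and "jordan_type (total_space smul) eta = lam"
    and "K \<in> skew_chains lam mu"
    and "P \<in> tableaux nu"
    and "jdt K (tab_chain P)"
  shows "\<exists>F'. openin (subtopology (flag_topology smul (psize mu))
                (flags_of_chain smul eta (psize mu) K)) F' \<and>
           subtopology (flag_topology smul (psize mu))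
                (flags_of_chain smul eta (psize mu) K) closure_of F' =
             flags_of_chain smul eta (psize mu) K \<and>
           (\<forall>f\<in>F'. quotient_flag_tableau smul eta (psize mu) f = P)"
proof -
  obtain k where k: "\<And>v. (eta ^^ k) v = 0" using assms(4) by blast
  interpret nilpotent_endo smul Basis eta k
    by (intro nilpotent_endo.intro fin_dim_space.intro nilpotent_endo_axioms.intro assms(2,3) k)
  show ?thesis using generic_quotient_tableau[OF assms(1) _ assms(7,8)] assms(5,6) by blast
qed

end
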